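(* Let $(A,\theta)$ be an independence alphabet and $(B,Z)$ a partition of $A$. (i) One has the semidirect product decomposition $F(A,\theta)=F(B,\theta_B)\ltimes H_Z$, where $H_Z$ is the normal subgroup of $F(A,\theta)$ generated by $Z$. Moreover $H_Z$ is the subgroup generated by $\rho_Z(B)=\{w^{-1}zw\mid zw\in\beta_Z^R(\tilde B)\}$. (ii) The subgroup $H_Z$ is free partially commutative for the code $\rho_Z(B)$ and the commutations $\hat\theta_\rho=\{(t,t')\in\rho_Z(B)^2\mid tt'=t't\text{ and }t\ne t'\}$; i.e. the natural morphism $F(\rho_Z(B),\hat\theta_\rho)\to H_Z$ is an isomorphism. (iii) The natural mapping $\alpha:F(\beta_Z^R(\tilde B),\tilde\theta_{\beta_Z^R(\tilde B)})\to H_Z$, the group morphism with $\alpha(zw)=w^{-1}zw$ for $zw\in\beta_Z^R(\tilde B)$, is one-to-one (injective) if and only if $B$ is a TFSA of $(A,\theta)$.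
   Context: An independence alphabet $(A,\theta)$ is a set $A$ with a symmetric, antireflexive relation $\theta$. $M(A,\theta)=\langle A\mid ab=ba,\ (a,b)\in\theta\rangle$ is the free partially commutative monoid (elements: traces) and $F(A,\theta)=\langle A\mid ab=ba,\ (a,b)\in\theta\rangle_{gr}$ is the free partially commutative group. $\mathrm{Alph}(t)$ is the set of letters of $t$; $IA(t)=\{a\mid a\text{ a letter},\ t=aw\text{ for some }w\}$. For $X\subset M(A,\theta)$, $\theta_X=\{(x_1,x_2)\in X^2\mid\mathrm{Alph}(x_1)\times\mathrm{Alph}(x_2)\subset\theta\}$, and $X$ is a partially commutative code if the natural morphism $M(X,\theta_X)\to\langle X\rangle$ is an isomorphism. For $B\subset A$, $Z=A\setminus B$, $\beta_Z(B)=\{zw\mid z\in Z,\ w\in M(B,\theta_B),\ IA(zw)=\{z\}\}$; $B$ is a TFSA of $(A,\theta)$ if $\beta_Z(B)$ is a partially commutative code. $F(B,\theta_B)$ is identified with the subgroup of $F(A,\theta)$ generated by $B$. $\tilde A=A\cup\bar A$, where $\bar A=\{\bar a\}_{a\in A}$ is a disjoint copy of $A$, with involution $x\mapsto\bar x$; $\tilde B=B\cup\bar B$. $\tilde\theta=\{(x,y)\in\tilde A^2\mid\{(x,y),(\bar x,y),(x,\bar y),(\bar x,\bar y)\}\cap\theta\ne\emptyset\}$. $s:M(\tilde A,\tilde\theta)\to F(A,\theta)$ is the monoid morphism with $s(a)=a$, $s(\bar a)=a^{-1}$ for $a\in A$. Each $g\in F(A,\theta)$ has a unique preimage of minimal length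 under $s$, its reduced expression; $red(\tilde A,\tilde\theta)$ is the set of these traces. $\beta_Z(\tilde B)=\{zw\mid z\in Z,\ w\in M(\tilde B,\tilde\theta_{\tilde B}),\ IA(zw)=\{z\}\}$ ($IA$ in $M(\tilde A,\tilde\theta)$) and $\beta_Z^R(\tilde B)=\beta_Z(\tilde B)\cap red(\tilde A,\tilde\theta)$, with the commutation relation $\tilde\theta_{\beta_Z^R(\tilde B)}=\{(x_1,x_2)\in\beta_Z^R(\tilde B)^2\mid\mathrm{Alph}(x_1)\times\mathrm{Alph}(x_2)\subset\tilde\theta\}$. For $zw\in\beta^R_Z(\tilde B)$ with $z\in Z$, $w\in M(\tilde B,\tilde\theta_{\tilde B})$, $w^{-1}zw$ denotes $s(w)^{-1}zs(w)\in F(A,\theta)$. *)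

theory Defs
  imports HOL.Hull "HOL-Algebra.Generated_Groups"
begin

subsection \<open>Presentations\<close>

inductive_set pres_cong :: "('x list \<times> 'x list) set \<Rightarrow> ('x list \<times> 'x list) set"
  for R where
    rel: "(l, r) \<in> R \<Longrightarrow> (u @ l @ v, u @ r @ v) \<in> pres_cong R"
  | refl: "(u, u) \<in> pres_cong R"
  | sym: "(u, v) \<in> pres_cong R \<Longrightarrow> (v, u) \<in> pres_cong R"
  | trans: "(u, v) \<in> pres_cong R \<Longrightarrow> (v, w) \<in> pres_cong R \<Longrightarrow> (u, w) \<in> pres_cong R"

text \<open>The relators are always taken in \<open>lists S \<times> lists S\<close>, so that a class of a word over \<open>S\<close>
  consists of words over \<open>S\<close> only.\<close>

definition monoid_pres :: "'x set \<Rightarrow> ('x list \<times> 'x list) set \<Rightarrow> 'x list set monoid" where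
  "monoid_pres S R =
     \<lparr>carrier = lists S // pres_cong R,
      mult = (\<lambda>s t. pres_cong R `` {u @ v | u v. u \<in> s \<and> v \<in> t}),
      one = pres_cong R `` {[]}\<rparr>"

definition word_eval :: "('g, 'b) monoid_scheme \<Rightarrow> ('x \<Rightarrow> 'g) \<Rightarrow> 'x list \<Rightarrow> 'g" where
  "word_eval G f w = foldr (\<lambda>x g. f x \<otimes>\<^bsub>G\<^esub> g) w \<one>\<^bsub>G\<^esub>"

text \<open>The morphism induced by \<open>f\<close> on a presented monoid: the common value of \<open>f\<close> on all the words
  of a class, provided that \<open>f\<close> respects the relators.\<close>

definition pres_lift :: "('g, 'b) monoid_scheme \<Rightarrow> ('x \<Rightarrow> 'g) \<Rightarrow> 'x list set \<Rightarrow> 'g" where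
  "pres_lift G f t = the_elem (word_eval G f ` t)"

subsection \<open>Free partially commutative monoids\<close>

definition independence_alphabet :: "'x set \<Rightarrow> ('x \<times> 'x) set \<Rightarrow> bool" where
  "independence_alphabet A \<theta> \<longleftrightarrow> \<theta> \<subseteq> A \<times> A \<and> sym \<theta> \<and> irrefl \<theta>"

definition comm_rels :: "('x \<times> 'x) set \<Rightarrow> ('x list \<times> 'x list) set" where
  "comm_rels \<theta> = {([a, b], [b, a]) | a b. (a, b) \<in> \<theta>}"

definition pc_monoid :: "'x set \<Rightarrow> ('x \<times> 'x) set \<Rightarrow> 'x list set monoid" where
  "pc_monoid A \<theta> = monoid_pres A (comm_rels \<theta>)"

definition letter :: "('x \<times> 'x) set \<Rightarrow> 'x \<Rightarrow> 'x list set" where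
  "letter \<theta> a = pres_cong (comm_rels \<theta>) `` {[a]}"

definition Alph :: "'x list set \<Rightarrow> 'x set" where
  "Alph t = (\<Union>w\<in>t. set w)"

text \<open>All the words of a trace have the same length.\<close>

definition trace_length :: "'x list set \<Rightarrow> nat" where
  "trace_length t = the_elem (length ` t)"

definition IA :: "'x set \<Rightarrow> ('x \<times> 'x) set \<Rightarrow> 'x list set \<Rightarrow> 'x set" where
  "IA A \<theta> t =
     {a \<in> A. \<exists>w\<in>carrier (pc_monoid A \<theta>). t = letter \<theta> a \<otimes>\<^bsub>pc_monoid A \<theta>\<^esub> w}"

definition restr :: "('x \<times> 'x) set \<Rightarrow> 'x set \<Rightarrow> ('x \<times> 'x) set" where
  "restr \<theta> B = \<theta> \<inter> B \<times> B"

definition induced_indep :: "('x \<times> 'x) set \<Rightarrow> 'x list set set \<Rightarrow> ('x list set \<times> 'x list set) set" where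
  "induced_indep \<theta> X = {(x, y) \<in> X \<times> X. Alph x \<times> Alph y \<subseteq> \<theta>}"

definition pc_code :: "'x set \<Rightarrow> ('x \<times> 'x) set \<Rightarrow> 'x list set set \<Rightarrow> bool" where
  "pc_code A \<theta> X \<longleftrightarrow>
     (\<exists>\<phi> \<in> iso (pc_monoid X (induced_indep \<theta> X))
              ((pc_monoid A \<theta>)\<lparr>carrier := (\<lambda>N. submonoid N (pc_monoid A \<theta>)) hull X\<rparr>).
        \<forall>x\<in>X. \<phi> (letter (induced_indep \<theta> X) x) = x)"

text \<open>For words over \<open>B\<close> the classes modulo \<open>restr \<theta> B\<close> and modulo \<open>\<theta>\<close> are the same sets
  (lemma \<open>carrier_pc_monoid_restr\<close>), so that \<open>M(B, \<theta>\<^sub>B)\<close> is literally contained in \<open>M(A, \<theta>)\<close>.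
  The set \<open>Z\<close> is a separate argument because for \<open>B \<union> bar B\<close> it is not the complement.\<close>

definition beta :: "'x set \<Rightarrow> ('x \<times> 'x) set \<Rightarrow> 'x set \<Rightarrow> 'x set \<Rightarrow> 'x list set set" where
  "beta A \<theta> Z B =
     {letter \<theta> z \<otimes>\<^bsub>pc_monoid A \<theta>\<^esub> w | z w.
        z \<in> Z \<and> w \<in> carrier (pc_monoid B (restr \<theta> B)) \<and>
        IA A \<theta> (letter \<theta> z \<otimes>\<^bsub>pc_monoid A \<theta>\<^esub> w) = {z}}"

definition TFSA :: "'x set \<Rightarrow> ('x \<times> 'x) set \<Rightarrow> 'x set \<Rightarrow> bool" where
  "TFSA A \<theta> B \<longleftrightarrow> B \<subseteq> A \<and> pc_code A \<theta> (beta A \<theta> (A - B) B)"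

subsection \<open>Free partially commutative groups\<close>

datatype 'a sletter = Gen 'a | Bar 'a

fun bar :: "'a sletter \<Rightarrow> 'a sletter" where
  "bar (Gen a) = Bar a"
| "bar (Bar a) = Gen a"

definition tilde :: "'a set \<Rightarrow> 'a sletter set" where
  "tilde A = Gen ` A \<union> Bar ` A"

definition tilde_indep :: "'a set \<Rightarrow> ('a \<times> 'a) set \<Rightarrow> ('a sletter \<times> 'a sletter) set" where
  "tilde_indep A \<theta> = {(x, y) \<in> tilde A \<times> tilde A.
     {(x, y), (bar x, y), (x, bar y), (bar x, bar y)} \<inter> map_prod Gen Gen ` \<theta> \<noteq> {}}"

definition pc_group_rels :: "'a set \<Rightarrow> ('a \<times> 'a) set \<Rightarrow> ('a sletter list \<times> 'a sletter list) set" where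
  "pc_group_rels A \<theta> =
     comm_rels (map_prod Gen Gen ` \<theta>) \<union> {([x, bar x], []) | x. x \<in> tilde A}"

definition pc_group :: "'a set \<Rightarrow> ('a \<times> 'a) set \<Rightarrow> 'a sletter list set monoid" where
  "pc_group A \<theta> = monoid_pres (tilde A) (pc_group_rels A \<theta>)"

definition gen :: "'a set \<Rightarrow> ('a \<times> 'a) set \<Rightarrow> 'a \<Rightarrow> 'a sletter list set" where
  "gen A \<theta> a = pres_cong (pc_group_rels A \<theta>) `` {[Gen a]}"

abbreviation tilde_monoid :: "'a set \<Rightarrow> ('a \<times> 'a) set \<Rightarrow> 'a sletter list set monoid" where
  "tilde_monoid A \<theta> \<equiv> pc_monoid (tilde A) (tilde_indep A \<theta>)"

definition s_map :: "'a set \<Rightarrow> ('a \<times> 'a) set \<Rightarrow> 'a sletter list set \<Rightarrow> 'a sletter list set" where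
  "s_map A \<theta> = pres_lift (pc_group A \<theta>)
     (\<lambda>x. case x of Gen a \<Rightarrow> gen A \<theta> a | Bar a \<Rightarrow> inv\<^bsub>pc_group A \<theta>\<^esub> gen A \<theta> a)"

definition red :: "'a set \<Rightarrow> ('a \<times> 'a) set \<Rightarrow> 'a sletter list set set" where
  "red A \<theta> = {t \<in> carrier (tilde_monoid A \<theta>).
     \<forall>t'\<in>carrier (tilde_monoid A \<theta>).
       s_map A \<theta> t' = s_map A \<theta> t \<longrightarrow> trace_length t \<le> trace_length t'}"

definition betaR :: "'a set \<Rightarrow> ('a \<times> 'a) set \<Rightarrow> 'a set \<Rightarrow> 'a set \<Rightarrow> 'a sletter list set set" where
  "betaR A \<theta> Z B = beta (tilde A) (tilde_indep A \<theta>) (Gen ` Z) (tilde B) \<inter> red A \<theta>"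

text \<open>The pairs \<open>(z, w)\<close> for which the trace \<open>z w\<close> lies in \<open>betaR\<close>, that trace, and the
  conjugate \<open>s(w)\<inverse> z s(w)\<close>.\<close>

definition zw_trace :: "'a set \<Rightarrow> ('a \<times> 'a) set \<Rightarrow> 'a \<Rightarrow> 'a sletter list set \<Rightarrow> 'a sletter list set" where
  "zw_trace A \<theta> z w = letter (tilde_indep A \<theta>) (Gen z) \<otimes>\<^bsub>tilde_monoid A \<theta>\<^esub> w"

definition zw_pairs :: "'a set \<Rightarrow> ('a \<times> 'a) set \<Rightarrow> 'a set \<Rightarrow> 'a set \<Rightarrow> ('a \<times> 'a sletter list set) set" where
  "zw_pairs A \<theta> Z B = {(z, w).
     z \<in> Z \<and> w \<in> carrier (pc_monoid (tilde B) (restr (tilde_indep A \<theta>) (tilde B))) \<and>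
     zw_trace A \<theta> z w \<in> betaR A \<theta> Z B}"

definition zw_conj :: "'a set \<Rightarrow> ('a \<times> 'a) set \<Rightarrow> 'a \<Rightarrow> 'a sletter list set \<Rightarrow> 'a sletter list set" where
  "zw_conj A \<theta> z w =
     inv\<^bsub>pc_group A \<theta>\<^esub> (s_map A \<theta> w) \<otimes>\<^bsub>pc_group A \<theta>\<^esub> gen A \<theta> z \<otimes>\<^bsub>pc_group A \<theta>\<^esub> s_map A \<theta> w"

definition rho :: "'a set \<Rightarrow> ('a \<times> 'a) set \<Rightarrow> 'a set \<Rightarrow> 'a set \<Rightarrow> 'a sletter list set set" where
  "rho A \<theta> Z B = {zw_conj A \<theta> z w | z w. (z, w) \<in> zw_pairs A \<theta> Z B}"

definition rho_indep :: "'a set \<Rightarrow> ('a \<times> 'a) set \<Rightarrow> 'a set \<Rightarrow> 'a set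
    \<Rightarrow> ('a sletter list set \<times> 'a sletter list set) set" where
  "rho_indep A \<theta> Z B = {(t, t') \<in> rho A \<theta> Z B \<times> rho A \<theta> Z B.
     t \<otimes>\<^bsub>pc_group A \<theta>\<^esub> t' = t' \<otimes>\<^bsub>pc_group A \<theta>\<^esub> t \<and> t \<noteq> t'}"

definition H_Z :: "'a set \<Rightarrow> ('a \<times> 'a) set \<Rightarrow> 'a set \<Rightarrow> 'a sletter list set set" where
  "H_Z A \<theta> Z = (\<lambda>N. N \<lhd> pc_group A \<theta>) hull (gen A \<theta> ` Z)"

definition H_group :: "'a set \<Rightarrow> ('a \<times> 'a) set \<Rightarrow> 'a set \<Rightarrow> 'a sletter list set monoid" where
  "H_group A \<theta> Z = (pc_group A \<theta>)\<lparr>carrier := H_Z A \<theta> Z\<rparr>"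

definition internal_semidirect :: "('g, 'b) monoid_scheme \<Rightarrow> 'g set \<Rightarrow> 'g set \<Rightarrow> bool" where
  "internal_semidirect G K N \<longleftrightarrow>
     subgroup K G \<and> N \<lhd> G \<and> K <#>\<^bsub>G\<^esub> N = carrier G \<and> K \<inter> N = {\<one>\<^bsub>G\<^esub>}"

subsection \<open>Basic facts\<close>

lemma equiv_pres_cong: "equiv UNIV (pres_cong R)"
  by (rule equivI) (auto simp: refl_on_def sym_def trans_def intro: pres_cong.intros)

lemma pres_cong_context: "(u, v) \<in> pres_cong R \<Longrightarrow> (p @ u @ q, p @ v @ q) \<in> pres_cong R"
proof (induction rule: pres_cong.induct)
  case (rel l r u v)
  then show ?case using pres_cong.rel[of l r R "p @ u" "v @ q"] by simp
qed (blast intro: pres_cong.intros)+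

lemma pres_cong_append:
  assumes "(u, u') \<in> pres_cong R" "(v, v') \<in> pres_cong R"
  shows "(u @ v, u' @ v') \<in> pres_cong R"
  using pres_cong_context[OF assms(1), of "[]" v] pres_cong_context[OF assms(2), of u' "[]"]
  by (auto intro: pres_cong.trans)

lemma pres_class_eq_iff:
  "pres_cong R `` {u} = pres_cong R `` {v} \<longleftrightarrow> (u, v) \<in> pres_cong R"
  using eq_equiv_class_iff[OF equiv_pres_cong] by auto

lemma pres_mult_class:
  "pres_cong R `` {u} \<otimes>\<^bsub>monoid_pres S R\<^esub> pres_cong R `` {v} = pres_cong R `` {u @ v}"
  unfolding monoid_pres_def
  by (auto intro: pres_cong.trans pres_cong_append pres_cong.refl)

lemma monoid_pres_carrierE:
  assumes "t \<in> carrier (monoid_pres S R)"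
  obtains w where "w \<in> lists S" "t = pres_cong R `` {w}"
  using assms by (auto simp: monoid_pres_def quotient_def)

lemma pres_class_in_carrier:
  "w \<in> lists S \<Longrightarrow> pres_cong R `` {w} \<in> carrier (monoid_pres S R)"
  by (auto simp: monoid_pres_def quotient_def)

lemma one_monoid_pres: "\<one>\<^bsub>monoid_pres S R\<^esub> = pres_cong R `` {[]}"
  by (simp add: monoid_pres_def)

lemma monoid_monoid_pres: "Group.monoid (monoid_pres S R)"
proof (rule monoidI)
  show "\<one>\<^bsub>monoid_pres S R\<^esub> \<in> carrier (monoid_pres S R)"
    by (simp add: one_monoid_pres pres_class_in_carrier)
qed (auto elim!: monoid_pres_carrierE simp: pres_mult_class one_monoid_pres
      intro!: pres_class_in_carrier)

lemma monoid_pc_monoid: "Group.monoid (pc_monoid A \<theta>)"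
  by (simp add: pc_monoid_def monoid_monoid_pres)

lemma group_pc_group: "group (pc_group A \<theta>)"
proof -
  let ?R = "pc_group_rels A \<theta>" and ?F = "pc_group A \<theta>"
  interpret Group.monoid ?F by (simp add: pc_group_def monoid_monoid_pres)
  have bar: "bar x \<in> tilde A" "bar (bar x) = x" if "x \<in> tilde A" for x
    using that by (cases x; auto simp: tilde_def)+
  have "\<exists>v\<in>lists (tilde A). (v @ w, []) \<in> pres_cong ?R" if "w \<in> lists (tilde A)" for w
    using that
  proof induction
    case Nil
    then show ?case by (auto intro: pres_cong.refl)
  next
    case (Cons x w)
    then obtain v where v: "v \<in> lists (tilde A)" "(v @ w, []) \<in> pres_cong ?R" by blast
    have "([bar x, x], []) \<in> ?R"
      unfolding pc_group_rels_def using bar[OF Cons.hyps(1)] by force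
    from pres_cong.rel[OF this, of v w] v(2)
    have "((v @ [bar x]) @ x # w, []) \<in> pres_cong ?R"
      by (auto intro: pres_cong.trans)
    then show ?case using v(1) bar[OF Cons.hyps(1)]
      by (intro bexI[of _ "v @ [bar x]"]) auto
  qed
  then have "\<exists>y\<in>carrier ?F. y \<otimes>\<^bsub>?F\<^esub> x = \<one>\<^bsub>?F\<^esub>" if "x \<in> carrier ?F" for x
    using that unfolding pc_group_def one_monoid_pres
    by (elim monoid_pres_carrierE)
       (metis pres_class_eq_iff pres_class_in_carrier pres_mult_class)
  then show ?thesis by (intro groupI) (auto simp: m_assoc)
qed

lemma pres_cong_mono:
  assumes "R \<subseteq> R'" "(u, v) \<in> pres_cong R"
  shows "(u, v) \<in> pres_cong R'"
  using assms(2) assms(1) by induction (auto intro: pres_cong.intros)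

lemma comm_cong_same:
  assumes "(u, v) \<in> pres_cong (comm_rels \<theta>)"
  shows "set u = set v" "length u = length v"
  using assms by induction (auto simp: comm_rels_def)

lemma comm_cong_restr:
  assumes "(u, v) \<in> pres_cong (comm_rels \<theta>)" "set u \<subseteq> B"
  shows "(u, v) \<in> pres_cong (comm_rels (restr \<theta> B))"
  using assms
proof induction
  case (rel l r u v)
  then have "(l, r) \<in> comm_rels (restr \<theta> B)" by (auto simp: comm_rels_def restr_def)
  then show ?case by (rule pres_cong.rel)
qed (use comm_cong_same(1) in \<open>blast intro: pres_cong.intros\<close>)+

lemma letter_class_restr:
  assumes "w \<in> lists B"
  shows "pres_cong (comm_rels (restr \<theta> B)) `` {w} = pres_cong (comm_rels \<theta>) `` {w}"
proof -
  have "comm_rels (restr \<theta> B) \<subseteq> comm_rels \<theta>"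
    by (auto simp: comm_rels_def restr_def)
  then show ?thesis
    using assms comm_cong_restr[of w _ \<theta> B] pres_cong_mono by (auto simp: lists_eq_set)
qed

lemma carrier_pc_monoid_restr:
  assumes "B \<subseteq> A"
  shows "carrier (pc_monoid B (restr \<theta> B)) \<subseteq> carrier (pc_monoid A \<theta>)"
proof
  fix t assume "t \<in> carrier (pc_monoid B (restr \<theta> B))"
  then obtain w where "w \<in> lists B" "t = pres_cong (comm_rels (restr \<theta> B)) `` {w}"
    unfolding pc_monoid_def by (elim monoid_pres_carrierE)
  with lists_mono[OF assms] show "t \<in> carrier (pc_monoid A \<theta>)"
    by (auto simp: pc_monoid_def letter_class_restr intro!: pres_class_in_carrier)
qed

lemma trace_length_class: "trace_length (pres_cong (comm_rels \<theta>) `` {w}) = length w"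
proof -
  have "length ` (pres_cong (comm_rels \<theta>) `` {w}) = {length w}"
    using comm_cong_same(2)[of w _ \<theta>] by (auto simp: image_iff intro: pres_cong.refl)
  then show ?thesis by (simp add: trace_length_def)
qed

lemma (in Group.monoid) word_eval_closed:
  assumes "f ` S \<subseteq> carrier G" "w \<in> lists S"
  shows "word_eval G f w \<in> carrier G"
  using assms(2,1) by induction (auto simp: word_eval_def)

lemma (in Group.monoid) word_eval_append:
  assumes "f ` S \<subseteq> carrier G" "u \<in> lists S" "v \<in> lists S"
  shows "word_eval G f (u @ v) = word_eval G f u \<otimes> word_eval G f v"
  using assms(2)
proof induction
  case Nil
  then show ?case using word_eval_closed[OF assms(1,3)] by (simp add: word_eval_def)
next
  case (Cons x u)
  then show ?case
    using word_eval_closed[OF assms(1,3)] word_eval_closed[OF assms(1), of u] assms(1)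
    by (auto simp: word_eval_def image_subset_iff m_assoc)
qed

text \<open>The universal property of a presentation.\<close>

lemma (in Group.monoid) pres_lift_class:
  assumes f: "f ` S \<subseteq> carrier G"
    and iff: "\<And>u l r v. (l, r) \<in> R \<Longrightarrow> u @ l @ v \<in> lists S \<longleftrightarrow> u @ r @ v \<in> lists S"
    and resp: "\<And>l r. (l, r) \<in> R \<Longrightarrow> word_eval G f l = word_eval G f r"
    and R: "R \<subseteq> lists S \<times> lists S"
    and w: "w \<in> lists S"
  shows "pres_lift G f (pres_cong R `` {w}) = word_eval G f w"
proof -
  have "(u \<in> lists S \<longleftrightarrow> v \<in> lists S) \<and> (u \<in> lists S \<longrightarrow> word_eval G f u = word_eval G f v)"
    if "(u, v) \<in> pres_cong R" for u v
    using that
  proof induction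
    case (rel l r u v)
    have *: "l \<in> lists S" "r \<in> lists S" using R rel by auto
    show ?case
    proof (intro conjI impI)
      show "u @ l @ v \<in> lists S \<longleftrightarrow> u @ r @ v \<in> lists S" using iff[OF rel] .
      assume "u @ l @ v \<in> lists S"
      then have "u \<in> lists S" "v \<in> lists S" by auto
      then show "word_eval G f (u @ l @ v) = word_eval G f (u @ r @ v)"
        using * resp[OF rel] word_eval_append[OF f] by (metis append_in_lists_conv)
    qed
  qed auto
  then have "word_eval G f v = word_eval G f w" if "(w, v) \<in> pres_cong R" for v
    using w that by metis
  then have "word_eval G f ` (pres_cong R `` {w}) = {word_eval G f w}"
    by (auto simp: image_iff intro: pres_cong.refl)
  then show ?thesis by (simp add: pres_lift_def)
qed

lemma inv_gen:
  assumes "a \<in> A"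
  shows "inv\<^bsub>pc_group A \<theta>\<^esub> gen A \<theta> a = pres_cong (pc_group_rels A \<theta>) `` {[Bar a]}"
proof -
  let ?R = "pc_group_rels A \<theta>"
  interpret group "pc_group A \<theta>" by (rule group_pc_group)
  have "bar (Bar a) = Gen a" "Bar a \<in> tilde A" using assms by (auto simp: tilde_def)
  then have "([Bar a, Gen a], []) \<in> ?R"
    unfolding pc_group_rels_def by force
  from pres_cong.rel[OF this, of "[]" "[]"]
  have "pres_cong ?R `` {[Bar a]} \<otimes>\<^bsub>pc_group A \<theta>\<^esub> gen A \<theta> a = \<one>\<^bsub>pc_group A \<theta>\<^esub>"
    by (simp add: gen_def pc_group_def pres_mult_class one_monoid_pres pres_class_eq_iff)
  moreover have "pres_cong ?R `` {[Bar a]} \<in> carrier (pc_group A \<theta>)"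
      "gen A \<theta> a \<in> carrier (pc_group A \<theta>)"
    using assms by (auto simp: gen_def pc_group_def tilde_def intro!: pres_class_in_carrier)
  ultimately show ?thesis by (simp add: inv_equality)
qed

lemma sletter_class:
  assumes "x \<in> tilde A"
  shows "(case x of Gen a \<Rightarrow> gen A \<theta> a | Bar a \<Rightarrow> inv\<^bsub>pc_group A \<theta>\<^esub> gen A \<theta> a)
    = pres_cong (pc_group_rels A \<theta>) `` {[x]}"
  using assms inv_gen[of _ A \<theta>] by (cases x) (auto simp: tilde_def gen_def)

text \<open>In particular \<open>s_map\<close> is a well-defined morphism with the prescribed values.\<close>

lemma s_map_class:
  assumes \<theta>: "independence_alphabet A \<theta>" and w: "w \<in> lists (tilde A)"
  shows "s_map A \<theta> (pres_cong (comm_rels (tilde_indep A \<theta>)) `` {w})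
    = pres_cong (pc_group_rels A \<theta>) `` {w}"
proof -
  let ?R = "pc_group_rels A \<theta>" and ?F = "pc_group A \<theta>" and ?M = "comm_rels (tilde_indep A \<theta>)"
  let ?f = "\<lambda>x. case x of Gen a \<Rightarrow> gen A \<theta> a | Bar a \<Rightarrow> inv\<^bsub>?F\<^esub> gen A \<theta> a"
  interpret F: group ?F by (rule group_pc_group)
  have eval: "word_eval ?F ?f w = pres_cong ?R `` {w}" if "w \<in> lists (tilde A)" for w
    using that
  proof induction
    case Nil
    then show ?case by (simp add: word_eval_def pc_group_def one_monoid_pres)
  next
    case (Cons x w)
    have "word_eval ?F ?f (x # w) = ?f x \<otimes>\<^bsub>?F\<^esub> word_eval ?F ?f w"
      by (simp add: word_eval_def)
    also have "\<dots> = pres_cong ?R `` {[x]} \<otimes>\<^bsub>?F\<^esub> pres_cong ?R `` {w}"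
      using sletter_class[OF Cons.hyps(1)] Cons.IH by simp
    finally show ?case by (simp add: pc_group_def pres_mult_class)
  qed
  have fc: "?f ` tilde A \<subseteq> carrier ?F"
    using sletter_class[of _ A \<theta>] by (auto simp: pc_group_def intro!: pres_class_in_carrier)
  have gc: "gen A \<theta> a \<in> carrier ?F" if "a \<in> A" for a
    using that by (auto simp: gen_def pc_group_def tilde_def intro!: pres_class_in_carrier)
  have comm: "gen A \<theta> a \<otimes>\<^bsub>?F\<^esub> gen A \<theta> b = gen A \<theta> b \<otimes>\<^bsub>?F\<^esub> gen A \<theta> a"
    if "(a, b) \<in> \<theta>" for a b
  proof -
    have "([Gen a, Gen b], [Gen b, Gen a]) \<in> ?R"
      using that by (auto simp: pc_group_rels_def comm_rels_def)
    from pres_cong.rel[OF this, of "[]" "[]"] show ?thesis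
      by (simp add: gen_def pc_group_def pres_mult_class pres_class_eq_iff)
  qed
  have ci: "inv\<^bsub>?F\<^esub> g \<otimes>\<^bsub>?F\<^esub> h = h \<otimes>\<^bsub>?F\<^esub> inv\<^bsub>?F\<^esub> g"
    if "g \<otimes>\<^bsub>?F\<^esub> h = h \<otimes>\<^bsub>?F\<^esub> g" "g \<in> carrier ?F" "h \<in> carrier ?F" for g h
    using that by (metis F.inv_closed F.inv_solve_left F.inv_solve_right F.m_assoc F.m_closed)
  have fcomm: "?f x \<otimes>\<^bsub>?F\<^esub> ?f y = ?f y \<otimes>\<^bsub>?F\<^esub> ?f x" if xy: "(x, y) \<in> tilde_indep A \<theta>" for x y
  proof -
    obtain a b where ab: "(a, b) \<in> \<theta>" "x = Gen a \<or> x = Bar a" "y = Gen b \<or> y = Bar b"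
      using xy by (cases x; cases y) (auto simp: tilde_indep_def)
    then have "a \<in> A" "b \<in> A" using \<theta> by (auto simp: independence_alphabet_def)
    note c = gc[OF this(1)] gc[OF this(2)]
    note 1 = comm[OF ab(1)]
    note 2 = ci[OF 1 c]
    note 3 = ci[OF 1[symmetric] c(2,1)]
    note 4 = ci[OF 3[symmetric] c(1) F.inv_closed[OF c(2)]]
    show ?thesis using ab(2,3) 1 2 3 4 by auto
  qed
  have "s_map A \<theta> (pres_cong ?M `` {w}) = word_eval ?F ?f w"
    unfolding s_map_def
  proof (rule F.pres_lift_class[OF fc _ _ _ w])
    show R: "?M \<subseteq> lists (tilde A) \<times> lists (tilde A)"
      by (auto simp: comm_rels_def tilde_indep_def)
    show "u @ l @ v \<in> lists (tilde A) \<longleftrightarrow> u @ r @ v \<in> lists (tilde A)" if "(l, r) \<in> ?M" for u l r v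
      using R that by auto
    show "word_eval ?F ?f l = word_eval ?F ?f r" if lr: "(l, r) \<in> ?M" for l r
    proof -
      obtain x y where xy: "l = [x, y]" "r = [y, x]" "(x, y) \<in> tilde_indep A \<theta>"
        using lr by (auto simp: comm_rels_def)
      then have "?f x \<in> carrier ?F" "?f y \<in> carrier ?F"
        using fc by (auto simp: tilde_indep_def)
      then show ?thesis using fcomm[OF xy(3)] by (simp add: xy word_eval_def del: sletter.case)
    qed
  qed
  then show ?thesis using eval[OF w] by simp
qed

text \<open>A morphism out of a free partially commutative group is determined by its values on the
  generators, hence an existential quantifier over such morphisms with prescribed values on the
  generators designates the natural morphism. The same holds for the monoid isomorphism in
  \<open>pc_code\<close>.\<close>

lemma pc_group_hom_unique:
  assumes "group G" "f \<in> hom (pc_group A \<theta>) G" "g \<in> hom (pc_group A \<theta>) G"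
    and eq: "\<And>a. a \<in> A \<Longrightarrow> f (gen A \<theta> a) = g (gen A \<theta> a)"
    and t: "t \<in> carrier (pc_group A \<theta>)"
  shows "f t = g t"
proof -
  let ?R = "pc_group_rels A \<theta>" and ?F = "pc_group A \<theta>"
  interpret f: group_hom ?F G f
    using assms group_pc_group by (auto simp: group_hom_def group_hom_axioms_def)
  interpret g: group_hom ?F G g
    using assms group_pc_group by (auto simp: group_hom_def group_hom_axioms_def)
  have x: "f (pres_cong ?R `` {[x]}) = g (pres_cong ?R `` {[x]})" if "x \<in> tilde A" for x
  proof (cases x)
    case (Gen a)
    then show ?thesis using eq[of a] that by (auto simp: gen_def tilde_def)
  next
    case (Bar a)
    then have a: "a \<in> A" using that by (auto simp: tilde_def)
    then have "gen A \<theta> a \<in> carrier ?F"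
      by (auto simp: gen_def pc_group_def tilde_def intro!: pres_class_in_carrier)
    then show ?thesis using f.hom_inv g.hom_inv eq[OF a] inv_gen[OF a, of \<theta>] Bar by metis
  qed
  obtain w where w: "w \<in> lists (tilde A)" "t = pres_cong ?R `` {w}"
    using t unfolding pc_group_def by (elim monoid_pres_carrierE)
  have "f (pres_cong ?R `` {w}) = g (pres_cong ?R `` {w})"
    using w(1)
  proof induction
    case Nil
    then show ?case using f.hom_one g.hom_one by (simp add: pc_group_def one_monoid_pres)
  next
    case (Cons y w)
    have c: "pres_cong ?R `` {[y]} \<in> carrier ?F" "pres_cong ?R `` {w} \<in> carrier ?F"
      using Cons by (auto simp: pc_group_def intro!: pres_class_in_carrier)
    have m: "pres_cong ?R `` {y # w} = pres_cong ?R `` {[y]} \<otimes>\<^bsub>?F\<^esub> pres_cong ?R `` {w}"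
      by (simp add: pc_group_def pres_mult_class)
    show ?case using f.hom_mult[OF c] g.hom_mult[OF c] x[OF Cons.hyps(1)] Cons.IH
      by (simp add: m)
  qed
  then show ?thesis by (simp add: w)
qed

end

theory Submission
  imports Defs
begin

text \<open>Killing the generators in \<open>Z\<close> retracts \<open>F(A, \<theta>)\<close> onto the subgroup generated by \<open>B\<close>. The
  kernel \<open>N\<close> of this retraction gives the semidirect decomposition, and everything rests on
  recognizing \<open>N\<close> as a free partially commutative group.

  Read a word from the right and move every letter of \<open>Z\<close> to the right end, conjugating it by the
  letters of \<open>B\<close> that it passes. This writes each element as (its \<open>B\<close>-part) times a product of
  conjugates \<open>u\<inverse> z u\<close>, with \<open>z \<in> Z\<close> and \<open>u\<close> a word over \<open>B\<close> and its inverses. The function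
  \<open>schreier\<close> returns this product as a word in the conjugates. Deleting \<open>x x\<inverse>\<close> or swapping two
  independent letters of the original word changes the resulting word only by cancellations and by
  the commutations between \<open>u\<inverse> z u\<close> and \<open>u\<inverse> z' u\<close> with \<open>(z, z') \<in> \<theta>\<close> and the same \<open>u\<close>
  (\<open>schreier_cong\<close>). So rewriting is a left inverse of evaluation (\<open>conj_eval_inj\<close>), and \<open>N\<close> is free
  partially commutative on the conjugates for these commutations (\<open>conj_indep\<close>). Since distinct
  generators of a free partially commutative group commute only if they are independent
  (\<open>gen_commuteD\<close>), these are all the commutations between distinct conjugates. Being generated by
  conjugates of elements of \<open>Z\<close>, the kernel \<open>N\<close> is \<open>H_Z\<close>. This proves that \<open>H_Z\<close> is
  free partially commutative for all these commutations, once the conjugates are known to be the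
  elements of \<open>rho\<close>.

  The set \<open>betaR\<close> indexes the conjugates without repetition. A conjugate \<open>u\<inverse> z u\<close> depends only on
  the coset of \<open>u\<close> modulo the letters of \<open>B\<close> that commute with \<open>z\<close>, and \<open>z w\<close> lies in \<open>betaR\<close> just if
  \<open>w\<close> is reduced and no first letter of \<open>w\<close> commutes with \<open>z\<close>. A shortest word of the coset has this
  property (\<open>minimal_exists\<close>), and only one trace in the coset has it (\<open>minimal_unique\<close>). Uniqueness
  uses the normal form theorem \<open>irreducible_unique\<close> for free partially commutative groups, proved by
  letting the group act on irreducible traces.

  Injectivity of \<open>\<alpha>\<close> and the TFSA property are both equivalent to a condition \<open>separated\<close> on the graph
  of non-commuting letters: if \<open>z, z' \<in> Z\<close> commute, then \<open>z\<close> commutes with every letter reached from \<open>z'\<close> along a path of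
  non-commuting letters of \<open>B\<close>. If it holds, then \<open>z w\<close> and \<open>z' w'\<close> have independent alphabets
  whenever \<open>z\<close> and \<open>z'\<close> commute, so the commutations of \<open>betaR\<close> are those of \<open>rho\<close> and \<open>\<alpha>\<close> is injective;
  for the same reason factorizations over \<open>beta\<close> are unique up to commutation. If it fails, take a
  path from \<open>z'\<close> through \<open>c\<close> to a first letter \<open>b\<close> that does not commute with \<open>z\<close>. Then
  \<open>z \<cdot> (z' c b) = (z' c) \<cdot> (z b)\<close> is a double factorization over \<open>beta\<close>, and \<open>\<alpha>\<close> maps the
  non-commuting generators \<open>z b\<close> and \<open>z' c b\<close> to \<open>(c b)\<inverse> z (c b)\<close> and \<open>(c b)\<inverse> z' (c b)\<close>, which commute.\<close>

section \<open>Traces and their initial letters\<close>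

abbreviation trace :: "('x \<times> 'x) set \<Rightarrow> 'x list \<Rightarrow> 'x list set" where
  "trace \<eta> w \<equiv> pres_cong (comm_rels \<eta>) `` {w}"

text \<open>A letter \<open>x\<close> is initial in a word if it can be moved to the front by commutations, that is, if it
  commutes with everything before its first occurrence. This is the word-level form of membership
  in \<open>IA\<close> and a substitute for Levi's lemma: traces are compared by stripping initial letters.\<close>

fun initial :: "('x \<times> 'x) set \<Rightarrow> 'x \<Rightarrow> 'x list \<Rightarrow> bool" where
  "initial \<eta> x [] \<longleftrightarrow> False"
| "initial \<eta> x (y # w) \<longleftrightarrow> x = y \<or> (y, x) \<in> \<eta> \<and> initial \<eta> x w"

lemma pres_cong_Cons: "(u, v) \<in> pres_cong R \<Longrightarrow> (x # u, x # v) \<in> pres_cong R"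
  using pres_cong_context[of u v R "[x]" "[]"] by simp

lemma pres_cong_map_words:
  assumes "(u, v) \<in> pres_cong R"
    and "\<And>u v. f (u @ v) = f u @ f v"
    and "\<And>l r. (l, r) \<in> R \<Longrightarrow> (f l, f r) \<in> pres_cong R'"
  shows "(f u, f v) \<in> pres_cong R'"
  using assms(1)
proof induction
  case (rel l r u v)
  then show ?case using pres_cong_context[OF assms(3)] by (simp add: assms(2))
qed (blast intro: pres_cong.intros)+

lemma trace_swap:
  "(x, y) \<in> \<eta> \<Longrightarrow> (x # y # w, y # x # w) \<in> pres_cong (comm_rels \<eta>)"
  using pres_cong.rel[of "[x, y]" "[y, x]" "comm_rels \<eta>" "[]" w] by (auto simp: comm_rels_def)

lemma initial_append:
  "initial \<eta> x (u @ v) \<longleftrightarrow> initial \<eta> x u \<or> (\<forall>y\<in>set u. (y, x) \<in> \<eta>) \<and> initial \<eta> x v"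
  by (induction u) auto

lemma initial_in_set: "initial \<eta> x w \<Longrightarrow> x \<in> set w"
  by (induction w) auto

lemma initial_cong:
  assumes "sym \<eta>" "(u, v) \<in> pres_cong (comm_rels \<eta>)"
  shows "initial \<eta> x u \<longleftrightarrow> initial \<eta> x v"
  using assms(2)
proof induction
  case (rel l r u v)
  then show ?case using assms(1)
    by (auto simp: initial_append comm_rels_def dest: symD)
qed auto

lemma initial_to_front:
  assumes "sym \<eta>" "initial \<eta> x w"
  shows "(w, x # remove1 x w) \<in> pres_cong (comm_rels \<eta>)"
  using assms(2)
proof (induction w)
  case (Cons y w)
  show ?case
  proof (cases "x = y")
    case False
    then have "(y # w, y # x # remove1 x w) \<in> pres_cong (comm_rels \<eta>)" "(y, x) \<in> \<eta>"
      using Cons pres_cong_Cons by fastforce+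
    then show ?thesis using False trace_swap[of y x \<eta>] by (auto intro: pres_cong.trans)
  qed (simp add: pres_cong.refl)
qed simp

text \<open>Deleting the first occurrence of a letter is well defined on traces; this makes the trace monoid
  left cancellative.\<close>

lemma remove1_cong:
  assumes "(u, v) \<in> pres_cong (comm_rels \<eta>)"
  shows "(remove1 x u, remove1 x v) \<in> pres_cong (comm_rels \<eta>)"
  using assms
proof induction
  case (rel l r u v)
  then obtain a b where ab: "l = [a, b]" "r = [b, a]" "(a, b) \<in> \<eta>" by (auto simp: comm_rels_def)
  show ?case
    using pres_cong_context[OF trace_swap[OF ab(3), of "[]"], of "remove1 x u" v]
      pres_cong_context[OF trace_swap[OF ab(3), of "[]"], of u "remove1 x v"]
    by (auto simp: remove1_append ab intro: pres_cong.refl)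
qed (blast intro: pres_cong.intros)+

lemma trace_cancel_Cons:
  "(x # u, x # v) \<in> pres_cong (comm_rels \<eta>) \<Longrightarrow> (u, v) \<in> pres_cong (comm_rels \<eta>)"
  using remove1_cong[of "x # u" "x # v" \<eta> x] by simp

lemma initial_remove1:
  assumes "sym \<eta>" "irrefl \<eta>" "(x, y) \<in> \<eta>" "initial \<eta> y w"
  shows "initial \<eta> x (remove1 y w) \<longleftrightarrow> initial \<eta> x w"
proof -
  have "initial \<eta> x w \<longleftrightarrow> initial \<eta> x (y # remove1 y w)"
    by (intro initial_cong initial_to_front assms)
  then show ?thesis using assms by (auto simp: irrefl_def dest: symD)
qed

lemma trace_move:
  assumes "\<And>y. y \<in> set u \<Longrightarrow> (x, y) \<in> \<eta>"
  shows "(x # u, u @ [x]) \<in> pres_cong (comm_rels \<eta>)"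
  using assms
proof (induction u)
  case (Cons y u)
  then have "(y # x # u, y # u @ [x]) \<in> pres_cong (comm_rels \<eta>)" by (intro pres_cong_Cons) simp
  then show ?case using trace_swap[of x y \<eta> u] Cons.prems by (auto intro: pres_cong.trans)
qed (simp add: pres_cong.refl)

lemma trace_commute:
  assumes "set u \<times> set v \<subseteq> \<eta>"
  shows "(u @ v, v @ u) \<in> pres_cong (comm_rels \<eta>)"
  using assms
proof (induction u)
  case (Cons x u)
  then have "(x # u @ v, x # v @ u) \<in> pres_cong (comm_rels \<eta>)" by (intro pres_cong_Cons) auto
  moreover have "(x # v, v @ [x]) \<in> pres_cong (comm_rels \<eta>)" using Cons.prems by (intro trace_move) auto
  from pres_cong_context[OF this, of "[]" u] have "(x # v @ u, v @ x # u) \<in> pres_cong (comm_rels \<eta>)" by simp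
  ultimately show ?case by (auto intro: pres_cong.trans)
qed (simp add: pres_cong.refl)

lemma initial_successively:
  assumes "successively (\<lambda>x y. (x, y) \<notin> \<eta>) (y # w)" "initial \<eta> x (y # w)"
  shows "x = y"
  using assms by (induction w arbitrary: y) auto

lemma Alph_trace: "Alph (trace \<eta> w) = set w"
proof -
  have "set v = set w" if "v \<in> trace \<eta> w" for v using that comm_cong_same(1)[of w v \<eta>] by auto
  moreover have "w \<in> trace \<eta> w" by (simp add: pres_cong.refl)
  ultimately show ?thesis unfolding Alph_def by blast
qed

lemma mult_trace: "trace \<eta> u \<otimes>\<^bsub>pc_monoid A \<eta>\<^esub> trace \<eta> v = trace \<eta> (u @ v)"
  by (simp add: pc_monoid_def pres_mult_class)

lemma pc_monoid_carrierE:
  assumes "t \<in> carrier (pc_monoid A \<eta>)"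
  obtains w where "w \<in> lists A" "t = trace \<eta> w"
  using assms unfolding pc_monoid_def by (elim monoid_pres_carrierE)

lemma trace_in_carrier: "w \<in> lists A \<Longrightarrow> trace \<eta> w \<in> carrier (pc_monoid A \<eta>)"
  unfolding pc_monoid_def by (rule pres_class_in_carrier)

lemma IA_trace:
  assumes "sym \<eta>" "w \<in> lists A"
  shows "x \<in> IA A \<eta> (trace \<eta> w) \<longleftrightarrow> initial \<eta> x w"
proof
  assume "x \<in> IA A \<eta> (trace \<eta> w)"
  then obtain t where t: "t \<in> carrier (pc_monoid A \<eta>)"
    "trace \<eta> w = letter \<eta> x \<otimes>\<^bsub>pc_monoid A \<eta>\<^esub> t"
    unfolding IA_def by blast
  obtain v where "t = trace \<eta> v" using t(1) by (rule pc_monoid_carrierE)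
  with t(2) have "trace \<eta> w = trace \<eta> (x # v)" by (simp add: letter_def mult_trace)
  then show "initial \<eta> x w" using initial_cong[OF assms(1)] by (auto simp: pres_class_eq_iff)
next
  assume i: "initial \<eta> x w"
  have "x \<in> A" "remove1 x w \<in> lists A"
    using initial_in_set[OF i] assms(2) set_remove1_subset[of x w] by (auto simp: in_lists_conv_set)
  moreover have "trace \<eta> w = letter \<eta> x \<otimes>\<^bsub>pc_monoid A \<eta>\<^esub> trace \<eta> (remove1 x w)"
    using initial_to_front[OF assms(1) i] by (simp add: letter_def mult_trace pres_class_eq_iff)
  ultimately show "x \<in> IA A \<eta> (trace \<eta> w)"
    unfolding IA_def mem_Collect_eq by (intro conjI bexI[of _ "trace \<eta> (remove1 x w)"] trace_in_carrier)
qed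

text \<open>The condition \<open>IA(zw) = {z}\<close>: no letter of \<open>w\<close> can be moved in front of \<open>z\<close>.\<close>

definition anchored :: "('x \<times> 'x) set \<Rightarrow> 'x \<Rightarrow> 'x list \<Rightarrow> bool" where
  "anchored \<eta> z w \<longleftrightarrow> (\<forall>x. initial \<eta> x w \<longrightarrow> (z, x) \<notin> \<eta>)"

lemma anchored_cong:
  assumes "sym \<eta>" "(u, v) \<in> pres_cong (comm_rels \<eta>)"
  shows "anchored \<eta> z u \<longleftrightarrow> anchored \<eta> z v"
  using initial_cong[OF assms] by (simp add: anchored_def)

text \<open>Along a path of non-commuting letters no letter can overtake its predecessor, so such paths are
  the simplest anchored words.\<close>

lemma anchored_successively:
  assumes "successively (\<lambda>x y. (x, y) \<notin> \<eta>) (z # w)"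
  shows "anchored \<eta> z w"
  using assms initial_successively[of \<eta> "hd w" "tl w"] by (cases w) (auto simp: anchored_def)

lemma beta_trace:
  assumes "sym \<eta>" "irrefl \<eta>" "Z \<subseteq> A" "B \<subseteq> A"
  shows "beta A \<eta> Z B = {trace \<eta> (z # w) | z w. z \<in> Z \<and> w \<in> lists B \<and> anchored \<eta> z w}"
    (is "_ = ?rhs")
proof -
  have IA: "IA A \<eta> (trace \<eta> (z # w)) = {z} \<longleftrightarrow> anchored \<eta> z w" if "z \<in> Z" "w \<in> lists B" for z w
  proof -
    have "z # w \<in> lists A" using that assms by (auto simp: in_lists_conv_set)
    from IA_trace[OF assms(1) this]
    have "IA A \<eta> (trace \<eta> (z # w)) = insert z {x. (z, x) \<in> \<eta> \<and> initial \<eta> x w}" by auto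
    then show ?thesis using assms(2) by (auto simp: anchored_def irrefl_def)
  qed
  show ?thesis
  proof
    show "beta A \<eta> Z B \<subseteq> ?rhs"
    proof
      fix t assume "t \<in> beta A \<eta> Z B"
      then obtain z v where v: "t = letter \<eta> z \<otimes>\<^bsub>pc_monoid A \<eta>\<^esub> v" "z \<in> Z"
        "v \<in> carrier (pc_monoid B (restr \<eta> B))" "IA A \<eta> t = {z}"
        by (auto simp: beta_def)
      obtain w where w: "w \<in> lists B" "v = trace (restr \<eta> B) w"
        using v(3) by (rule pc_monoid_carrierE)
      then have "t = trace \<eta> (z # w)"
        using v(1) by (simp add: letter_class_restr letter_def mult_trace)
      then show "t \<in> ?rhs" using IA[OF v(2) w(1)] v w by auto
    qed
    show "?rhs \<subseteq> beta A \<eta> Z B"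
    proof
      fix t assume "t \<in> ?rhs"
      then obtain z w where w: "t = trace \<eta> (z # w)" "z \<in> Z" "w \<in> lists B" "anchored \<eta> z w"
        by auto
      then have t: "letter \<eta> z \<otimes>\<^bsub>pc_monoid A \<eta>\<^esub> trace (restr \<eta> B) w = t"
        by (simp add: letter_class_restr letter_def mult_trace)
      have "IA A \<eta> t = {z}" using IA[OF w(2,3)] w(1,4) by blast
      moreover have "trace (restr \<eta> B) w \<in> carrier (pc_monoid B (restr \<eta> B))"
        using w(3) by (rule trace_in_carrier)
      ultimately show "t \<in> beta A \<eta> Z B"
        using w(2) unfolding beta_def mem_Collect_eq
        by - (rule exI[of _ z], rule exI[of _ "trace (restr \<eta> B) w"],
            intro conjI, (simp only: t)+)
    qed
  qed
qed

section \<open>Normal forms in free partially commutative groups\<close>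

fun root :: "'a sletter \<Rightarrow> 'a" where
  "root (Gen a) = a"
| "root (Bar a) = a"

lemma bar_simps [simp]: "bar (bar x) = x" "root (bar x) = root x" "bar x \<noteq> x"
  by (cases x; simp)+

lemma mem_tilde: "x \<in> tilde A \<longleftrightarrow> root x \<in> A"
  by (cases x) (auto simp: tilde_def)

lemma mem_lists_tilde: "w \<in> lists (tilde A) \<longleftrightarrow> root ` set w \<subseteq> A"
  by (auto simp: in_lists_conv_set mem_tilde)

lemma tilde_indep_iff:
  assumes "independence_alphabet A \<theta>"
  shows "(x, y) \<in> tilde_indep A \<theta> \<longleftrightarrow> (root x, root y) \<in> \<theta>"
  using assms by (cases x; cases y) (auto simp: tilde_indep_def independence_alphabet_def tilde_def)

text \<open>Left multiplication by a letter on irreducible traces: if the inverse letter can be brought to the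
  front it is cancelled, otherwise the letter is put in front. On irreducible traces this obeys the
  relations of the group, so it defines an action; the normal form of a word is its action on the
  empty trace.\<close>

definition cancel_mult :: "('a sletter \<times> 'a sletter) set \<Rightarrow> 'a sletter \<Rightarrow> 'a sletter list \<Rightarrow> 'a sletter list"
  where "cancel_mult \<eta> x w = (if initial \<eta> (bar x) w then remove1 (bar x) w else x # w)"

abbreviation normal_form :: "('a sletter \<times> 'a sletter) set \<Rightarrow> 'a sletter list \<Rightarrow> 'a sletter list"
  where "normal_form \<eta> w \<equiv> foldr (cancel_mult \<eta>) w []"

fun irreducible_word :: "('a sletter \<times> 'a sletter) set \<Rightarrow> 'a sletter list \<Rightarrow> bool" where
  "irreducible_word \<eta> [] \<longleftrightarrow> True"
| "irreducible_word \<eta> (x # w) \<longleftrightarrow> \<not> initial \<eta> (bar x) w \<and> irreducible_word \<eta> w"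

locale signed_indep =
  fixes A :: "'a set" and \<theta> :: "('a \<times> 'a) set"
  assumes indep: "independence_alphabet A \<theta>"
begin

abbreviation \<eta> where "\<eta> \<equiv> tilde_indep A \<theta>"
abbreviation F where "F \<equiv> pc_group A \<theta>"
abbreviation cls where "cls w \<equiv> pres_cong (pc_group_rels A \<theta>) `` {w}"

lemma \<theta>_in: "(a, b) \<in> \<theta> \<Longrightarrow> a \<in> A \<and> b \<in> A"
  and \<theta>_sym: "(a, b) \<in> \<theta> \<Longrightarrow> (b, a) \<in> \<theta>"
  and \<theta>_irrefl: "(a, a) \<notin> \<theta>"
  using indep by (auto simp: independence_alphabet_def sym_def irrefl_def)

lemmas \<eta>_iff = tilde_indep_iff[OF indep]

lemma sym_\<eta>: "sym \<eta>" and irrefl_\<eta>: "irrefl \<eta>"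
  using \<theta>_sym \<theta>_irrefl unfolding sym_def irrefl_def \<eta>_iff by blast+

lemma \<eta>_bar:
  assumes "(x, y) \<in> \<eta>"
  shows "(bar x, y) \<in> \<eta>" "(x, bar y) \<in> \<eta>" "(bar x, bar y) \<in> \<eta>" "x \<noteq> bar y" "y \<noteq> bar x"
  using assms \<theta>_irrefl by (auto simp: \<eta>_iff)

lemma cancel_mult_cong:
  assumes "(u, v) \<in> pres_cong (comm_rels \<eta>)"
  shows "(cancel_mult \<eta> x u, cancel_mult \<eta> x v) \<in> pres_cong (comm_rels \<eta>)"
  using initial_cong[OF sym_\<eta> assms] remove1_cong[OF assms] pres_cong_Cons[OF assms]
  by (simp add: cancel_mult_def)

lemma foldr_cancel_mult_cong:
  "(u, v) \<in> pres_cong (comm_rels \<eta>) \<Longrightarrow>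
    (foldr (cancel_mult \<eta>) w u, foldr (cancel_mult \<eta>) w v) \<in> pres_cong (comm_rels \<eta>)"
  by (induction w) (auto intro: cancel_mult_cong)

text \<open>Irreducibility is tested from the right end of a word, one letter at a time; the test does not
  depend on the word chosen in a trace because inverse letters have the same commutations.\<close>

lemma irreducible_word_cong:
  assumes "(u, v) \<in> pres_cong (comm_rels \<eta>)"
  shows "irreducible_word \<eta> u \<longleftrightarrow> irreducible_word \<eta> v"
  using assms
proof induction
  case (rel l r u v)
  then obtain x y where xy: "l = [x, y]" "r = [y, x]" "(x, y) \<in> \<eta>" by (auto simp: comm_rels_def)
  note yx = symD[OF sym_\<eta> xy(3)]
  then have base: "irreducible_word \<eta> (l @ v) \<longleftrightarrow> irreducible_word \<eta> (r @ v)"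
    using \<eta>_bar[OF xy(3)] \<eta>_bar[OF yx] by (auto simp: xy)
  have "initial \<eta> z (u' @ l @ v) \<longleftrightarrow> initial \<eta> z (u' @ r @ v)" for z u'
    by (intro initial_cong sym_\<eta> pres_cong.rel rel)
  then show ?case using base by (induction u) auto
qed auto

lemma irreducible_word_remove1:
  assumes "irreducible_word \<eta> w" "initial \<eta> x w"
  shows "irreducible_word \<eta> (remove1 x w)" "\<not> initial \<eta> (bar x) (remove1 x w)"
  using irreducible_word_cong[OF initial_to_front[OF sym_\<eta> assms(2)]] assms(1) by auto

lemma irreducible_cancel_mult: "irreducible_word \<eta> w \<Longrightarrow> irreducible_word \<eta> (cancel_mult \<eta> x w)"
  using irreducible_word_remove1(1) by (auto simp: cancel_mult_def)

lemma irreducible_normal_form: "irreducible_word \<eta> (normal_form \<eta> w)"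
  by (induction w) (auto intro: irreducible_cancel_mult)

lemma normal_form_irreducible: "irreducible_word \<eta> w \<Longrightarrow> normal_form \<eta> w = w"
  by (induction w) (auto simp: cancel_mult_def)

lemma length_normal_form:
  "length (normal_form \<eta> w) \<le> length w"
  "length (normal_form \<eta> w) = length w \<Longrightarrow> irreducible_word \<eta> w"
proof (induction w)
  case (Cons x w)
  { case 1
    show ?case using Cons(1) by (auto simp: cancel_mult_def length_remove1) }
  { case 2
    then have "\<not> initial \<eta> (bar x) (normal_form \<eta> w)" "length (normal_form \<eta> w) = length w"
      using Cons(1) by (auto simp: cancel_mult_def[of \<eta> x] length_remove1 split: if_splits)
    then show ?case using Cons(2) normal_form_irreducible by simp }
qed simp_all

text \<open>Irreducibility matters here: if \<open>x\<close> is initial in \<open>w\<close>, the inner multiplication deletes it, and the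
  outer one must put it back instead of deleting a further inverse letter.\<close>

lemma cancel_mult_bar:
  assumes "irreducible_word \<eta> w"
  shows "(cancel_mult \<eta> x (cancel_mult \<eta> (bar x) w), w) \<in> pres_cong (comm_rels \<eta>)"
proof (cases "initial \<eta> x w")
  case True
  then show ?thesis
    using irreducible_word_remove1(2)[OF assms True] initial_to_front[OF sym_\<eta> True]
    by (auto simp: cancel_mult_def intro: pres_cong.sym)
qed (simp add: cancel_mult_def pres_cong.refl)

lemma cancel_mult_commute:
  assumes "(x, y) \<in> \<eta>"
  shows "(cancel_mult \<eta> x (cancel_mult \<eta> y w), cancel_mult \<eta> y (cancel_mult \<eta> x w))
    \<in> pres_cong (comm_rels \<eta>)"
proof -
  note xy = \<eta>_bar[OF assms] \<eta>_bar[OF symD[OF sym_\<eta> assms]]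
  have 1: "initial \<eta> (bar y) w \<Longrightarrow> initial \<eta> (bar x) (remove1 (bar y) w) \<longleftrightarrow> initial \<eta> (bar x) w"
    and 2: "initial \<eta> (bar x) w \<Longrightarrow> initial \<eta> (bar y) (remove1 (bar x) w) \<longleftrightarrow> initial \<eta> (bar y) w"
    using initial_remove1[OF sym_\<eta> irrefl_\<eta>] xy by blast+
  show ?thesis
    using xy trace_swap[OF assms] 1 2
    by (auto simp: cancel_mult_def remove1_commute[of "bar x"] intro: pres_cong.refl)
qed

lemma normal_form_cong:
  assumes "(u, v) \<in> pres_cong (pc_group_rels A \<theta>)"
  shows "(normal_form \<eta> u, normal_form \<eta> v) \<in> pres_cong (comm_rels \<eta>)"
  using assms
proof induction
  case (rel l r u v)
  let ?n = "normal_form \<eta> v"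
  have "(foldr (cancel_mult \<eta>) l ?n, foldr (cancel_mult \<eta>) r ?n) \<in> pres_cong (comm_rels \<eta>)"
    using rel cancel_mult_bar[OF irreducible_normal_form, of _ v] cancel_mult_commute[of _ _ ?n]
    by (auto simp: pc_group_rels_def comm_rels_def \<eta>_iff)
  then show ?case using foldr_cancel_mult_cong by simp
qed (blast intro: pres_cong.intros)+

text \<open>The normal form theorem: each element of the group is represented by only one irreducible trace,
  because an irreducible word is its own normal form.\<close>

lemma irreducible_unique:
  assumes "(u, v) \<in> pres_cong (pc_group_rels A \<theta>)" "irreducible_word \<eta> u" "irreducible_word \<eta> v"
  shows "(u, v) \<in> pres_cong (comm_rels \<eta>)"
  using normal_form_cong[OF assms(1)] assms(2,3) by (simp add: normal_form_irreducible)

end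

section \<open>Words and classes in free partially commutative groups\<close>

definition word_inv :: "'a sletter list \<Rightarrow> 'a sletter list" where
  "word_inv w = rev (map bar w)"

lemma word_inv_simps [simp]:
  "word_inv [] = []" "word_inv (x # w) = word_inv w @ [bar x]" "word_inv (u @ v) = word_inv v @ word_inv u"
  "root ` set (word_inv w) = root ` set w"
  by (auto simp: word_inv_def image_image)

text \<open>The extension of a map on generators to generators and their formal inverses; \<open>word_eval\<close> of it is
  the value of a group word.\<close>

definition signed :: "('g, 'b) monoid_scheme \<Rightarrow> ('x \<Rightarrow> 'g) \<Rightarrow> 'x sletter \<Rightarrow> 'g" where
  "signed G f x = (case x of Gen a \<Rightarrow> f a | Bar a \<Rightarrow> inv\<^bsub>G\<^esub> f a)"

lemma signed_simps [simp]: "signed G f (Gen a) = f a" "signed G f (Bar a) = inv\<^bsub>G\<^esub> f a"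
  by (simp_all add: signed_def)

lemma word_eval_simps [simp]:
  "word_eval G f [] = \<one>\<^bsub>G\<^esub>" "word_eval G f (x # w) = f x \<otimes>\<^bsub>G\<^esub> word_eval G f w"
  by (simp_all add: word_eval_def)

lemma signed_closed:
  assumes "group G" "f ` X \<subseteq> carrier G"
  shows "signed G f ` tilde X \<subseteq> carrier G"
proof -
  interpret group G by fact
  show ?thesis using assms(2) by (auto simp: tilde_def)
qed

lemma generate_word_eval:
  assumes "group G" "f ` X \<subseteq> carrier G"
  shows "generate G (f ` X) = word_eval G (signed G f) ` lists (tilde X)"
proof -
  interpret group G by fact
  note cl = signed_closed[OF assms]
  show ?thesis
  proof
    show "generate G (f ` X) \<subseteq> word_eval G (signed G f) ` lists (tilde X)"
    proof
      fix g assume "g \<in> generate G (f ` X)"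
      then show "g \<in> word_eval G (signed G f) ` lists (tilde X)"
      proof induction
        case one
        then show ?case by (auto intro!: image_eqI[of _ _ "[]"])
      next
        case (incl h)
        then obtain a where "h = f a" "a \<in> X" by blast
        then show ?case using assms(2)
          by (intro image_eqI[of _ _ "[Gen a]"]) (auto simp: tilde_def)
      next
        case (inv h)
        then obtain a where "h = f a" "a \<in> X" by blast
        then show ?case using assms(2)
          by (intro image_eqI[of _ _ "[Bar a]"]) (auto simp: tilde_def)
      next
        case (eng g h)
        then obtain u v where uv: "u \<in> lists (tilde X)" "v \<in> lists (tilde X)"
          "g = word_eval G (signed G f) u" "h = word_eval G (signed G f) v" by blast
        then show ?case using word_eval_append[OF cl uv(1,2)]
          by (intro image_eqI[of _ _ "u @ v"]) auto
      qed
    qed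
    have "word_eval G (signed G f) w \<in> generate G (f ` X)" if "w \<in> lists (tilde X)" for w
      using that
    proof induction
      case (Cons x w)
      then have "signed G f x \<in> generate G (f ` X)"
        using generate.incl[of _ "f ` X" G] generate.inv[of _ "f ` X" G] by (auto simp: tilde_def)
      then show ?case using Cons by (auto intro: generate.eng)
    qed (simp add: generate.one)
    then show "word_eval G (signed G f) ` lists (tilde X) \<subseteq> generate G (f ` X)" by blast
  qed
qed

lemma (in group) conj_eq_commute:
  assumes "a \<in> carrier G" "b \<in> carrier G" "g \<in> carrier G" "inv a \<otimes> g \<otimes> a = inv b \<otimes> g \<otimes> b"
  shows "g \<otimes> (a \<otimes> inv b) = (a \<otimes> inv b) \<otimes> g"
proof -
  have "a \<otimes> (inv a \<otimes> x) = x" if "x \<in> carrier G" for x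
    using assms(1) that by (simp flip: m_assoc)
  then have "g \<otimes> (a \<otimes> inv b) = a \<otimes> (inv a \<otimes> g \<otimes> a) \<otimes> inv b"
    using assms(1-3) by (simp add: m_assoc)
  also have "\<dots> = (a \<otimes> inv b) \<otimes> g"
    using assms(1-3) unfolding assms(4) by (simp add: m_assoc)
  finally show ?thesis .
qed

text \<open>The universal property of a free partially commutative group.\<close>

lemma pc_group_lift:
  assumes G: "group G" and ind: "\<theta> \<subseteq> A \<times> A" and f: "f ` A \<subseteq> carrier G"
    and comm: "\<And>a b. (a, b) \<in> \<theta> \<Longrightarrow> f a \<otimes>\<^bsub>G\<^esub> f b = f b \<otimes>\<^bsub>G\<^esub> f a"
  defines "h \<equiv> pres_lift G (signed G f)"
  shows "h \<in> hom (pc_group A \<theta>) G"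
    and "\<And>w. w \<in> lists (tilde A) \<Longrightarrow>
      h (pres_cong (pc_group_rels A \<theta>) `` {w}) = word_eval G (signed G f) w"
    and "\<And>a. a \<in> A \<Longrightarrow> h (gen A \<theta> a) = f a"
proof -
  interpret group G by fact
  note cl = signed_closed[OF G f]
  have val: "h (pres_cong (pc_group_rels A \<theta>) `` {w}) = word_eval G (signed G f) w"
    if w: "w \<in> lists (tilde A)" for w
    unfolding h_def
  proof (rule pres_lift_class[OF cl _ _ _ w])
    show R: "pc_group_rels A \<theta> \<subseteq> lists (tilde A) \<times> lists (tilde A)"
      using subsetD[OF ind] by (auto simp: pc_group_rels_def comm_rels_def mem_tilde)
    show "u @ l @ v \<in> lists (tilde A) \<longleftrightarrow> u @ r @ v \<in> lists (tilde A)"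
      if "(l, r) \<in> pc_group_rels A \<theta>" for u l r v
      using that R by auto
    show "word_eval G (signed G f) l = word_eval G (signed G f) r" if lr: "(l, r) \<in> pc_group_rels A \<theta>" for l r
    proof -
      consider a b where "(a, b) \<in> \<theta>" "l = [Gen a, Gen b]" "r = [Gen b, Gen a]"
        | a where "a \<in> A" "l = [Gen a, Bar a]" "r = []"
        | a where "a \<in> A" "l = [Bar a, Gen a]" "r = []"
        using lr by (auto simp: pc_group_rels_def comm_rels_def tilde_def)
      then show ?thesis
      proof cases
        case 1
        then have "f a \<in> carrier G" "f b \<in> carrier G" using ind f by auto
        then show ?thesis using 1 comm by simp
      qed (use f in \<open>auto simp: image_subset_iff\<close>)
    qed
  qed
  show "\<And>w. w \<in> lists (tilde A) \<Longrightarrow>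
      h (pres_cong (pc_group_rels A \<theta>) `` {w}) = word_eval G (signed G f) w"
    by (rule val)
  show "h (gen A \<theta> a) = f a" if "a \<in> A" for a
    using val[of "[Gen a]"] that f by (auto simp: gen_def mem_tilde)
  show "h \<in> hom (pc_group A \<theta>) G"
  proof (rule homI)
    fix s t assume st: "s \<in> carrier (pc_group A \<theta>)" "t \<in> carrier (pc_group A \<theta>)"
    obtain u where u: "u \<in> lists (tilde A)" "s = pres_cong (pc_group_rels A \<theta>) `` {u}"
      using st(1) unfolding pc_group_def by (rule monoid_pres_carrierE)
    show "h s \<in> carrier G" using word_eval_closed[OF cl u(1)] val[OF u(1)] u(2) by simp
    obtain v where v: "v \<in> lists (tilde A)" "t = pres_cong (pc_group_rels A \<theta>) `` {v}"
      using st(2) unfolding pc_group_def by (rule monoid_pres_carrierE)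
    have "u @ v \<in> lists (tilde A)" using u v by simp
    from val[OF this] show "h (s \<otimes>\<^bsub>pc_group A \<theta>\<^esub> t) = h s \<otimes>\<^bsub>G\<^esub> h t"
      using word_eval_append[OF cl u(1) v(1)] val[OF u(1)] val[OF v(1)]
      unfolding u(2) v(2) by (simp add: pc_group_def pres_mult_class)
  qed
qed

lemma pc_group_inj_on_iff:
  assumes "group G" "\<theta> \<subseteq> A \<times> A" "f ` A \<subseteq> carrier G"
    and "\<And>a b. (a, b) \<in> \<theta> \<Longrightarrow> f a \<otimes>\<^bsub>G\<^esub> f b = f b \<otimes>\<^bsub>G\<^esub> f a"
  shows "inj_on (pres_lift G (signed G f)) (carrier (pc_group A \<theta>)) \<longleftrightarrow>
    (\<forall>u\<in>lists (tilde A). \<forall>v\<in>lists (tilde A). word_eval G (signed G f) u = word_eval G (signed G f) v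
      \<longrightarrow> (u, v) \<in> pres_cong (pc_group_rels A \<theta>))" (is "?l \<longleftrightarrow> ?r")
proof -
  note val = pc_group_lift(2)[OF assms]
  have car: "carrier (pc_group A \<theta>) = (\<lambda>w. pres_cong (pc_group_rels A \<theta>) `` {w}) ` lists (tilde A)"
    unfolding pc_group_def by (auto elim!: monoid_pres_carrierE intro: pres_class_in_carrier)
  show ?thesis
    unfolding car inj_on_def ball_simps(9) by (simp add: val pres_class_eq_iff cong: ball_cong)
qed

lemma pc_group_iso_generate:
  assumes G: "group G" "\<theta> \<subseteq> A \<times> A" "f ` A \<subseteq> carrier G"
    "\<And>a b. (a, b) \<in> \<theta> \<Longrightarrow> f a \<otimes>\<^bsub>G\<^esub> f b = f b \<otimes>\<^bsub>G\<^esub> f a"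
    and inj: "\<And>u v. \<lbrakk>u \<in> lists (tilde A); v \<in> lists (tilde A);
        word_eval G (signed G f) u = word_eval G (signed G f) v\<rbrakk> \<Longrightarrow> (u, v) \<in> pres_cong (pc_group_rels A \<theta>)"
  shows "\<exists>\<phi>\<in>iso (pc_group A \<theta>) (G\<lparr>carrier := generate G (f ` A)\<rparr>). \<forall>a\<in>A. \<phi> (gen A \<theta> a) = f a"
proof -
  let ?h = "pres_lift G (signed G f)"
  have car: "carrier (pc_group A \<theta>) = (\<lambda>w. pres_cong (pc_group_rels A \<theta>) `` {w}) ` lists (tilde A)"
    unfolding pc_group_def by (auto elim!: monoid_pres_carrierE intro: pres_class_in_carrier)
  have "?h ` carrier (pc_group A \<theta>) = generate G (f ` A)"
    unfolding car image_image generate_word_eval[OF G(1,3)]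
    using pc_group_lift(2)[OF G] by (intro image_cong) auto
  moreover have "inj_on ?h (carrier (pc_group A \<theta>))"
    using pc_group_inj_on_iff[OF G] inj by blast
  moreover have "?h \<in> hom (pc_group A \<theta>) G" by (rule pc_group_lift(1)[OF G])
  ultimately have "?h \<in> iso (pc_group A \<theta>) (G\<lparr>carrier := generate G (f ` A)\<rparr>)"
    by (auto simp: iso_def hom_def bij_betw_def)
  then show ?thesis using pc_group_lift(3)[OF G] by blast
qed

context signed_indep
begin

sublocale F: group F by (rule group_pc_group)

lemma cls_mult: "cls u \<otimes>\<^bsub>F\<^esub> cls v = cls (u @ v)"
  by (simp add: pc_group_def pres_mult_class)

lemma cls_one: "\<one>\<^bsub>F\<^esub> = cls []"
  by (simp add: pc_group_def one_monoid_pres)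

lemma cls_closed: "w \<in> lists (tilde A) \<Longrightarrow> cls w \<in> carrier F"
  unfolding pc_group_def by (rule pres_class_in_carrier)

lemma F_carrierE:
  assumes "g \<in> carrier F"
  obtains w where "w \<in> lists (tilde A)" "g = cls w"
  using assms unfolding pc_group_def by (rule monoid_pres_carrierE)

lemma cls_cancel: "x \<in> tilde A \<Longrightarrow> cls (x # bar x # w) = cls w"
  using pres_cong.rel[of "[x, bar x]" "[]" "pc_group_rels A \<theta>" "[]" w]
  by (auto simp: pc_group_rels_def pres_class_eq_iff)

lemma cls_word_inv:
  assumes "w \<in> lists (tilde A)"
  shows "cls (word_inv w @ w) = cls []" "cls (w @ word_inv w) = cls []" "inv\<^bsub>F\<^esub> cls w = cls (word_inv w)"
proof -
  have "word_inv w \<in> lists (tilde A)" using assms by (simp add: mem_lists_tilde)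
  have 1: "cls (w @ word_inv w) = cls []" if "w \<in> lists (tilde A)" for w
    using that
  proof induction
    case (Cons x w)
    have "cls (x # w @ word_inv w @ [bar x]) = cls [x] \<otimes>\<^bsub>F\<^esub> cls (w @ word_inv w) \<otimes>\<^bsub>F\<^esub> cls [bar x]"
      by (simp add: cls_mult)
    also have "\<dots> = cls [x, bar x]" unfolding Cons.IH by (simp add: cls_mult)
    finally show ?case using cls_cancel[OF Cons.hyps(1)] by simp
  qed simp
  show "cls (w @ word_inv w) = cls []" using 1[OF assms] .
  have "word_inv (word_inv w) = w" by (simp add: word_inv_def rev_map o_def)
  then show 2: "cls (word_inv w @ w) = cls []"
    using 1[OF \<open>word_inv w \<in> lists (tilde A)\<close>] by simp
  show "inv\<^bsub>F\<^esub> cls w = cls (word_inv w)"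
    by (rule F.inv_equality)
       (use 2 assms \<open>word_inv w \<in> lists (tilde A)\<close> in \<open>auto simp: cls_mult cls_one intro!: cls_closed\<close>)
qed

lemma cls_trace_cong:
  assumes "u \<in> lists (tilde A)" "(u, v) \<in> pres_cong (comm_rels \<eta>)"
  shows "cls u = cls v"
proof -
  have "v \<in> lists (tilde A)" using comm_cong_same(1)[OF assms(2)] assms(1) by (simp add: lists_eq_set)
  moreover have "trace \<eta> u = trace \<eta> v" using assms(2) by (simp add: pres_class_eq_iff)
  ultimately show ?thesis using s_map_class[OF indep] assms(1) by metis
qed

lemma cls_irreducible_eq:
  "cls u = cls v \<Longrightarrow> irreducible_word \<eta> u \<Longrightarrow> irreducible_word \<eta> v \<Longrightarrow>
    (u, v) \<in> pres_cong (comm_rels \<eta>)"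
  using irreducible_unique by (simp add: pres_class_eq_iff)

lemma cls_cancel_mult:
  assumes "x \<in> tilde A" "w \<in> lists (tilde A)"
  shows "cls (cancel_mult \<eta> x w) = cls (x # w)" "cancel_mult \<eta> x w \<in> lists (tilde A)"
proof -
  show "cancel_mult \<eta> x w \<in> lists (tilde A)"
    using assms set_remove1_subset[of "bar x" w] by (auto simp: cancel_mult_def in_lists_conv_set)
  show "cls (cancel_mult \<eta> x w) = cls (x # w)"
  proof (cases "initial \<eta> (bar x) w")
    case True
    have "cls (x # w) = cls [x] \<otimes>\<^bsub>F\<^esub> cls (bar x # remove1 (bar x) w)"
      using cls_trace_cong[OF assms(2) initial_to_front[OF sym_\<eta> True]]
      by (metis append_Cons append_Nil cls_mult)
    then show ?thesis using True cls_cancel[OF assms(1)] by (simp add: cls_mult cancel_mult_def)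
  qed (simp add: cancel_mult_def)
qed

lemma cls_foldr_cancel_mult:
  assumes "w \<in> lists (tilde A)" "v \<in> lists (tilde A)"
  shows "cls (foldr (cancel_mult \<eta>) w v) = cls (w @ v)"
    "foldr (cancel_mult \<eta>) w v \<in> lists (tilde A)"
proof -
  have "cls (foldr (cancel_mult \<eta>) w v) = cls (w @ v) \<and> foldr (cancel_mult \<eta>) w v \<in> lists (tilde A)"
    using assms(1)
  proof induction
    case (Cons x w)
    have "cls (x # foldr (cancel_mult \<eta>) w v) = cls [x] \<otimes>\<^bsub>F\<^esub> cls (foldr (cancel_mult \<eta>) w v)"
      by (simp add: cls_mult)
    then show ?case using Cons cls_cancel_mult[OF Cons.hyps(1)] by (simp add: cls_mult)
  qed (simp add: assms)
  then show "cls (foldr (cancel_mult \<eta>) w v) = cls (w @ v)"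
    "foldr (cancel_mult \<eta>) w v \<in> lists (tilde A)" by auto
qed

text \<open>A trace is of minimal length in its group element just if it is irreducible: normal forms never
  lengthen a word, and shorten every word that is not irreducible.\<close>

lemma red_iff:
  assumes "w \<in> lists (tilde A)"
  shows "trace \<eta> w \<in> red A \<theta> \<longleftrightarrow> irreducible_word \<eta> w"
proof
  assume "trace \<eta> w \<in> red A \<theta>"
  moreover note nf = cls_foldr_cancel_mult[OF assms lists.Nil]
  ultimately have "length w \<le> length (normal_form \<eta> w)"
    using s_map_class[OF indep assms] s_map_class[OF indep nf(2)] trace_in_carrier[OF nf(2)]
    by (simp add: red_def flip: pc_monoid_def) (metis trace_length_class)
  then show "irreducible_word \<eta> w" using length_normal_form[of w] by simp
next
  assume irr: "irreducible_word \<eta> w"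
  have "length w \<le> trace_length t"
    if t: "t \<in> carrier (tilde_monoid A \<theta>)" "s_map A \<theta> t = s_map A \<theta> (trace \<eta> w)" for t
  proof -
    obtain v where v: "v \<in> lists (tilde A)" "t = trace \<eta> v" using t(1) by (rule pc_monoid_carrierE)
    then have "(w, v) \<in> pres_cong (pc_group_rels A \<theta>)"
      using t(2) s_map_class[OF indep] assms pres_class_eq_iff by metis
    from normal_form_cong[OF this] have "length w = length (normal_form \<eta> v)"
      using irr comm_cong_same(2) normal_form_irreducible by metis
    then show ?thesis using length_normal_form(1)[of v] by (simp add: v trace_length_class)
  qed
  then show "trace \<eta> w \<in> red A \<theta>"
    using assms by (auto simp: red_def trace_length_class intro: trace_in_carrier)
qed

text \<open>Both words are irreducible, so equality in the group is equality of traces.\<close>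

lemma gen_commuteD:
  assumes "cls [Gen a, Gen b] = cls [Gen b, Gen a]" "a \<noteq> b"
  shows "(a, b) \<in> \<theta>"
proof -
  have "([Gen a, Gen b], [Gen b, Gen a]) \<in> pres_cong (comm_rels \<eta>)"
    by (rule cls_irreducible_eq[OF assms(1)]) auto
  from initial_cong[OF sym_\<eta> this, of "Gen b"] show ?thesis
    using assms(2) by (auto simp: \<eta>_iff)
qed

lemma gen_inject: "cls [Gen a] = cls [Gen b] \<Longrightarrow> a = b"
  using cls_irreducible_eq[of "[Gen a]" "[Gen b]"] comm_cong_same(1)[of "[Gen a]" "[Gen b]"] by simp

end

text \<open>Killing the generators outside of \<open>B\<close> is well defined, and takes values in the group presented by
  \<open>B\<close> alone. Hence subalphabets embed, and \<open>F(A, \<theta>)\<close> retracts onto each of them.\<close>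

lemma filter_root_cong:
  assumes "B \<subseteq> A" "(u, v) \<in> pres_cong (pc_group_rels A \<theta>)"
  shows "(filter (\<lambda>x. root x \<in> B) u, filter (\<lambda>x. root x \<in> B) v)
    \<in> pres_cong (pc_group_rels B (restr \<theta> B))"
proof (rule pres_cong_map_words[OF assms(2)])
  fix l r assume "(l, r) \<in> pc_group_rels A \<theta>"
  then consider a b where "(a, b) \<in> \<theta>" "l = [Gen a, Gen b]" "r = [Gen b, Gen a]"
    | x where "x \<in> tilde A" "l = [x, bar x]" "r = []"
    by (auto simp: pc_group_rels_def comm_rels_def)
  then show "(filter (\<lambda>x. root x \<in> B) l, filter (\<lambda>x. root x \<in> B) r)
    \<in> pres_cong (pc_group_rels B (restr \<theta> B))"
  proof cases
    case 1
    then have "a \<in> B \<Longrightarrow> b \<in> B \<Longrightarrow> (l, r) \<in> pc_group_rels B (restr \<theta> B)"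
      by (auto simp: pc_group_rels_def comm_rels_def restr_def)
    from pres_cong.rel[OF this, of "[]" "[]"] show ?thesis
      by (auto simp: 1 intro: pres_cong.refl)
  next
    case 2
    then have "root x \<in> B \<Longrightarrow> (l, r) \<in> pc_group_rels B (restr \<theta> B)"
      by (auto simp: pc_group_rels_def mem_tilde)
    from pres_cong.rel[OF this, of "[]" "[]"] show ?thesis
      by (auto simp: 2 intro: pres_cong.refl)
  qed
qed simp

lemma pc_group_rels_restr: "B \<subseteq> A \<Longrightarrow> pc_group_rels B (restr \<theta> B) \<subseteq> pc_group_rels A \<theta>"
  by (auto simp: pc_group_rels_def comm_rels_def restr_def tilde_def)

lemma map_sletter_cong:
  assumes "(u, v) \<in> pres_cong (pc_group_rels A \<theta>)"
    and "f ` A \<subseteq> A'" and "\<And>a b. (a, b) \<in> \<theta> \<Longrightarrow> (f a, f b) \<in> \<theta>'"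
  shows "(map (map_sletter f) u, map (map_sletter f) v) \<in> pres_cong (pc_group_rels A' \<theta>')"
proof (rule pres_cong_map_words[OF assms(1)])
  fix l r assume "(l, r) \<in> pc_group_rels A \<theta>"
  then have "(map (map_sletter f) l, map (map_sletter f) r) \<in> pc_group_rels A' \<theta>'"
    using assms(2,3) by (fastforce simp: pc_group_rels_def comm_rels_def tilde_def)
  from pres_cong.rel[OF this, of "[]" "[]"]
  show "(map (map_sletter f) l, map (map_sletter f) r) \<in> pres_cong (pc_group_rels A' \<theta>')" by simp
qed simp

section \<open>Rewriting words into conjugates of letters in Z\<close>

locale indep_partition = signed_indep A \<theta> for A :: "'a set" and \<theta> +
  fixes B Z :: "'a set"
  assumes union: "B \<union> Z = A" and disjoint: "B \<inter> Z = {}"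
begin

lemma B_sub: "B \<subseteq> A" and Z_sub: "Z \<subseteq> A"
  and notB_iff: "a \<in> A \<Longrightarrow> a \<notin> B \<longleftrightarrow> a \<in> Z" and Z_eq: "A - B = Z"
  using union disjoint by auto

lemma Z_notB: "z \<in> Z \<Longrightarrow> z \<notin> B"
  using disjoint by auto

abbreviation B_part :: "'a sletter list \<Rightarrow> 'a sletter list" where
  "B_part w \<equiv> filter (\<lambda>x. root x \<in> B) w"

lemma B_part_in: "B_part w \<in> lists (tilde B)"
  by (auto simp: mem_lists_tilde)

lemma B_part_id: "w \<in> lists (tilde B) \<Longrightarrow> B_part w = w"
  by (auto simp: mem_lists_tilde intro!: filter_True)

lemma tildeB_A: "w \<in> lists (tilde B) \<Longrightarrow> w \<in> lists (tilde A)"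
  using B_sub by (auto simp: mem_lists_tilde)

lemma word_inv_B: "w \<in> lists (tilde B) \<Longrightarrow> word_inv w \<in> lists (tilde B)"
  by (simp add: mem_lists_tilde)

lemma cls_B_part: "cls u = cls v \<Longrightarrow> cls (B_part u) = cls (B_part v)"
  using filter_root_cong[OF B_sub] pres_cong_mono[OF pc_group_rels_restr[OF B_sub]]
  unfolding pres_class_eq_iff by blast

definition conjugate :: "'a \<Rightarrow> 'a sletter list \<Rightarrow> 'a sletter list set" where
  "conjugate z u = cls (word_inv u @ Gen z # u)"

definition conjugates :: "'a sletter list set set" where
  "conjugates = {conjugate z u | z u. z \<in> Z \<and> u \<in> lists (tilde B)}"

text \<open>Only conjugates by the same element are declared independent. These are the commutations that
  rewriting produces; freeness of the kernel for this smaller relation then shows that it contains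
  all commuting pairs of distinct conjugates (\<open>conj_indep_iff\<close>).\<close>

definition conj_indep :: "('a sletter list set \<times> 'a sletter list set) set" where
  "conj_indep = {(conjugate z u, conjugate z' u) | z z' u. z \<in> Z \<and> z' \<in> Z \<and> (z, z') \<in> \<theta> \<and> u \<in> lists (tilde B)}"

abbreviation conj_cong :: "('a sletter list set sletter list \<times> 'a sletter list set sletter list) set" where
  "conj_cong \<equiv> pres_cong (pc_group_rels conjugates conj_indep)"

abbreviation conj_eval :: "'a sletter list set sletter list \<Rightarrow> 'a sletter list set" where
  "conj_eval \<equiv> word_eval F (signed F (\<lambda>t. t))"

lemma conjugatesI: "z \<in> Z \<Longrightarrow> u \<in> lists (tilde B) \<Longrightarrow> conjugate z u \<in> conjugates"
  unfolding conjugates_def by blast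

lemma conj_indepI:
  "z \<in> Z \<Longrightarrow> z' \<in> Z \<Longrightarrow> (z, z') \<in> \<theta> \<Longrightarrow> u \<in> lists (tilde B) \<Longrightarrow> (conjugate z u, conjugate z' u) \<in> conj_indep"
  unfolding conj_indep_def by blast

lemma conjugate_word:
  "u \<in> lists (tilde A) \<Longrightarrow> root x \<in> A \<Longrightarrow> word_inv u @ x # u \<in> lists (tilde A)"
  by (simp add: mem_lists_tilde image_Un)

lemma conjugate_eq:
  assumes "u \<in> lists (tilde A)"
  shows "conjugate z u = inv\<^bsub>F\<^esub> cls u \<otimes>\<^bsub>F\<^esub> cls [Gen z] \<otimes>\<^bsub>F\<^esub> cls u"
  using assms by (simp add: conjugate_def cls_word_inv(3) cls_mult)

lemma conjugate_closed: "z \<in> A \<Longrightarrow> u \<in> lists (tilde A) \<Longrightarrow> conjugate z u \<in> carrier F"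
  unfolding conjugate_def by (intro cls_closed conjugate_word) simp_all

lemma inv_conjugate:
  assumes "u \<in> lists (tilde A)" "z \<in> A"
  shows "inv\<^bsub>F\<^esub> conjugate z u = cls (word_inv u @ Bar z # u)"
proof -
  have "word_inv u @ Gen z # u \<in> lists (tilde A)" using assms by (intro conjugate_word) simp_all
  moreover have "word_inv (word_inv u) = u" by (simp add: word_inv_def rev_map o_def)
  ultimately show ?thesis by (simp add: conjugate_def cls_word_inv(3))
qed

lemma conjugate_cong:
  assumes "u \<in> lists (tilde A)" "v \<in> lists (tilde A)" "cls u = cls v"
  shows "conjugate z u = conjugate z v"
  using assms by (simp add: conjugate_eq)

lemma cls_swap:
  assumes "(root x, root y) \<in> \<theta>"
  shows "cls [x, y] = cls [y, x]"
proof -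
  have "[x, y] \<in> lists (tilde A)" using assms \<theta>_in by (auto simp: mem_tilde)
  moreover have "([x, y], [y, x]) \<in> pres_cong (comm_rels \<eta>)"
    using assms by (intro trace_swap) (simp add: \<eta>_iff)
  ultimately show ?thesis by (rule cls_trace_cong)
qed

text \<open>Letters next to \<open>z\<close> that commute with \<open>z\<close> cancel against their inverses.\<close>

lemma conjugate_absorb:
  assumes "u \<in> lists (tilde A)" "\<And>x. x \<in> set u \<Longrightarrow> (root x, z) \<in> \<theta>"
  shows "conjugate z (u @ v) = conjugate z v"
  using assms
proof induction
  case (Cons x u)
  have "conjugate z (x # u @ v) = cls (word_inv (u @ v)) \<otimes>\<^bsub>F\<^esub> (cls [bar x] \<otimes>\<^bsub>F\<^esub> cls [Gen z, x]) \<otimes>\<^bsub>F\<^esub> cls (u @ v)"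
    by (simp add: conjugate_def cls_mult)
  also have "cls [bar x] \<otimes>\<^bsub>F\<^esub> cls [Gen z, x] = cls [bar x] \<otimes>\<^bsub>F\<^esub> cls [x, Gen z]"
    using cls_swap[of x "Gen z"] Cons.prems by simp
  also have "\<dots> = cls [Gen z]"
    using cls_cancel[of "bar x" "[Gen z]"] Cons.hyps by (simp add: cls_mult mem_tilde)
  also have "cls (word_inv (u @ v)) \<otimes>\<^bsub>F\<^esub> cls [Gen z] \<otimes>\<^bsub>F\<^esub> cls (u @ v) = conjugate z (u @ v)"
    by (simp add: conjugate_def cls_mult)
  finally show ?case using Cons by simp
qed simp

lemma conjugates_closed: "conjugates \<subseteq> carrier F"
  using conjugate_closed tildeB_A Z_sub unfolding conjugates_def by blast

lemma conj_indep_sub: "conj_indep \<subseteq> conjugates \<times> conjugates"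
  by (auto simp: conj_indep_def conjugates_def)

lemma conj_indep_commute:
  assumes "(s, t) \<in> conj_indep"
  shows "s \<otimes>\<^bsub>F\<^esub> t = t \<otimes>\<^bsub>F\<^esub> s"
proof -
  obtain z z' u where zu: "s = conjugate z u" "t = conjugate z' u" "(z, z') \<in> \<theta>" "u \<in> lists (tilde A)"
    using assms tildeB_A unfolding conj_indep_def by blast
  have eq: "conjugate a u \<otimes>\<^bsub>F\<^esub> conjugate b u = cls (word_inv u) \<otimes>\<^bsub>F\<^esub> cls [Gen a, Gen b] \<otimes>\<^bsub>F\<^esub> cls u" for a b
  proof -
    have "conjugate a u \<otimes>\<^bsub>F\<^esub> conjugate b u = cls (word_inv u @ [Gen a]) \<otimes>\<^bsub>F\<^esub> cls (u @ word_inv u) \<otimes>\<^bsub>F\<^esub> cls (Gen b # u)"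
      by (simp add: conjugate_def cls_mult)
    also have "\<dots> = cls (word_inv u) \<otimes>\<^bsub>F\<^esub> cls [Gen a, Gen b] \<otimes>\<^bsub>F\<^esub> cls u"
      unfolding cls_word_inv(2)[OF zu(4)] by (simp add: cls_mult)
    finally show ?thesis .
  qed
  show ?thesis unfolding zu(1,2) eq using cls_swap[of "Gen z" "Gen z'"] zu(3) by simp
qed

text \<open>Every letter \<open>z\<close> or \<open>z\<inverse>\<close> with \<open>z \<in> Z\<close> becomes a conjugate by the \<open>B\<close>-part of what follows it. The letters
  of the result are the conjugates as elements of the group, so they depend only on the classes of
  these \<open>B\<close>-parts.\<close>

primrec schreier :: "'a sletter list \<Rightarrow> 'a sletter list set sletter list" where
  "schreier [] = []"
| "schreier (x # w) =
    (if root x \<in> B then [] else [map_sletter (\<lambda>z. conjugate z (B_part w)) x]) @ schreier w"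

text \<open>A suffix acts on the letters before it only through its \<open>B\<close>-part.\<close>

lemma schreier_append_cong:
  assumes "cls (B_part v) = cls (B_part v')" "(schreier v, schreier v') \<in> conj_cong"
  shows "(schreier (u @ v), schreier (u @ v')) \<in> conj_cong"
proof (induction u)
  case (Cons x u)
  have "cls (B_part (u @ v)) = cls (B_part (u @ v'))"
    using assms(1) by (simp flip: cls_mult)
  moreover have "B_part w \<in> lists (tilde A)" for w using B_part_in tildeB_A by blast
  ultimately have "conjugate z (B_part (u @ v)) = conjugate z (B_part (u @ v'))" for z
    using conjugate_cong by blast
  then show ?case using Cons pres_cong_context[of _ _ _ "if root x \<in> B then [] else [_]" "[]"]
    by (simp add: pres_cong_Cons)
qed (simp add: assms)

text \<open>The heart of the proof: rewriting respects the relations of \<open>F(A, \<theta>)\<close>. Swapping \<open>b \<in> B\<close> with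
  \<open>z \<in> Z\<close> replaces \<open>u\<inverse> z u\<close> by \<open>(b u)\<inverse> z (b u)\<close>, which is the same element because \<open>b\<close> and \<open>z\<close>
  commute; swapping two letters of \<open>Z\<close> gives two conjugates by the same \<open>u\<close>; and the \<open>B\<close>-part behind
  \<open>x\<close> and behind \<open>x\<inverse>\<close> is the same in a factor \<open>x x\<inverse>\<close> over \<open>Z\<close>.\<close>

lemma schreier_cong:
  assumes "(u, v) \<in> pres_cong (pc_group_rels A \<theta>)"
  shows "(schreier u, schreier v) \<in> conj_cong"
  using assms
proof induction
  case (rel l r u v)
  have "cls (l @ v) = cls (r @ v)"
    using pres_cong.rel[OF rel, of "[]" v] by (simp add: pres_class_eq_iff)
  then have f: "cls (B_part (l @ v)) = cls (B_part (r @ v))" by (rule cls_B_part)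
  have fA: "B_part w \<in> lists (tilde A)" for w using B_part_in tildeB_A by blast
  consider a b where "(a, b) \<in> \<theta>" "l = [Gen a, Gen b]" "r = [Gen b, Gen a]"
    | x where "x \<in> tilde A" "l = [x, bar x]" "r = []"
    using rel by (auto simp: pc_group_rels_def comm_rels_def)
  then have "(schreier (l @ v), schreier (r @ v)) \<in> conj_cong"
  proof cases
    case 1
    have absorb: "conjugate z (Gen c # B_part v) = conjugate z (B_part v)" if "(c, z) \<in> \<theta>" for c z
      using conjugate_absorb[of "[Gen c]" z "B_part v"] that \<theta>_in[OF that] by (simp add: mem_tilde)
    show ?thesis
    proof (cases "a \<in> B \<or> b \<in> B")
      case True
      then have "schreier (l @ v) = schreier (r @ v)"
        using absorb[OF 1(1)] absorb[OF \<theta>_sym[OF 1(1)]] by (auto simp: 1)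
      then show ?thesis by (simp add: pres_cong.refl)
    next
      case False
      then have "(conjugate a (B_part v), conjugate b (B_part v)) \<in> conj_indep"
        using \<theta>_in[OF 1(1)] 1(1) B_part_in notB_iff by (intro conj_indepI) auto
      then have "([Gen (conjugate a (B_part v)), Gen (conjugate b (B_part v))], [Gen (conjugate b (B_part v)), Gen (conjugate a (B_part v))])
          \<in> pc_group_rels conjugates conj_indep"
        by (auto simp: pc_group_rels_def comm_rels_def)
      from pres_cong.rel[OF this, of "[]" "schreier v"] show ?thesis
        using False by (simp add: 1)
    qed
  next
    case 2
    show ?thesis
    proof (cases "root x \<in> B")
      case True
      then show ?thesis by (simp add: 2 pres_cong.refl)
    next
      case False
      let ?t = "conjugate (root x) (B_part v)"
      have "?t \<in> conjugates"
        using 2(1) False B_part_in notB_iff by (intro conjugatesI) (auto simp: mem_tilde)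
      then have "Gen ?t \<in> tilde conjugates" "Bar ?t \<in> tilde conjugates" by (auto simp: tilde_def)
      then have "([Gen ?t, Bar ?t], []) \<in> pc_group_rels conjugates conj_indep"
        "([Bar ?t, Gen ?t], []) \<in> pc_group_rels conjugates conj_indep"
        unfolding pc_group_rels_def by force+
      from this[THEN pres_cong.rel, of "[]" "schreier v"] show ?thesis
        using False by (cases x) (simp_all add: 2)
    qed
  qed
  with f show ?case by (rule schreier_append_cong)
qed (blast intro: pres_cong.intros)+

text \<open>By \<open>z v = v (v\<inverse> z v)\<close>, a letter of \<open>Z\<close> moves to the right across the \<open>B\<close>-part \<open>v\<close> behind it.\<close>

lemma cls_factorization:
  assumes "w \<in> lists (tilde A)"
  shows "schreier w \<in> lists (tilde conjugates)"
    "cls w = cls (B_part w) \<otimes>\<^bsub>F\<^esub> conj_eval (schreier w)"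
proof -
  have "schreier w \<in> lists (tilde conjugates) \<and> cls w = cls (B_part w) \<otimes>\<^bsub>F\<^esub> conj_eval (schreier w)"
    using assms
  proof induction
    case Nil
    show ?case by (simp add: cls_one cls_mult)
  next
    case (Cons x w)
    let ?u = "B_part w"
    have uB: "?u \<in> lists (tilde B)" and u: "?u \<in> lists (tilde A)" and "word_inv ?u \<in> lists (tilde A)"
      using B_part_in tildeB_A word_inv_B by blast+
    have xA: "root x \<in> A" using Cons by (simp add: mem_tilde)
    have car: "conj_eval (schreier w) \<in> carrier F"
      by (rule F.word_eval_closed[OF signed_closed[OF F.is_group]])
         (use Cons conjugates_closed in auto)
    have ux: "cls (x # ?u) \<in> carrier F" "cls [x] \<in> carrier F" "cls ?u \<in> carrier F"
      by (rule cls_closed; use Cons.hyps u in simp)+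
    have "cls (x # w) = cls [x] \<otimes>\<^bsub>F\<^esub> cls w" by (simp add: cls_mult)
    also have "\<dots> = cls (x # ?u) \<otimes>\<^bsub>F\<^esub> conj_eval (schreier w)"
      using Cons.IH F.m_assoc[OF ux(2,3) car] by (simp add: cls_mult)
    finally have eq: "cls (x # w) = cls (x # ?u) \<otimes>\<^bsub>F\<^esub> conj_eval (schreier w)" .
    show ?case
    proof (cases "root x \<in> B")
      case True
      then show ?thesis using eq Cons by simp
    next
      case False
      let ?c = "cls (word_inv ?u @ x # ?u)"
      have zZ: "root x \<in> Z" using False xA notB_iff by blast
      have signed: "signed F (\<lambda>t. t) (map_sletter (\<lambda>z. conjugate z ?u) x) = ?c"
        using inv_conjugate[OF u xA] by (cases x) (simp_all add: conjugate_def)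
      have "word_inv ?u @ x # ?u \<in> lists (tilde A)" by (rule conjugate_word[OF u xA])
      then have c: "?c \<in> carrier F" by (rule cls_closed)
      have "cls ?u \<otimes>\<^bsub>F\<^esub> ?c = cls (?u @ word_inv ?u) \<otimes>\<^bsub>F\<^esub> cls (x # ?u)" by (simp add: cls_mult)
      also have "\<dots> = cls (x # ?u)" unfolding cls_word_inv(2)[OF u] by (simp add: cls_mult)
      finally have "cls (x # w) = cls ?u \<otimes>\<^bsub>F\<^esub> (?c \<otimes>\<^bsub>F\<^esub> conj_eval (schreier w))"
        using eq F.m_assoc[OF ux(3) c car] by simp
      moreover have "map_sletter (\<lambda>z. conjugate z ?u) x \<in> tilde conjugates"
        using conjugatesI[OF zZ uB] by (cases x) (simp_all add: mem_tilde)
      ultimately show ?thesis using False Cons.IH by (simp add: signed)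
    qed
  qed
  then show "schreier w \<in> lists (tilde conjugates)"
    "cls w = cls (B_part w) \<otimes>\<^bsub>F\<^esub> conj_eval (schreier w)" by auto
qed

lemma schreier_append:
  assumes "cls (B_part v) = cls []"
  shows "schreier (u @ v) = schreier u @ schreier v"
proof (induction u)
  case (Cons x u)
  have "cls (B_part (u @ v)) = cls (B_part u) \<otimes>\<^bsub>F\<^esub> cls (B_part v)" by (simp add: cls_mult)
  also have "\<dots> = cls (B_part u)" unfolding assms by (simp add: cls_mult)
  moreover have "B_part w \<in> lists (tilde A)" for w using B_part_in tildeB_A by blast
  ultimately have "conjugate z (B_part (u @ v)) = conjugate z (B_part u)" for z
    using conjugate_cong by metis
  then show ?case using Cons by simp
qed simp

lemma schreier_B: "u \<in> lists (tilde B) \<Longrightarrow> schreier u = []"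
  by (induction u) (auto simp: mem_tilde)

text \<open>Replace each conjugate by a word \<open>u\<inverse> z u\<close>. Such a word has trivial \<open>B\<close>-part, so it leaves the
  conjugates before it unchanged when the words are concatenated, and is rewritten to the single
  letter \<open>u\<inverse> z u\<close>, whichever \<open>z\<close> and \<open>u\<close> represent it.\<close>

lemma schreier_surj:
  assumes "v \<in> lists (tilde conjugates)"
  shows "\<exists>w\<in>lists (tilde A). cls w = conj_eval v \<and> schreier w = v \<and> cls (B_part w) = cls []"
  using assms
proof induction
  case Nil
  show ?case by (intro bexI[of _ "[]"]) (auto simp: cls_one)
next
  case (Cons t v)
  then obtain w where w: "w \<in> lists (tilde A)" "cls w = conj_eval v" "schreier w = v"
    "cls (B_part w) = cls []" by blast
  obtain z u where zu: "z \<in> Z" "u \<in> lists (tilde B)" "root t = conjugate z u"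
    using Cons.hyps(1) unfolding mem_tilde conjugates_def by blast
  \<comment> \<open>\<open>z\<close> with the sign of \<open>t\<close>\<close>
  define x where "x = map_sletter (\<lambda>_. z) t"
  have x: "root x = z" by (cases t) (simp_all add: x_def)
  let ?w = "word_inv u @ x # u"
  have uA: "u \<in> lists (tilde A)" using zu tildeB_A by blast
  have zA: "z \<in> A" using zu Z_sub by blast
  have wA: "?w \<in> lists (tilde A)" using uA zA x by (intro conjugate_word) simp_all
  have c: "cls ?w = signed F (\<lambda>t. t) t"
    using zu(3) inv_conjugate[OF uA zA] by (cases t) (simp_all add: x_def conjugate_def)
  have f: "B_part ?w = word_inv u @ u"
    using zu B_part_id[OF zu(2)] B_part_id[OF word_inv_B[OF zu(2)]] x Z_notB by simp
  have "schreier (x # u) = [map_sletter (\<lambda>z. conjugate z u) x]"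
    using x zu Z_notB B_part_id[OF zu(2)] schreier_B[OF zu(2)] by simp
  also have "\<dots> = [t]" using zu(3) by (cases t) (simp_all add: x_def)
  finally have "schreier ?w = [t]"
  proof -
    assume s: "schreier (x # u) = [t]"
    have "schreier (v @ x # u) = [t]" if "v \<in> lists (tilde B)" for v
      using that s by induction (auto simp: mem_tilde)
    then show ?thesis using word_inv_B[OF zu(2)] by blast
  qed
  then have "schreier (?w @ w) = t # v"
    using schreier_append[OF w(4), of ?w] w(3) by simp
  moreover have "cls (B_part (?w @ w)) = cls []"
  proof -
    have "cls (B_part (?w @ w)) = cls (B_part ?w) \<otimes>\<^bsub>F\<^esub> cls (B_part w)" by (simp add: cls_mult)
    then show ?thesis unfolding w(4) f cls_word_inv(1)[OF uA] by (simp add: cls_mult)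
  qed
  moreover have "cls (?w @ w) = conj_eval (t # v)"
    unfolding cls_mult[of ?w w, symmetric] c w(2) by simp
  ultimately show ?case using wA w(1) by (intro bexI[of _ "?w @ w"]) auto
qed

lemma conj_eval_inj:
  assumes "u \<in> lists (tilde conjugates)" "v \<in> lists (tilde conjugates)" "conj_eval u = conj_eval v"
  shows "(u, v) \<in> conj_cong"
proof -
  obtain u' v' where "cls u' = conj_eval u" "schreier u' = u" "cls v' = conj_eval v" "schreier v' = v"
    using schreier_surj[OF assms(1)] schreier_surj[OF assms(2)] by blast
  then show ?thesis using schreier_cong[of u' v'] assms(3) by (metis pres_class_eq_iff)
qed

section \<open>The semidirect decomposition\<close>

lemma gen_cls: "gen A \<theta> a = cls [Gen a]"
  by (simp add: gen_def)

lemma cls_gen_closed: "a \<in> A \<Longrightarrow> gen A \<theta> a \<in> carrier F"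
  unfolding gen_cls by (rule cls_closed) (simp add: mem_tilde)

lemma signed_gen: "x \<in> tilde A \<Longrightarrow> signed F (gen A \<theta>) x = cls [x]"
  using sletter_class[of x A \<theta>] by (simp add: signed_def)

lemma gen_eval: "w \<in> lists (tilde A) \<Longrightarrow> word_eval F (signed F (gen A \<theta>)) w = cls w"
  by (induction w rule: lists.induct) (simp_all add: cls_one cls_mult signed_gen)

lemma generate_B: "generate F (gen A \<theta> ` B) = cls ` lists (tilde B)"
proof -
  have "generate F (gen A \<theta> ` B) = word_eval F (signed F (gen A \<theta>)) ` lists (tilde B)"
    using cls_gen_closed B_sub by (intro generate_word_eval F.is_group) auto
  then show ?thesis using gen_eval tildeB_A by (simp cong: image_cong)
qed

definition retraction :: "'a sletter list set \<Rightarrow> 'a sletter list set" where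
  "retraction = pres_lift F (signed F (\<lambda>a. if a \<in> B then gen A \<theta> a else \<one>\<^bsub>F\<^esub>))"

lemma retraction_hom: "retraction \<in> hom F F"
  and retraction_cls: "w \<in> lists (tilde A) \<Longrightarrow> retraction (cls w) = cls (B_part w)"
proof -
  let ?f = "\<lambda>a. if a \<in> B then gen A \<theta> a else \<one>\<^bsub>F\<^esub>"
  have sub: "\<theta> \<subseteq> A \<times> A" using \<theta>_in by auto
  have cl: "?f ` A \<subseteq> carrier F" using cls_gen_closed by auto
  have comm: "?f a \<otimes>\<^bsub>F\<^esub> ?f b = ?f b \<otimes>\<^bsub>F\<^esub> ?f a" if "(a, b) \<in> \<theta>" for a b
    using cls_swap[of "Gen a" "Gen b"] that \<theta>_in[OF that] cls_gen_closed
    by (auto simp: gen_cls cls_mult)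
  note lift = pc_group_lift[OF F.is_group sub cl comm]
  show "retraction \<in> hom F F" unfolding retraction_def by (rule lift(1))
  assume w: "w \<in> lists (tilde A)"
  have "word_eval F (signed F ?f) w = cls (B_part w)" using w
  proof induction
    case (Cons x w)
    have "signed F ?f x = (if root x \<in> B then cls [x] else \<one>\<^bsub>F\<^esub>)"
      using signed_gen[OF Cons.hyps(1)] by (cases x) auto
    moreover have "cls (B_part w) \<in> carrier F" using B_part_in tildeB_A cls_closed by blast
    ultimately show ?case using Cons by (simp add: cls_mult)
  qed (simp add: cls_one)
  then show "retraction (cls w) = cls (B_part w)" unfolding retraction_def using lift(2)[OF _ w] by simp
qed

sublocale retraction: group_hom F F retraction
  using retraction_hom by (simp add: group_hom_def group_hom_axioms_def F.is_group)

lemma conjugates_generate: "generate F conjugates = conj_eval ` lists (tilde conjugates)"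
  using generate_word_eval[OF F.is_group, of "\<lambda>t. t" conjugates] conjugates_closed by simp

text \<open>An element with trivial \<open>B\<close>-part is the value of its rewritten word. As a kernel, the subgroup
  generated by the conjugates is normal.\<close>

lemma kernel_retraction: "kernel F F retraction = generate F conjugates"
proof
  show "kernel F F retraction \<subseteq> generate F conjugates"
  proof
    fix g assume g: "g \<in> kernel F F retraction"
    obtain w where w: "w \<in> lists (tilde A)" "g = cls w"
      using g by (auto simp: kernel_def elim: F_carrierE)
    have "cls (B_part w) = \<one>\<^bsub>F\<^esub>" using g retraction_cls[OF w(1)] w(2) by (simp add: kernel_def)
    moreover have "conj_eval (schreier w) \<in> carrier F"
      by (rule F.word_eval_closed[OF signed_closed[OF F.is_group]])
        (use cls_factorization(1)[OF w(1)] conjugates_closed in auto)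
    ultimately have "g = conj_eval (schreier w)"
      using cls_factorization(2)[OF w(1)] w(2) by simp
    then show "g \<in> generate F conjugates"
      unfolding conjugates_generate using cls_factorization(1)[OF w(1)] by blast
  qed
  show "generate F conjugates \<subseteq> kernel F F retraction"
  proof (rule F.generate_subgroup_incl[OF _ retraction.subgroup_kernel])
    show "conjugates \<subseteq> kernel F F retraction"
    proof
      fix t assume "t \<in> conjugates"
      then obtain z u where zu: "t = conjugate z u" "z \<in> Z" "u \<in> lists (tilde B)"
        unfolding conjugates_def by blast
      have "cls (B_part (word_inv u @ Gen z # u)) = cls []"
        using zu B_part_id word_inv_B cls_word_inv(1)[OF tildeB_A[OF zu(3)]] Z_notB by simp
      moreover have "word_inv u @ Gen z # u \<in> lists (tilde A)"
        using zu Z_sub tildeB_A by (intro conjugate_word) auto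
      ultimately show "t \<in> kernel F F retraction"
        using retraction_cls cls_closed by (simp add: kernel_def zu(1) conjugate_def cls_one)
    qed
  qed
qed

text \<open>A normal subgroup that contains \<open>Z\<close> contains the conjugates; the subgroup that they generate is
  normal by \<open>kernel_retraction\<close> and contains \<open>Z\<close>.\<close>

lemma H_Z_eq: "H_Z A \<theta> Z = generate F conjugates"
proof
  have "gen A \<theta> ` Z \<subseteq> conjugates"
    using conjugatesI[of _ "[]"] by (auto simp: conjugate_def gen_cls)
  then have "gen A \<theta> ` Z \<subseteq> generate F conjugates"
    using generate.incl[of _ conjugates F] by (meson subset_iff)
  moreover have "generate F conjugates \<lhd> F"
    using retraction.normal_kernel by (simp add: kernel_retraction)
  ultimately show "H_Z A \<theta> Z \<subseteq> generate F conjugates"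
    unfolding H_Z_def by (intro hull_minimal)
  show "generate F conjugates \<subseteq> H_Z A \<theta> Z"
    unfolding H_Z_def hull_def
  proof (rule Inter_greatest)
    fix N assume "N \<in> {t. t \<lhd> F \<and> gen A \<theta> ` Z \<subseteq> t}"
    then have N: "N \<lhd> F" "gen A \<theta> ` Z \<subseteq> N" by auto
    interpret N: normal N F by fact
    show "generate F conjugates \<subseteq> N"
    proof (rule F.generate_subgroup_incl[OF _ N.is_subgroup])
      show "conjugates \<subseteq> N"
      proof
        fix t assume "t \<in> conjugates"
        then obtain z u where zu: "t = conjugate z u" "z \<in> Z" "u \<in> lists (tilde B)"
          unfolding conjugates_def by blast
        then have "u \<in> lists (tilde A)" using tildeB_A by blast
        then show "t \<in> N"
          using N.inv_op_closed1[of "cls u" "cls [Gen z]"] cls_closed N(2) zu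
          by (auto simp: conjugate_eq gen_cls)
      qed
    qed
  qed
qed

lemma semidirect: "internal_semidirect F (generate F (gen A \<theta> ` B)) (H_Z A \<theta> Z)"
  unfolding internal_semidirect_def
proof (intro conjI)
  have genB: "gen A \<theta> ` B \<subseteq> carrier F" using cls_gen_closed B_sub by auto
  show K: "subgroup (generate F (gen A \<theta> ` B)) F" by (rule F.generate_is_subgroup[OF genB])
  show N: "H_Z A \<theta> Z \<lhd> F" using retraction.normal_kernel by (simp add: kernel_retraction H_Z_eq)
  have H: "subgroup (H_Z A \<theta> Z) F" using N by (simp add: normal_def)
  show "generate F (gen A \<theta> ` B) <#>\<^bsub>F\<^esub> H_Z A \<theta> Z = carrier F"
  proof
    show "generate F (gen A \<theta> ` B) <#>\<^bsub>F\<^esub> H_Z A \<theta> Z \<subseteq> carrier F"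
      using subgroup.subset[OF K] subgroup.subset[OF H] by (rule F.set_mult_closed)
    show "carrier F \<subseteq> generate F (gen A \<theta> ` B) <#>\<^bsub>F\<^esub> H_Z A \<theta> Z"
    proof
      fix g assume "g \<in> carrier F"
      then obtain w where w: "w \<in> lists (tilde A)" "g = cls w" by (rule F_carrierE)
      have "cls (B_part w) \<in> generate F (gen A \<theta> ` B)" using B_part_in by (simp add: generate_B)
      moreover have "conj_eval (schreier w) \<in> H_Z A \<theta> Z"
        using cls_factorization(1)[OF w(1)] by (simp add: H_Z_eq conjugates_generate)
      ultimately show "g \<in> generate F (gen A \<theta> ` B) <#>\<^bsub>F\<^esub> H_Z A \<theta> Z"
        using cls_factorization(2)[OF w(1)] w(2) unfolding set_mult_def by blast
    qed
  qed
  show "generate F (gen A \<theta> ` B) \<inter> H_Z A \<theta> Z = {\<one>\<^bsub>F\<^esub>}"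
  proof
    show "{\<one>\<^bsub>F\<^esub>} \<subseteq> generate F (gen A \<theta> ` B) \<inter> H_Z A \<theta> Z"
      using subgroup.one_closed[OF K] subgroup.one_closed[OF H] by simp
    show "generate F (gen A \<theta> ` B) \<inter> H_Z A \<theta> Z \<subseteq> {\<one>\<^bsub>F\<^esub>}"
    proof
      fix g assume g: "g \<in> generate F (gen A \<theta> ` B) \<inter> H_Z A \<theta> Z"
      then obtain u where u: "u \<in> lists (tilde B)" "g = cls u" by (auto simp: generate_B)
      have "retraction g = \<one>\<^bsub>F\<^esub>" using g by (simp add: H_Z_eq kernel_def flip: kernel_retraction)
      then show "g \<in> {\<one>\<^bsub>F\<^esub>}" using retraction_cls[OF tildeB_A[OF u(1)]] B_part_id[OF u(1)] u(2) by simp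
    qed
  qed
qed

lemma iso_B:
  "\<exists>\<iota> \<in> iso (pc_group B (restr \<theta> B)) (F\<lparr>carrier := generate F (gen A \<theta> ` B)\<rparr>).
    \<forall>b\<in>B. \<iota> (gen B (restr \<theta> B) b) = gen A \<theta> b"
proof (rule pc_group_iso_generate)
  show "group F" by (rule F.is_group)
  show "restr \<theta> B \<subseteq> B \<times> B" by (simp add: restr_def)
  show "gen A \<theta> ` B \<subseteq> carrier F" using cls_gen_closed B_sub by auto
  show "gen A \<theta> a \<otimes>\<^bsub>F\<^esub> gen A \<theta> b = gen A \<theta> b \<otimes>\<^bsub>F\<^esub> gen A \<theta> a" if "(a, b) \<in> restr \<theta> B" for a b
    using that cls_swap[of "Gen a" "Gen b"] by (simp add: restr_def gen_cls cls_mult)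
  fix u v assume uv: "u \<in> lists (tilde B)" "v \<in> lists (tilde B)"
    and eq: "word_eval F (signed F (gen A \<theta>)) u = word_eval F (signed F (gen A \<theta>)) v"
  have "(u, v) \<in> pres_cong (pc_group_rels A \<theta>)"
    using eq unfolding gen_eval[OF tildeB_A[OF uv(1)]] gen_eval[OF tildeB_A[OF uv(2)]] pres_class_eq_iff .
  from filter_root_cong[OF B_sub this]
  show "(u, v) \<in> pres_cong (pc_group_rels B (restr \<theta> B))"
    using B_part_id[OF uv(1)] B_part_id[OF uv(2)] by simp
qed

section \<open>Conjugates and their minimal representatives\<close>

text \<open>Killing \<open>B\<close> instead of \<open>Z\<close> recovers the conjugated letter.\<close>

lemma conjugate_letter:
  assumes "conjugate z u = conjugate z' u'" "z \<in> Z" "z' \<in> Z" "u \<in> lists (tilde B)" "u' \<in> lists (tilde B)"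
  shows "z = z'"
proof -
  let ?f = "filter (\<lambda>x. root x \<in> Z)"
  have "?f w = []" if "w \<in> lists (tilde B)" for w
    using that Z_notB by (auto simp: mem_tilde filter_empty_conv)
  then have "?f (word_inv u @ Gen z # u) = [Gen z]" "?f (word_inv u' @ Gen z' # u') = [Gen z']"
    using assms word_inv_B by simp_all
  then have "([Gen z], [Gen z']) \<in> pres_cong (pc_group_rels Z (restr \<theta> Z))"
    using filter_root_cong[OF Z_sub] assms(1) unfolding conjugate_def pres_class_eq_iff by metis
  then have "cls [Gen z] = cls [Gen z']"
    using pres_cong_mono[OF pc_group_rels_restr[OF Z_sub]] by (simp add: pres_class_eq_iff)
  then show ?thesis by (rule gen_inject)
qed

lemma conj_indep_alphabet: "independence_alphabet conjugates conj_indep"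
  unfolding independence_alphabet_def
proof (intro conjI)
  show "conj_indep \<subseteq> conjugates \<times> conjugates" by (rule conj_indep_sub)
  show "sym conj_indep" unfolding sym_def conj_indep_def using \<theta>_sym by blast
  have False if "z \<in> Z" "z' \<in> Z" "(z, z') \<in> \<theta>" "u \<in> lists (tilde B)" "conjugate z u = conjugate z' u" for z z' u
    using conjugate_letter[OF that(5,1,2,4,4)] that(3) \<theta>_irrefl by simp
  then show "irrefl conj_indep" unfolding irrefl_def conj_indep_def by fast
qed

text \<open>If two distinct conjugates commute in \<open>F(A, \<theta>)\<close>, they commute as generators of the free partially
  commutative group on the conjugates, by \<open>conj_eval_inj\<close>; hence they are independent there.\<close>

lemma conj_indep_iff:
  "(s, t) \<in> conj_indep \<longleftrightarrow>
    s \<in> conjugates \<and> t \<in> conjugates \<and> s \<otimes>\<^bsub>F\<^esub> t = t \<otimes>\<^bsub>F\<^esub> s \<and> s \<noteq> t"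
proof
  assume st: "(s, t) \<in> conj_indep"
  then show "s \<in> conjugates \<and> t \<in> conjugates \<and> s \<otimes>\<^bsub>F\<^esub> t = t \<otimes>\<^bsub>F\<^esub> s \<and> s \<noteq> t"
    using conj_indep_sub conj_indep_commute[OF st] conj_indep_alphabet
    by (auto simp: independence_alphabet_def irrefl_def)
next
  assume st: "s \<in> conjugates \<and> t \<in> conjugates \<and> s \<otimes>\<^bsub>F\<^esub> t = t \<otimes>\<^bsub>F\<^esub> s \<and> s \<noteq> t"
  interpret R: signed_indep conjugates conj_indep
    by unfold_locales (rule conj_indep_alphabet)
  have "s \<in> carrier F" "t \<in> carrier F" using st conjugates_closed by auto
  then have "([Gen s, Gen t], [Gen t, Gen s]) \<in> conj_cong"
    using st by (intro conj_eval_inj) (simp_all add: mem_tilde)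
  then have "R.cls [Gen s, Gen t] = R.cls [Gen t, Gen s]" by (simp add: pres_class_eq_iff)
  then show "(s, t) \<in> conj_indep" using st by (intro R.gen_commuteD) simp_all
qed

definition minimal :: "'a \<Rightarrow> 'a sletter list \<Rightarrow> bool" where
  "minimal z w \<longleftrightarrow> w \<in> lists (tilde B) \<and> irreducible_word \<eta> w \<and> anchored \<eta> (Gen z) w"

lemma set_normal_form: "set (foldr (cancel_mult \<eta>) u v) \<subseteq> set u \<union> set v"
  by (induction u) (auto simp: cancel_mult_def[of \<eta>] dest: notin_set_remove1 split: if_splits)

lemma normal_form_B: "w \<in> lists (tilde B) \<Longrightarrow> normal_form \<eta> w \<in> lists (tilde B)"
  using set_normal_form[of w "[]"] by (auto simp: lists_eq_set)

text \<open>A shortest word that gives the conjugate is irreducible, and an initial letter that commutes with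
  \<open>z\<close> could be dropped.\<close>

lemma minimal_exists:
  assumes z: "z \<in> Z" and u: "u \<in> lists (tilde B)"
  shows "\<exists>w. minimal z w \<and> conjugate z w = conjugate z u"
proof -
  let ?P = "\<lambda>w. w \<in> lists (tilde B) \<and> conjugate z w = conjugate z u"
  obtain w where w: "?P w" "\<And>v. ?P v \<Longrightarrow> length w \<le> length v"
    using ex_has_least_nat[of ?P u length] u by blast
  have wA: "w \<in> lists (tilde A)" using w tildeB_A by blast
  have "?P (normal_form \<eta> w)"
    using cls_foldr_cancel_mult[OF wA, of "[]"] w(1) wA normal_form_B conjugate_cong[of w "normal_form \<eta> w"]
    by auto
  then have irr: "irreducible_word \<eta> w"
    using w(2) length_normal_form[of w] by (simp add: le_antisym)
  have "anchored \<eta> (Gen z) w"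
    unfolding anchored_def
  proof (intro allI impI notI)
    fix x assume x: "initial \<eta> x w" "(Gen z, x) \<in> \<eta>"
    let ?v = "remove1 x w"
    have v: "?v \<in> lists (tilde B)" "x \<in> tilde B"
      using w(1) initial_in_set[OF x(1)] set_remove1_subset[of x w] by (auto simp: lists_eq_set)
    have xv: "x # ?v \<in> lists (tilde A)" using v by (intro tildeB_A) simp
    have "cls w = cls (x # ?v)"
      by (rule cls_trace_cong[OF wA initial_to_front[OF sym_\<eta> x(1)]])
    then have "conjugate z w = conjugate z ([x] @ ?v)" using conjugate_cong[OF wA xv] by simp
    also have "\<dots> = conjugate z ?v"
      using x(2) xv \<theta>_sym by (intro conjugate_absorb) (auto simp: \<eta>_iff)
    finally have "?P ?v" using v w(1) by simp
    then have "length w \<le> length ?v" by (rule w(2))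
    moreover have "Suc (length ?v) = length w"
      using initial_in_set[OF x(1)] length_pos_if_in_set[of x w] by (simp add: length_remove1)
    ultimately show False by linarith
  qed
  then show ?thesis using irr w(1) by (auto simp: minimal_def)
qed

text \<open>The centralizer of \<open>z\<close>: since \<open>u\<close> contains neither \<open>z\<close> nor its inverse, both \<open>z u\<close> and \<open>u z\<close> are
  irreducible, so \<open>z\<close> can be moved through \<open>u\<close> by commutations.\<close>

lemma commute_with_letter:
  assumes "z \<in> Z" "u \<in> lists (tilde B)" "irreducible_word \<eta> u" "cls (Gen z # u) = cls (u @ [Gen z])"
    "x \<in> set u"
  shows "(x, Gen z) \<in> \<eta>"
proof -
  have nz: "root x \<noteq> z" if "x \<in> tilde B" for x
    using that Z_notB[OF assms(1)] by (auto simp: mem_tilde)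
  have 1: "irreducible_word \<eta> (Gen z # u)"
    using assms(2,3) nz initial_in_set[of \<eta> "Bar z" u] by fastforce
  have 2: "irreducible_word \<eta> (u @ [Gen z])" using assms(2,3)
  proof (induction u)
    case (Cons x u)
    then have "bar x \<noteq> Gen z" using nz[of x] by (metis bar_simps(2) lists.cases list.inject list.distinct(1) root.simps(1))
    then show ?case using Cons by (auto simp: initial_append)
  qed simp
  have "initial \<eta> (Gen z) (u @ [Gen z])"
    using initial_cong[OF sym_\<eta> cls_irreducible_eq[OF assms(4) 1 2], of "Gen z"] by simp
  moreover have "\<not> initial \<eta> (Gen z) u"
    using assms(2) nz initial_in_set[of \<eta> "Gen z" u] by fastforce
  ultimately show ?thesis using assms(5) by (simp add: initial_append)
qed

text \<open>Multiplying an anchored word by letters that commute with \<open>z\<close> cancels nothing in it, since none of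
  its initial letters commutes with \<open>z\<close>.\<close>

lemma cancel_mult_anchored:
  assumes "\<And>x. x \<in> set u \<Longrightarrow> (x, Gen z) \<in> \<eta>" "anchored \<eta> (Gen z) w"
  shows "\<exists>p. foldr (cancel_mult \<eta>) u w = p @ w \<and> (\<forall>x\<in>set p. (x, Gen z) \<in> \<eta>)"
  using assms(1)
proof (induction u)
  case (Cons x u)
  then obtain p where p: "foldr (cancel_mult \<eta>) u w = p @ w" "\<forall>x\<in>set p. (x, Gen z) \<in> \<eta>"
    by auto
  have "(x, Gen z) \<in> \<eta>" using Cons by simp
  then have "\<not> initial \<eta> (bar x) w"
    using assms(2) symD[OF sym_\<eta> \<eta>_bar(1)] by (auto simp: anchored_def)
  then have i: "initial \<eta> (bar x) (p @ w) \<Longrightarrow> bar x \<in> set p"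
    by (auto simp: initial_append dest: initial_in_set)
  show ?case
  proof (cases "initial \<eta> (bar x) (p @ w)")
    case True
    then show ?thesis using p i set_remove1_subset[of "bar x" p]
      by (intro exI[of _ "remove1 (bar x) p"]) (auto simp: cancel_mult_def[of \<eta> x] remove1_append)
  next
    case False
    then show ?thesis using p Cons.prems
      by (intro exI[of _ "x # p"]) (auto simp: cancel_mult_def[of \<eta> x])
  qed
qed simp

text \<open>The element \<open>u = w w'\<inverse>\<close> centralizes \<open>z\<close>, so its letters commute with \<open>z\<close>. Then \<open>w = u w'\<close> is the
  irreducible trace \<open>p w'\<close> for some \<open>p\<close> over these letters, and \<open>p\<close> is empty because \<open>w\<close> is anchored.\<close>

lemma minimal_unique:
  assumes z: "z \<in> Z" and w: "minimal z w" and w': "minimal z w'" and eq: "conjugate z w = conjugate z w'"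
  shows "(w, w') \<in> pres_cong (comm_rels \<eta>)"
proof -
  let ?v = "w @ word_inv w'" let ?u = "normal_form \<eta> ?v"
  have B: "w \<in> lists (tilde B)" "w' \<in> lists (tilde B)" using w w' by (auto simp: minimal_def)
  note A = tildeB_A[OF B(1)] tildeB_A[OF B(2)]
  have vB: "?v \<in> lists (tilde B)" using B word_inv_B by simp
  have vA: "?v \<in> lists (tilde A)" using tildeB_A[OF vB] .
  have uA: "?u \<in> lists (tilde A)" using normal_form_B[OF vB] tildeB_A by blast
  have u: "cls ?u = cls ?v" using cls_foldr_cancel_mult(1)[OF vA, of "[]"] by simp
  have v: "cls ?v = cls w \<otimes>\<^bsub>F\<^esub> inv\<^bsub>F\<^esub> cls w'" by (simp add: cls_word_inv(3)[OF A(2)] cls_mult)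
  have zA: "cls [Gen z] \<in> carrier F" using z Z_sub by (intro cls_closed) (auto simp: mem_tilde)
  have "cls [Gen z] \<otimes>\<^bsub>F\<^esub> cls ?v = cls ?v \<otimes>\<^bsub>F\<^esub> cls [Gen z]"
    unfolding v using F.conj_eq_commute[OF cls_closed[OF A(1)] cls_closed[OF A(2)] zA] eq
    by (simp add: conjugate_eq[OF A(1)] conjugate_eq[OF A(2)])
  then have comm: "cls (Gen z # ?u) = cls (?u @ [Gen z])"
    unfolding u[symmetric] cls_mult by simp
  have c: "(x, Gen z) \<in> \<eta>" if "x \<in> set ?u" for x
    by (rule commute_with_letter[OF z normal_form_B[OF vB] irreducible_normal_form comm that])
  have "anchored \<eta> (Gen z) w'" using w' by (simp add: minimal_def)
  from cancel_mult_anchored[OF c this]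
  obtain p where p: "foldr (cancel_mult \<eta>) ?u w' = p @ w'" "\<forall>x\<in>set p. (x, Gen z) \<in> \<eta>"
    by blast
  have "irreducible_word \<eta> (foldr (cancel_mult \<eta>) y w')" for y
    using w' by (induction y) (auto simp: minimal_def intro: irreducible_cancel_mult)
  then have irr: "irreducible_word \<eta> (p @ w')" using p(1) by metis
  have "cls (p @ w') = cls ?u \<otimes>\<^bsub>F\<^esub> cls w'"
    using cls_foldr_cancel_mult(1)[OF uA A(2)] p(1) by (simp add: cls_mult)
  also have "\<dots> = cls w \<otimes>\<^bsub>F\<^esub> cls (word_inv w' @ w')" unfolding u by (simp add: cls_mult)
  also have "\<dots> = cls w" unfolding cls_word_inv(1)[OF A(2)] by (simp add: cls_mult)
  finally have ww: "(w, p @ w') \<in> pres_cong (comm_rels \<eta>)"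
    using irr w by (intro cls_irreducible_eq) (auto simp: minimal_def)
  have "p = []"
  proof (cases p)
    case (Cons x q)
    then have "initial \<eta> x w" using initial_cong[OF sym_\<eta> ww] by simp
    then show ?thesis using w p(2) Cons symD[OF sym_\<eta>] by (auto simp: minimal_def anchored_def)
  qed
  then show ?thesis using ww by simp
qed

lemma tilde_sub: "tilde B \<subseteq> tilde A" "Gen ` Z \<subseteq> tilde A"
  using B_sub Z_sub by (auto simp: tilde_def)

lemma Gen_front_cong:
  assumes "(Gen z # w, Gen z' # w') \<in> pres_cong (comm_rels \<eta>)" "z \<in> Z" "w' \<in> lists (tilde B)"
  shows "z = z'" "(w, w') \<in> pres_cong (comm_rels \<eta>)"
proof -
  have "Gen z \<in> set (Gen z' # w')" using comm_cong_same(1)[OF assms(1)] list.set_intros(1) by metis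
  moreover have "Gen z \<notin> tilde B" using Z_notB[OF assms(2)] by (simp add: mem_tilde)
  ultimately show "z = z'" using assms(3) by auto
  then show "(w, w') \<in> pres_cong (comm_rels \<eta>)" using trace_cancel_Cons assms(1) by metis
qed

lemma irreducible_Gen_Cons:
  assumes "z \<in> Z" "w \<in> lists (tilde B)"
  shows "irreducible_word \<eta> (Gen z # w) \<longleftrightarrow> irreducible_word \<eta> w"
proof -
  have "Bar z \<notin> set w" using assms(2) Z_notB[OF assms(1)] by (auto simp: mem_tilde)
  then show ?thesis using initial_in_set[of \<eta> "Bar z" w] by auto
qed

lemma betaR_trace: "betaR A \<theta> Z B = {trace \<eta> (Gen z # w) | z w. z \<in> Z \<and> minimal z w}"
proof -
  have 1: "trace \<eta> (Gen z # w) \<in> red A \<theta> \<longleftrightarrow> irreducible_word \<eta> w" if "z \<in> Z" "w \<in> lists (tilde B)" for z w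
  proof -
    have "Gen z # w \<in> lists (tilde A)" using that tildeB_A Z_sub by (auto simp: mem_tilde)
    then show ?thesis using red_iff irreducible_Gen_Cons[OF that] by blast
  qed
  show ?thesis
    unfolding betaR_def beta_trace[OF sym_\<eta> irrefl_\<eta> tilde_sub(2,1)]
    using 1 by (auto simp: minimal_def)
qed

lemma zw_trace_trace: "zw_trace A \<theta> z (trace \<eta> w) = trace \<eta> (Gen z # w)"
  by (simp add: zw_trace_def letter_def mult_trace)

text \<open>A pair is given by its trace \<open>z w\<close>: the first letter is the only one over \<open>Z\<close>, and cancelling it
  leaves \<open>w\<close>.\<close>

lemma zw_pairs_iff:
  "(z, W) \<in> zw_pairs A \<theta> Z B \<longleftrightarrow> z \<in> Z \<and> (\<exists>w. W = trace \<eta> w \<and> minimal z w)"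
proof
  assume a: "(z, W) \<in> zw_pairs A \<theta> Z B"
  then have z: "z \<in> Z" and W: "W \<in> carrier (pc_monoid (tilde B) (restr \<eta> (tilde B)))"
    and b: "zw_trace A \<theta> z W \<in> betaR A \<theta> Z B" by (auto simp: zw_pairs_def)
  obtain w where w: "w \<in> lists (tilde B)" "W = trace \<eta> w"
    using W by (rule pc_monoid_carrierE) (simp add: letter_class_restr)
  obtain z' w' where zw': "trace \<eta> (Gen z # w) = trace \<eta> (Gen z' # w')" "minimal z' w'"
    using b unfolding w(2) zw_trace_trace betaR_trace by blast
  have c: "(Gen z # w, Gen z' # w') \<in> pres_cong (comm_rels \<eta>)"
    using zw'(1) by (simp add: pres_class_eq_iff)
  have "w' \<in> lists (tilde B)" using zw'(2) by (simp add: minimal_def)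
  note e = Gen_front_cong[OF c z this]
  have "minimal z w"
    using zw'(2) e w(1) irreducible_word_cong[OF e(2)] anchored_cong[OF sym_\<eta> e(2)]
    by (simp add: minimal_def)
  then show "z \<in> Z \<and> (\<exists>w. W = trace \<eta> w \<and> minimal z w)" using z w by blast
next
  assume "z \<in> Z \<and> (\<exists>w. W = trace \<eta> w \<and> minimal z w)"
  then obtain w where w: "z \<in> Z" "W = trace \<eta> w" "minimal z w" by blast
  then have wB: "w \<in> lists (tilde B)" by (simp add: minimal_def)
  have "trace (restr \<eta> (tilde B)) w \<in> carrier (pc_monoid (tilde B) (restr \<eta> (tilde B)))"
    by (rule trace_in_carrier[OF wB])
  then have "W \<in> carrier (pc_monoid (tilde B) (restr \<eta> (tilde B)))"
    by (simp only: letter_class_restr[OF wB] w(2))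
  moreover have "zw_trace A \<theta> z W \<in> betaR A \<theta> Z B"
    unfolding w(2) zw_trace_trace betaR_trace using w by blast
  ultimately show "(z, W) \<in> zw_pairs A \<theta> Z B" using w(1) by (simp add: zw_pairs_def)
qed

lemma zw_conj_trace:
  assumes "w \<in> lists (tilde B)"
  shows "zw_conj A \<theta> z (trace \<eta> w) = conjugate z w"
  using conjugate_eq[OF tildeB_A[OF assms]] s_map_class[OF indep tildeB_A[OF assms]]
  by (simp add: zw_conj_def gen_cls)

lemma rho_eq: "rho A \<theta> Z B = conjugates"
proof
  show "rho A \<theta> Z B \<subseteq> conjugates"
  proof
    fix t assume "t \<in> rho A \<theta> Z B"
    then obtain z w where zw: "t = zw_conj A \<theta> z (trace \<eta> w)" "z \<in> Z" "minimal z w"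
      unfolding rho_def zw_pairs_iff by blast
    then have "w \<in> lists (tilde B)" by (simp add: minimal_def)
    then show "t \<in> conjugates" using conjugatesI[OF zw(2)] by (simp only: zw(1) zw_conj_trace)
  qed
  show "conjugates \<subseteq> rho A \<theta> Z B"
  proof
    fix t assume "t \<in> conjugates"
    then obtain z u where zu: "t = conjugate z u" "z \<in> Z" "u \<in> lists (tilde B)"
      unfolding conjugates_def by blast
    then obtain w where w: "minimal z w" "conjugate z w = t" using minimal_exists by metis
    then have "(z, trace \<eta> w) \<in> zw_pairs A \<theta> Z B" using zu(2) by (auto simp: zw_pairs_iff)
    moreover have "t = zw_conj A \<theta> z (trace \<eta> w)" using w zw_conj_trace by (simp add: minimal_def)
    ultimately show "t \<in> rho A \<theta> Z B" unfolding rho_def by blast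
  qed
qed

lemma rho_indep_eq: "rho_indep A \<theta> Z B = conj_indep"
  by (auto simp: rho_indep_def rho_eq conj_indep_iff)

lemma iso_rho:
  "\<exists>\<phi> \<in> iso (pc_group (rho A \<theta> Z B) (rho_indep A \<theta> Z B)) (H_group A \<theta> Z).
    \<forall>t\<in>rho A \<theta> Z B. \<phi> (gen (rho A \<theta> Z B) (rho_indep A \<theta> Z B) t) = t"
proof -
  have H: "H_group A \<theta> Z = F\<lparr>carrier := generate F ((\<lambda>t. t) ` conjugates)\<rparr>"
    by (simp add: H_group_def H_Z_eq)
  show ?thesis
    unfolding rho_eq rho_indep_eq H
    by (rule pc_group_iso_generate[OF F.is_group conj_indep_sub _ conj_indep_commute conj_eval_inj])
      (use conjugates_closed in auto)
qed

section \<open>Separation in the graph of non-commuting letters\<close>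

text \<open>One step of a path in the non-commutation graph; only the starting point of a path may lie
  outside of \<open>B\<close>.\<close>

definition dep :: "('a \<times> 'a) set" where
  "dep = {(x, y). y \<in> B \<and> (x, y) \<notin> \<theta>}"

text \<open>The graph condition that is equivalent both to the TFSA property and to injectivity of \<open>\<alpha>\<close>.\<close>

definition separated :: bool where
  "separated \<longleftrightarrow> (\<forall>z\<in>Z. \<forall>z'\<in>Z. \<forall>b. (z, z') \<in> \<theta> \<longrightarrow> (z', b) \<in> dep\<^sup>+ \<longrightarrow> (z, b) \<in> \<theta>)"

text \<open>In an anchored word every letter is held in place by a path of non-commuting letters back to \<open>z\<close>.
  The map \<open>f\<close> allows the letters to be signed.\<close>

lemma anchored_dep:
  assumes "\<And>x y. (x, y) \<in> \<zeta> \<longleftrightarrow> (f x, f y) \<in> \<theta>"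
    and "anchored \<zeta> z w" "f ` set w \<subseteq> B" "b \<in> set w"
  shows "(f z, f b) \<in> dep\<^sup>+"
  using assms(2-)
proof (induction w arbitrary: b rule: rev_induct)
  case (snoc x w)
  have IH: "(f z, f y) \<in> dep\<^sup>+" if "y \<in> set w" for y
    using snoc.prems that by (intro snoc.IH) (auto simp: anchored_def initial_append)
  show ?case
  proof (cases "b \<in> set w")
    case False
    then have b: "b = x" "f x \<in> B" using snoc.prems by auto
    show ?thesis
    proof (cases "\<forall>y\<in>set w. (y, x) \<in> \<zeta>")
      case True
      then have "(z, x) \<notin> \<zeta>" using snoc.prems by (auto simp: anchored_def initial_append)
      then show ?thesis using b by (auto simp: assms(1) dep_def)
    next
      case False
      then obtain y where y: "y \<in> set w" "(f y, f x) \<in> dep" using b by (auto simp: assms(1) dep_def)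
      then show ?thesis using IH[OF y(1)] b(1) by (auto intro: trancl_into_trancl)
    qed
  qed (rule IH)
qed simp

lemma dep_rtrancl_sym:
  assumes "(c, b) \<in> dep\<^sup>*" "c \<in> B"
  shows "(b, c) \<in> dep\<^sup>* \<and> b \<in> B"
  using assms(1)
proof induction
  case (step y y')
  then have "(y', y) \<in> dep" using \<theta>_sym by (auto simp: dep_def)
  then show ?case using step by (auto simp: dep_def intro: converse_rtrancl_into_rtrancl)
qed (simp add: assms)

text \<open>Otherwise \<open>b\<close> and \<open>b'\<close> are adjacent, and the path from \<open>z'\<close> to \<open>b'\<close> continues through \<open>b\<close> back to the
  first letter \<open>c\<close> of the path from \<open>z\<close>. Separation would make \<open>c\<close> commute with \<open>z\<close>.\<close>

lemma separated_dep:
  assumes sep: separated and z: "z \<in> Z" "z' \<in> Z" "(z, z') \<in> \<theta>"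
    and b: "(z, b) \<in> dep\<^sup>+" "(z', b') \<in> dep\<^sup>+"
  shows "(b, b') \<in> \<theta>"
proof (rule ccontr)
  assume "(b, b') \<notin> \<theta>"
  obtain c where c: "(z, c) \<in> dep" "(c, b) \<in> dep\<^sup>*" using tranclD[OF b(1)] by blast
  have "c \<in> B" using c(1) by (simp add: dep_def)
  then have "(b, c) \<in> dep\<^sup>*" "b \<in> B" using dep_rtrancl_sym[OF c(2)] by auto
  moreover from this have "(b', b) \<in> dep" using \<open>(b, b') \<notin> \<theta>\<close> \<theta>_sym by (auto simp: dep_def)
  ultimately have "(z', c) \<in> dep\<^sup>+" using b(2) by (meson trancl_into_trancl trancl_rtrancl_trancl)
  then have "(z, c) \<in> \<theta>" using sep z unfolding separated_def by blast
  then show False using c(1) by (simp add: dep_def)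
qed

lemma separated_alph:
  assumes sep: separated and iff: "\<And>x y. (x, y) \<in> \<zeta> \<longleftrightarrow> (f x, f y) \<in> \<theta>"
    and z: "f x \<in> Z" "f y \<in> Z" "(f x, f y) \<in> \<theta>"
    and u: "anchored \<zeta> x u" "f ` set u \<subseteq> B" and v: "anchored \<zeta> y v" "f ` set v \<subseteq> B"
  shows "set (x # u) \<times> set (y # v) \<subseteq> \<zeta>"
proof -
  have "(a, b) \<in> \<zeta>" if ab: "a \<in> set (x # u)" "b \<in> set (y # v)" for a b
  proof -
    have d: "a = x \<or> (f x, f a) \<in> dep\<^sup>+" "b = y \<or> (f y, f b) \<in> dep\<^sup>+"
      using ab anchored_dep[OF iff u] anchored_dep[OF iff v] by auto
    then consider "a = x" "b = y" | "a = x" "(f y, f b) \<in> dep\<^sup>+" | "(f x, f a) \<in> dep\<^sup>+" "b = y"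
      | "(f x, f a) \<in> dep\<^sup>+" "(f y, f b) \<in> dep\<^sup>+" by blast
    then show ?thesis
    proof cases
      case 2
      then show ?thesis using sep z unfolding separated_def iff by blast
    next
      case 3
      then show ?thesis using sep z \<theta>_sym unfolding separated_def iff by blast
    next
      case 4
      then show ?thesis unfolding iff by (rule separated_dep[OF sep z])
    qed (use z iff in auto)
  qed
  then show ?thesis by blast
qed

text \<open>Cut a path from \<open>z'\<close> that violates separation at its first letter \<open>b\<close> that does not commute with \<open>z\<close>.\<close>

lemma not_separatedE:
  assumes "\<not> separated"
  obtains z z' c b where "z \<in> Z" "z' \<in> Z" "(z, z') \<in> \<theta>" "set c \<subseteq> B" "b \<in> B"
    "\<And>y. y \<in> set c \<Longrightarrow> (z, y) \<in> \<theta>" "(z, b) \<notin> \<theta>"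
    "successively (\<lambda>x y. (x, y) \<notin> \<theta>) (z' # c @ [b])"
proof -
  obtain z z' b0 where z: "z \<in> Z" "z' \<in> Z" "(z, z') \<in> \<theta>" "(z', b0) \<in> dep\<^sup>+" "(z, b0) \<notin> \<theta>"
    using assms unfolding separated_def by blast
  let ?path = "\<lambda>w. successively (\<lambda>x y. (x, y) \<notin> \<theta>) (z' # w)"
  let ?c = "\<lambda>c. set c \<subseteq> B \<and> (\<forall>y\<in>set c. (z, y) \<in> \<theta>)"
  \<comment> \<open>Along the path, either the cut has been found or all letters so far commute with \<open>z\<close>.\<close>
  have "(\<exists>c b. ?c c \<and> b \<in> B \<and> (z, b) \<notin> \<theta> \<and> ?path (c @ [b])) \<or> (\<exists>c. ?c (c @ [b0]) \<and> ?path (c @ [b0]))"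
    using z(4)
  proof induction
    case (base b)
    then have b: "b \<in> B" "?path ([] @ [b])" by (simp_all add: dep_def)
    show ?case
    proof (cases "(z, b) \<in> \<theta>")
      case True
      then have "?c ([] @ [b])" using b(1) by simp
      then show ?thesis using b(2) by blast
    next
      case False
      moreover have "?c []" by simp
      ultimately show ?thesis using b by blast
    qed
  next
    case (step b b')
    from step.IH show ?case
    proof
      assume "\<exists>c. ?c (c @ [b]) \<and> ?path (c @ [b])"
      then obtain c where c: "?c (c @ [b])" "?path (c @ [b])" by blast
      have "?path ((c @ [b]) @ [b'])"
        using successively_append_iff[of "\<lambda>x y. (x, y) \<notin> \<theta>" "z' # c @ [b]" "[b']"] c(2) step.hyps(2)
        by (simp add: dep_def)
      moreover have "b' \<in> B" using step.hyps(2) by (simp add: dep_def)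
      moreover from this have "?c ((c @ [b]) @ [b'])" if "(z, b') \<in> \<theta>" using c(1) that by simp
      ultimately show ?thesis using c(1) by blast
    qed blast
  qed
  then show ?thesis using that z by auto
qed

section \<open>The morphism alpha\<close>

abbreviation \<beta> :: "'a sletter list set set" where
  "\<beta> \<equiv> betaR A \<theta> Z B"

abbreviation \<beta>_indep :: "('a sletter list set \<times> 'a sletter list set) set" where
  "\<beta>_indep \<equiv> induced_indep \<eta> \<beta>"

text \<open>The map \<open>zw \<mapsto> w\<inverse> z w\<close> on \<open>betaR\<close>. The description is unique because the trace \<open>z w\<close> determines
  \<open>z\<close> and \<open>w\<close>; see \<open>conj_of_trace\<close>.\<close>

definition conj_of :: "'a sletter list set \<Rightarrow> 'a sletter list set" where
  "conj_of t = (THE c. \<exists>(z, W)\<in>zw_pairs A \<theta> Z B. t = zw_trace A \<theta> z W \<and> c = zw_conj A \<theta> z W)"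

lemma minimal_B: "minimal z w \<Longrightarrow> w \<in> lists (tilde B)"
  by (simp add: minimal_def)

lemma betaE:
  assumes "t \<in> \<beta>"
  obtains z w where "z \<in> Z" "minimal z w" "t = trace \<eta> (Gen z # w)"
  using assms unfolding betaR_trace by blast

lemma betaI: "z \<in> Z \<Longrightarrow> minimal z w \<Longrightarrow> trace \<eta> (Gen z # w) \<in> \<beta>"
  unfolding betaR_trace by blast

lemma beta_trace_inject:
  assumes "trace \<eta> (Gen z # w) = trace \<eta> (Gen z' # w')" "z \<in> Z" "minimal z' w'"
  shows "z = z'" "(w, w') \<in> pres_cong (comm_rels \<eta>)"
  using Gen_front_cong[OF _ assms(2) minimal_B[OF assms(3)]] assms(1) by (metis pres_class_eq_iff)+

lemma conj_of_trace:
  assumes z: "z \<in> Z" and w: "minimal z w"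
  shows "conj_of (trace \<eta> (Gen z # w)) = conjugate z w"
  unfolding conj_of_def
proof (rule the_equality)
  have "(z, trace \<eta> w) \<in> zw_pairs A \<theta> Z B" using z w by (auto simp: zw_pairs_iff)
  then show "\<exists>(z', W)\<in>zw_pairs A \<theta> Z B. trace \<eta> (Gen z # w) = zw_trace A \<theta> z' W \<and> conjugate z w = zw_conj A \<theta> z' W"
    using zw_trace_trace zw_conj_trace[OF minimal_B[OF w]] by (intro bexI[of _ "(z, trace \<eta> w)"]) simp_all
  fix c assume "\<exists>(z', W)\<in>zw_pairs A \<theta> Z B. trace \<eta> (Gen z # w) = zw_trace A \<theta> z' W \<and> c = zw_conj A \<theta> z' W"
  then obtain z' w' where z': "z' \<in> Z" "minimal z' w'" "trace \<eta> (Gen z' # w') = trace \<eta> (Gen z # w)"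
    "c = zw_conj A \<theta> z' (trace \<eta> w')"
    by (auto simp: zw_pairs_iff zw_trace_trace)
  note e = beta_trace_inject[OF z'(3,1) w]
  have "trace \<eta> w' = trace \<eta> w" using e(2) by (simp add: pres_class_eq_iff)
  then show "c = conjugate z w" using z'(4) e(1) zw_conj_trace[OF minimal_B[OF w]] by simp
qed

lemma conj_of_inj: "inj_on conj_of \<beta>"
proof (rule inj_onI)
  fix s t assume st: "s \<in> \<beta>" "t \<in> \<beta>" "conj_of s = conj_of t"
  obtain z w where zw: "z \<in> Z" "minimal z w" "s = trace \<eta> (Gen z # w)" using st(1) by (rule betaE)
  obtain z' w' where zw': "z' \<in> Z" "minimal z' w'" "t = trace \<eta> (Gen z' # w')" using st(2) by (rule betaE)
  have eq: "conjugate z w = conjugate z' w'" using st(3) conj_of_trace zw zw' by simp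
  have z: "z = z'" by (rule conjugate_letter[OF eq zw(1) zw'(1) minimal_B[OF zw(2)] minimal_B[OF zw'(2)]])
  then have "(w, w') \<in> pres_cong (comm_rels \<eta>)" using minimal_unique zw zw' eq by blast
  then show "s = t" unfolding zw(3) zw'(3) z pres_class_eq_iff by (rule pres_cong_Cons)
qed

lemma conj_of_image: "conj_of ` \<beta> = conjugates"
proof
  show "conj_of ` \<beta> \<subseteq> conjugates"
  proof
    fix c assume "c \<in> conj_of ` \<beta>"
    then obtain t where t: "t \<in> \<beta>" "c = conj_of t" by blast
    obtain z w where zw: "z \<in> Z" "minimal z w" "t = trace \<eta> (Gen z # w)" using t(1) by (rule betaE)
    then show "c \<in> conjugates" using t(2) conj_of_trace conjugatesI minimal_B by simp
  qed
  show "conjugates \<subseteq> conj_of ` \<beta>"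
  proof
    fix c assume "c \<in> conjugates"
    then obtain z u where "c = conjugate z u" "z \<in> Z" "u \<in> lists (tilde B)" unfolding conjugates_def by blast
    then obtain w where w: "minimal z w" "conjugate z w = c" "z \<in> Z" using minimal_exists by metis
    then show "c \<in> conj_of ` \<beta>" using conj_of_trace[OF w(3,1)] betaI[OF w(3,1)] by (metis image_eqI)
  qed
qed

text \<open>If the alphabets of \<open>z w\<close> and \<open>z' w'\<close> are independent, both conjugates can be taken by \<open>w' w = w w'\<close>.\<close>

lemma conj_of_indep:
  assumes "(s, t) \<in> \<beta>_indep"
  shows "(conj_of s, conj_of t) \<in> conj_indep"
proof -
  have st: "s \<in> \<beta>" "t \<in> \<beta>" "Alph s \<times> Alph t \<subseteq> \<eta>" using assms by (auto simp: induced_indep_def)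
  obtain z w where zw: "z \<in> Z" "minimal z w" "s = trace \<eta> (Gen z # w)" using st(1) by (rule betaE)
  obtain z' w' where zw': "z' \<in> Z" "minimal z' w'" "t = trace \<eta> (Gen z' # w')" using st(2) by (rule betaE)
  note B = minimal_B[OF zw(2)] minimal_B[OF zw'(2)]
  note A = tildeB_A[OF B(1)] tildeB_A[OF B(2)]
  have c: "set (Gen z # w) \<times> set (Gen z' # w') \<subseteq> \<eta>" using st(3) unfolding zw(3) zw'(3) Alph_trace .
  then have zz: "(z, z') \<in> \<theta>" by (auto simp: \<eta>_iff)
  have 1: "conjugate z (w' @ w) = conjugate z w"
    using c \<theta>_sym by (intro conjugate_absorb A) (auto simp: \<eta>_iff)
  have 2: "conjugate z' (w @ w') = conjugate z' w'"
    using c by (intro conjugate_absorb A) (auto simp: \<eta>_iff)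
  have "(w @ w', w' @ w) \<in> pres_cong (comm_rels \<eta>)" using c by (intro trace_commute) auto
  then have "cls (w @ w') = cls (w' @ w)" using A by (intro cls_trace_cong) auto
  then have "conjugate z' (w @ w') = conjugate z' (w' @ w)" using A by (intro conjugate_cong) auto
  then have "(conjugate z w, conjugate z' w') \<in> conj_indep"
    using conj_indepI[OF zw(1) zw'(1) zz, of "w' @ w"] B 1 2 by simp
  then show ?thesis using conj_of_trace zw zw' by simp
qed

lemma \<beta>_indep_alphabet: "independence_alphabet \<beta> \<beta>_indep"
  unfolding independence_alphabet_def
proof (intro conjI)
  show "\<beta>_indep \<subseteq> \<beta> \<times> \<beta>" by (auto simp: induced_indep_def)
  show "sym \<beta>_indep" using sym_\<eta> unfolding sym_def induced_indep_def by blast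
  have "(t, t) \<notin> \<beta>_indep" for t
  proof
    assume t: "(t, t) \<in> \<beta>_indep"
    then obtain z w where "t = trace \<eta> (Gen z # w)" by (auto simp: induced_indep_def elim: betaE)
    then have "Gen z \<in> Alph t" by (simp add: Alph_trace)
    then show False using t irrefl_\<eta> by (auto simp: induced_indep_def irrefl_def)
  qed
  then show "irrefl \<beta>_indep" by (simp add: irrefl_def)
qed

text \<open>Under separation the converse of \<open>conj_of_indep\<close> holds: the commutation of \<open>z\<close> and \<open>z'\<close> alone makes
  the alphabets of \<open>z w\<close> and \<open>z' w'\<close> independent.\<close>

lemma separated_conj_indep:
  assumes sep: separated and st: "s \<in> \<beta>" "t \<in> \<beta>" "(conj_of s, conj_of t) \<in> conj_indep"
  shows "(s, t) \<in> \<beta>_indep"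
proof -
  obtain z w where zw: "z \<in> Z" "minimal z w" "s = trace \<eta> (Gen z # w)" using st(1) by (rule betaE)
  obtain z' w' where zw': "z' \<in> Z" "minimal z' w'" "t = trace \<eta> (Gen z' # w')" using st(2) by (rule betaE)
  note B = minimal_B[OF zw(2)] minimal_B[OF zw'(2)]
  have "(conjugate z w, conjugate z' w') \<in> conj_indep" using st(3) conj_of_trace zw zw' by simp
  then obtain y y' u where y: "conjugate z w = conjugate y u" "conjugate z' w' = conjugate y' u" "y \<in> Z" "y' \<in> Z"
    "(y, y') \<in> \<theta>" "u \<in> lists (tilde B)" unfolding conj_indep_def by blast
  have "z = y" "z' = y'"
    using conjugate_letter[OF y(1) zw(1) y(3) B(1) y(6)] conjugate_letter[OF y(2) zw'(1) y(4) B(2) y(6)] by auto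
  then have "set (Gen z # w) \<times> set (Gen z' # w') \<subseteq> \<eta>"
    using zw zw' y(5) B by (intro separated_alph[OF sep, of _ root] \<eta>_iff)
      (auto simp: minimal_def mem_tilde)
  then show ?thesis using st(1,2) unfolding induced_indep_def zw(3) zw'(3) by (simp add: Alph_trace)
qed

definition \<alpha> :: "'a sletter list set sletter list set \<Rightarrow> 'a sletter list set" where
  "\<alpha> = pres_lift F (signed F conj_of)"

lemma \<beta>_lift:
  shows "\<beta>_indep \<subseteq> \<beta> \<times> \<beta>" "conj_of ` \<beta> \<subseteq> carrier F"
    "\<And>s t. (s, t) \<in> \<beta>_indep \<Longrightarrow> conj_of s \<otimes>\<^bsub>F\<^esub> conj_of t = conj_of t \<otimes>\<^bsub>F\<^esub> conj_of s"
proof -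
  show "\<beta>_indep \<subseteq> \<beta> \<times> \<beta>" by (auto simp: induced_indep_def)
  show "conj_of ` \<beta> \<subseteq> carrier F" using conj_of_image conjugates_closed by simp
qed (rule conj_indep_commute[OF conj_of_indep])

lemma \<alpha>_lift:
  shows "\<alpha> \<in> hom (pc_group \<beta> \<beta>_indep) F"
    and "w \<in> lists (tilde \<beta>) \<Longrightarrow> \<alpha> (pres_cong (pc_group_rels \<beta> \<beta>_indep) `` {w}) = word_eval F (signed F conj_of) w"
    and "t \<in> \<beta> \<Longrightarrow> \<alpha> (gen \<beta> \<beta>_indep t) = conj_of t"
  unfolding \<alpha>_def by (intro pc_group_lift F.is_group \<beta>_lift; assumption)+

lemma \<alpha>_inj_on_iff:
  "inj_on \<alpha> (carrier (pc_group \<beta> \<beta>_indep)) \<longleftrightarrow>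
    (\<forall>u\<in>lists (tilde \<beta>). \<forall>v\<in>lists (tilde \<beta>). word_eval F (signed F conj_of) u = word_eval F (signed F conj_of) v
      \<longrightarrow> (u, v) \<in> pres_cong (pc_group_rels \<beta> \<beta>_indep))"
  unfolding \<alpha>_def by (rule pc_group_inj_on_iff[OF F.is_group \<beta>_lift])

lemma \<alpha>_hom: "\<alpha> \<in> hom (pc_group \<beta> \<beta>_indep) (H_group A \<theta> Z)"
proof -
  have "\<alpha> g \<in> H_Z A \<theta> Z" if g: "g \<in> carrier (pc_group \<beta> \<beta>_indep)" for g
  proof -
    obtain w where w: "w \<in> lists (tilde \<beta>)" "g = pres_cong (pc_group_rels \<beta> \<beta>_indep) `` {w}"
      using g unfolding pc_group_def by (rule monoid_pres_carrierE)
    have "word_eval F (signed F conj_of) w \<in> generate F (conj_of ` \<beta>)"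
      unfolding generate_word_eval[OF F.is_group \<beta>_lift(2)] using w(1) by blast
    then show ?thesis using \<alpha>_lift(2)[OF w(1)] w(2) by (simp add: H_Z_eq conj_of_image)
  qed
  then show ?thesis using \<alpha>_lift(1) by (auto simp: hom_def H_group_def)
qed

lemma \<alpha>_zw:
  assumes "(z, W) \<in> zw_pairs A \<theta> Z B"
  shows "\<alpha> (gen \<beta> \<beta>_indep (zw_trace A \<theta> z W)) = zw_conj A \<theta> z W"
proof -
  obtain w where w: "z \<in> Z" "W = trace \<eta> w" "minimal z w" using assms by (auto simp: zw_pairs_iff)
  show ?thesis
    unfolding w(2) zw_trace_trace zw_conj_trace[OF minimal_B[OF w(3)]]
    using \<alpha>_lift(3)[OF betaI[OF w(1,3)]] conj_of_trace[OF w(1,3)] by simp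
qed

text \<open>Under separation \<open>conj_of\<close> is an isomorphism of independence alphabets from \<open>betaR\<close> to the
  conjugates, so a relation between values of \<open>\<alpha>\<close> can be pulled back. Without it, a path from \<open>z'\<close>
  through \<open>c\<close> to a letter \<open>b\<close> as in \<open>not_separatedE\<close> gives the generators \<open>z b\<close> and \<open>z' c b\<close>, which share
  the letter \<open>b\<close> and so do not commute. Their images are the conjugates of \<open>z\<close> and \<open>z'\<close> by \<open>c b\<close>, since
  \<open>z\<close> commutes with \<open>c\<close>, and these commute.\<close>

lemma \<alpha>_inj_iff_separated: "inj_on \<alpha> (carrier (pc_group \<beta> \<beta>_indep)) \<longleftrightarrow> separated"
proof
  assume sep: separated
  show "inj_on \<alpha> (carrier (pc_group \<beta> \<beta>_indep))"
    unfolding \<alpha>_inj_on_iff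
  proof (intro ballI impI)
    fix u v assume uv: "u \<in> lists (tilde \<beta>)" "v \<in> lists (tilde \<beta>)"
      and eq: "word_eval F (signed F conj_of) u = word_eval F (signed F conj_of) v"
    let ?m = "map (map_sletter conj_of)" and ?g = "inv_into \<beta> conj_of"
    have m: "?m w \<in> lists (tilde conjugates) \<and> conj_eval (?m w) = word_eval F (signed F conj_of) w
        \<and> map (map_sletter ?g) (?m w) = w"
      if "w \<in> lists (tilde \<beta>)" for w
      using that
    proof induction
      case (Cons x w)
      have "map_sletter conj_of x \<in> tilde conjugates" "map_sletter ?g (map_sletter conj_of x) = x"
        "signed F (\<lambda>t. t) (map_sletter conj_of x) = signed F conj_of x"
        using Cons.hyps(1) inv_into_f_f[OF conj_of_inj, of "root x"]
        by (cases x; auto simp: mem_tilde simp flip: conj_of_image)+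
      then show ?case using Cons by simp
    qed simp
    have "(?m u, ?m v) \<in> conj_cong" using conj_eval_inj m uv eq by simp
    moreover have "?g ` conjugates \<subseteq> \<beta>" by (simp add: image_subset_iff inv_into_into flip: conj_of_image)
    moreover have "(?g s, ?g t) \<in> \<beta>_indep" if st: "(s, t) \<in> conj_indep" for s t
    proof -
      have "s \<in> conj_of ` \<beta>" "t \<in> conj_of ` \<beta>" using st conj_indep_sub conj_of_image by auto
      then show ?thesis
        using st inv_into_into[of _ conj_of \<beta>] f_inv_into_f[of _ conj_of \<beta>]
        by (intro separated_conj_indep[OF sep]) simp_all
    qed
    ultimately have "(map (map_sletter ?g) (?m u), map (map_sletter ?g) (?m v))
        \<in> pres_cong (pc_group_rels \<beta> \<beta>_indep)"
      by (rule map_sletter_cong)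
    then show "(u, v) \<in> pres_cong (pc_group_rels \<beta> \<beta>_indep)" using m uv by metis
  qed
next
  assume inj: "inj_on \<alpha> (carrier (pc_group \<beta> \<beta>_indep))"
  show separated
  proof (rule ccontr)
    assume "\<not> separated"
    then obtain z z' c b where z: "z \<in> Z" "z' \<in> Z" "(z, z') \<in> \<theta>" and cb: "set c \<subseteq> B" "b \<in> B"
      "\<And>y. y \<in> set c \<Longrightarrow> (z, y) \<in> \<theta>" "(z, b) \<notin> \<theta>"
      and path: "successively (\<lambda>x y. (x, y) \<notin> \<theta>) (z' # c @ [b])"
      by (rule not_separatedE) blast
    have min: "minimal y (map Gen w)"
      if "set w \<subseteq> B" "successively (\<lambda>x y. (x, y) \<notin> \<theta>) (y # w)" for y w
    proof -
      have "successively (\<lambda>x y. (x, y) \<notin> \<eta>) (map Gen (y # w))"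
        using that(2) by (simp only: successively_map) (simp add: \<eta>_iff)
      then have "anchored \<eta> (Gen y) (map Gen w)" by (intro anchored_successively) simp
      moreover have "irreducible_word \<eta> (map Gen w)"
      proof (induction w)
        case (Cons x w)
        have "Bar x \<notin> set (map Gen w)" by auto
        then show ?case using Cons initial_in_set[of \<eta> "Bar x" "map Gen w"] by auto
      qed simp
      moreover have "map Gen w \<in> lists (tilde B)" using that(1) by (simp add: mem_lists_tilde image_image)
      ultimately show ?thesis by (simp add: minimal_def)
    qed
    let ?w = "map Gen (c @ [b])"
    have 1: "minimal z [Gen b]" using min[of "[b]" z] cb by simp
    have 2: "minimal z' ?w" using min[of "c @ [b]" z'] cb path by simp
    let ?s = "trace \<eta> (Gen z # [Gen b])" and ?t = "trace \<eta> (Gen z' # ?w)"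
    interpret R: signed_indep \<beta> \<beta>_indep by unfold_locales (rule \<beta>_indep_alphabet)
    have mem: "?s \<in> \<beta>" "?t \<in> \<beta>" using betaI z 1 2 by auto
    have "conjugate z (map Gen c @ [Gen b]) = conjugate z [Gen b]"
    proof (rule conjugate_absorb)
      show "map Gen c \<in> lists (tilde A)"
        using subset_trans[OF cb(1) B_sub] by (simp add: mem_lists_tilde image_image)
    qed (use cb(3) \<theta>_sym in auto)
    then have "conj_of ?s = conjugate z ?w" using conj_of_trace[OF z(1) 1] by simp
    moreover have "conj_of ?t = conjugate z' ?w" by (rule conj_of_trace[OF z(2) 2])
    ultimately have "(conj_of ?s, conj_of ?t) \<in> conj_indep"
      using conj_indepI[OF z minimal_B[OF 2]] by simp
    then have "conj_of ?s \<otimes>\<^bsub>F\<^esub> conj_of ?t = conj_of ?t \<otimes>\<^bsub>F\<^esub> conj_of ?s" by (rule conj_indep_commute)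
    moreover have "conj_of ?s \<in> carrier F" "conj_of ?t \<in> carrier F" using mem \<beta>_lift(2) by auto
    ultimately have "word_eval F (signed F conj_of) [Gen ?s, Gen ?t] = word_eval F (signed F conj_of) [Gen ?t, Gen ?s]"
      by simp
    moreover have "[Gen ?s, Gen ?t] \<in> lists (tilde \<beta>)" "[Gen ?t, Gen ?s] \<in> lists (tilde \<beta>)"
      using mem by (simp_all add: mem_tilde)
    ultimately have "([Gen ?s, Gen ?t], [Gen ?t, Gen ?s]) \<in> pres_cong (pc_group_rels \<beta> \<beta>_indep)"
      using inj unfolding \<alpha>_inj_on_iff by blast
    moreover have "?s \<noteq> ?t" using beta_trace_inject(1)[OF _ z(1) 2] z(3) \<theta>_irrefl by blast
    ultimately have "(?s, ?t) \<in> \<beta>_indep" by (intro R.gen_commuteD) (simp_all add: pres_class_eq_iff)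
    then have "Alph ?s \<times> Alph ?t \<subseteq> \<eta>" by (simp add: induced_indep_def)
    then have "(Gen b, Gen b) \<in> \<eta>" unfolding Alph_trace by auto
    then show False using irrefl_\<eta> by (simp add: irrefl_def)
  qed
qed

end

section \<open>Unique factorization over beta\<close>

text \<open>A partially commutative code is a set over which factorizations are unique up to the commutations
  between its independent elements.\<close>

lemma pc_code_iff:
  assumes X: "X \<subseteq> carrier (pc_monoid A \<theta>)"
  shows "pc_code A \<theta> X \<longleftrightarrow>
    (\<forall>u\<in>lists X. \<forall>v\<in>lists X. word_eval (pc_monoid A \<theta>) (\<lambda>x. x) u = word_eval (pc_monoid A \<theta>) (\<lambda>x. x) v
      \<longrightarrow> (u, v) \<in> pres_cong (comm_rels (induced_indep \<theta> X)))"
    (is "_ \<longleftrightarrow> ?inj")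
proof -
  let ?M = "pc_monoid A \<theta>" and ?I = "induced_indep \<theta> X"
  let ?ev = "word_eval ?M (\<lambda>x. x)"
  let ?P = "pc_monoid X ?I"
  let ?N = "?M\<lparr>carrier := (\<lambda>N. submonoid N ?M) hull X\<rparr>"
  interpret M: Group.monoid ?M by (rule monoid_pc_monoid)
  have cl: "(\<lambda>x. x) ` X \<subseteq> carrier ?M" using X by simp
  have car: "carrier ?P = trace ?I ` lists X"
    by (auto elim!: pc_monoid_carrierE intro: trace_in_carrier)
  have hull: "(\<lambda>N. submonoid N ?M) hull X = ?ev ` lists X"
  proof
    show "(\<lambda>N. submonoid N ?M) hull X \<subseteq> ?ev ` lists X"
    proof (rule hull_minimal)
      show "X \<subseteq> ?ev ` lists X"
      proof
        fix x assume "x \<in> X"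
        then show "x \<in> ?ev ` lists X" using X by (intro image_eqI[of _ _ "[x]"]) auto
      qed
      show "submonoid (?ev ` lists X) ?M"
      proof (rule submonoid.intro)
        show "?ev ` lists X \<subseteq> carrier ?M" using M.word_eval_closed[OF cl] by blast
        show "\<one>\<^bsub>?M\<^esub> \<in> ?ev ` lists X" by (intro image_eqI[of _ _ "[]"]) auto
        fix s t assume "s \<in> ?ev ` lists X" "t \<in> ?ev ` lists X"
        then obtain u v where "u \<in> lists X" "v \<in> lists X" "s = ?ev u" "t = ?ev v" by blast
        then show "s \<otimes>\<^bsub>?M\<^esub> t \<in> ?ev ` lists X"
          using M.word_eval_append[OF cl] by (intro image_eqI[of _ _ "u @ v"]) auto
      qed
    qed
    show "?ev ` lists X \<subseteq> (\<lambda>N. submonoid N ?M) hull X"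
      unfolding hull_def
    proof (intro Inter_greatest)
      fix N assume "N \<in> {t. submonoid t ?M \<and> X \<subseteq> t}"
      then have N: "submonoid N ?M" "X \<subseteq> N" by auto
      have "?ev w \<in> N" if "w \<in> lists X" for w
        using that by induction (use N in \<open>auto simp: submonoid.one_closed submonoid.m_closed\<close>)
      then show "?ev ` lists X \<subseteq> N" by blast
    qed
  qed
  have comm: "x \<otimes>\<^bsub>?M\<^esub> y = y \<otimes>\<^bsub>?M\<^esub> x" if xy: "(x, y) \<in> ?I" for x y
  proof -
    have "x \<in> X" "y \<in> X" and ind: "Alph x \<times> Alph y \<subseteq> \<theta>" using xy by (auto simp: induced_indep_def)
    then have "x \<in> carrier ?M" "y \<in> carrier ?M" using X by auto
    then obtain u v where uv: "x = trace \<theta> u" "y = trace \<theta> v" by (metis pc_monoid_carrierE)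
    then show ?thesis
      using trace_commute[of u v \<theta>] ind by (simp add: mult_trace Alph_trace pres_class_eq_iff)
  qed
  define h where "h = pres_lift ?M (\<lambda>x. x)"
  have h: "h (trace ?I w) = ?ev w" if w: "w \<in> lists X" for w
    unfolding h_def
  proof (rule M.pres_lift_class[OF cl _ _ _ w])
    show R: "comm_rels ?I \<subseteq> lists X \<times> lists X" by (auto simp: comm_rels_def induced_indep_def)
    show "u @ l @ v \<in> lists X \<longleftrightarrow> u @ r @ v \<in> lists X" if "(l, r) \<in> comm_rels ?I" for u l r v
      using that R by auto
    show "?ev l = ?ev r" if lr: "(l, r) \<in> comm_rels ?I" for l r
    proof -
      obtain x y where xy: "l = [x, y]" "r = [y, x]" "(x, y) \<in> ?I" using lr by (auto simp: comm_rels_def)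
      then have "x \<in> carrier ?M" "y \<in> carrier ?M" using X by (auto simp: induced_indep_def)
      then show ?thesis using comm[OF xy(3)] xy by simp
    qed
  qed
  show ?thesis
  proof
    assume inj: ?inj
    have "h \<in> hom ?P ?N"
    proof (rule homI)
      fix s t assume st: "s \<in> carrier ?P" "t \<in> carrier ?P"
      then obtain u v where uv: "u \<in> lists X" "s = trace ?I u" "v \<in> lists X" "t = trace ?I v"
        unfolding car by blast
      show "h s \<in> carrier ?N" using h[OF uv(1)] uv(1,2) by (simp add: hull)
      have "u @ v \<in> lists X" using uv by simp
      from h[OF this] show "h (s \<otimes>\<^bsub>?P\<^esub> t) = h s \<otimes>\<^bsub>?N\<^esub> h t"
        unfolding uv(2,4) mult_trace using h[OF uv(1)] h[OF uv(3)] M.word_eval_append[OF cl uv(1,3)] by simp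
    qed
    moreover have "inj_on h (carrier ?P)"
    proof (rule inj_onI)
      fix s t assume st: "s \<in> carrier ?P" "t \<in> carrier ?P" "h s = h t"
      then obtain u v where uv: "u \<in> lists X" "s = trace ?I u" "v \<in> lists X" "t = trace ?I v"
        unfolding car by blast
      then show "s = t" using inj st(3) h by (simp add: pres_class_eq_iff)
    qed
    moreover have "h ` carrier ?P = carrier ?N"
      unfolding car image_image using h by (simp add: hull cong: image_cong)
    ultimately have "h \<in> iso ?P ?N" by (auto simp: iso_def bij_betw_def)
    moreover have "h (letter ?I x) = x" if "x \<in> X" for x
      using h[of "[x]"] that X by (auto simp: letter_def)
    ultimately show "pc_code A \<theta> X" unfolding pc_code_def by blast
  next
    assume "pc_code A \<theta> X"
    then obtain \<phi> where \<phi>: "\<phi> \<in> iso ?P ?N" "\<forall>x\<in>X. \<phi> (letter ?I x) = x" unfolding pc_code_def by blast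
    interpret P: Group.monoid ?P by (rule monoid_pc_monoid)
    have hom: "\<phi> (s \<otimes>\<^bsub>?P\<^esub> t) = \<phi> s \<otimes>\<^bsub>?M\<^esub> \<phi> t" if "s \<in> carrier ?P" "t \<in> carrier ?P" for s t
      using \<phi>(1) that by (simp add: iso_def hom_def)
    have inj: "inj_on \<phi> (carrier ?P)" using \<phi>(1) by (simp add: iso_def bij_betw_def)
    have ne: "\<phi> (trace ?I (x # w)) = ?ev (x # w)" if "x \<in> X" "w \<in> lists X" for x w
      using that(2,1)
    proof (induction w arbitrary: x)
      case Nil
      then show ?case using \<phi>(2) X by (auto simp: letter_def)
    next
      case (Cons y w)
      have "\<phi> (trace ?I [x] \<otimes>\<^bsub>?P\<^esub> trace ?I (y # w)) = x \<otimes>\<^bsub>?M\<^esub> ?ev (y # w)"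
        using hom[of "trace ?I [x]" "trace ?I (y # w)"] Cons \<phi>(2)
          trace_in_carrier[of "[x]" X ?I] trace_in_carrier[of "y # w" X ?I] by (simp add: letter_def)
      then show ?case by (simp add: mult_trace)
    qed
    \<comment> \<open>A multiplicative map need not preserve the unit, but a surjective one does.\<close>
    obtain s where s: "s \<in> carrier ?P" "\<phi> s = \<one>\<^bsub>?M\<^esub>"
    proof -
      have "\<one>\<^bsub>?M\<^esub> \<in> carrier ?N" by (simp add: hull) (auto intro!: image_eqI[of _ _ "[]"])
      then have "\<one>\<^bsub>?M\<^esub> \<in> \<phi> ` carrier ?P" using \<phi>(1) by (simp add: iso_def bij_betw_def)
      then show ?thesis using that by (metis imageE)
    qed
    have "\<phi> \<one>\<^bsub>?P\<^esub> \<in> carrier ?M"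
    proof -
      have "\<phi> \<one>\<^bsub>?P\<^esub> \<in> carrier ?N" using \<phi>(1) P.one_closed by (auto simp: iso_def hom_def)
      then obtain w where "w \<in> lists X" "\<phi> \<one>\<^bsub>?P\<^esub> = ?ev w" by (auto simp: hull)
      then show ?thesis using M.word_eval_closed[OF cl] by metis
    qed
    then have "\<phi> \<one>\<^bsub>?P\<^esub> = \<one>\<^bsub>?M\<^esub>" using hom[OF s(1) P.one_closed] s by simp
    then have "\<phi> (trace ?I []) = ?ev []" by (simp add: pc_monoid_def one_monoid_pres)
    then have val: "\<phi> (trace ?I w) = ?ev w" if "w \<in> lists X" for w
      using ne that by (cases w) auto
    show ?inj
    proof (intro ballI impI)
      fix u v assume uv: "u \<in> lists X" "v \<in> lists X" "?ev u = ?ev v"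
      then have "trace ?I u = trace ?I v"
        using inj_onD[OF inj] val trace_in_carrier[OF uv(1)] trace_in_carrier[OF uv(2)] by metis
      then show "(u, v) \<in> pres_cong (comm_rels ?I)" by (simp add: pres_class_eq_iff)
    qed
  qed
qed

context indep_partition
begin

lemma sym_\<theta>: "sym \<theta>" and irrefl_\<theta>: "irrefl \<theta>"
  using indep by (auto simp: independence_alphabet_def)

text \<open>Factorizations over \<open>beta\<close> are handled as lists of pairs \<open>(z, w)\<close>, so that equality of their products
  is a congruence of concrete words.\<close>

definition anchored_pair :: "'a \<times> 'a list \<Rightarrow> bool" where
  "anchored_pair p \<longleftrightarrow> fst p \<in> Z \<and> snd p \<in> lists B \<and> anchored \<theta> (fst p) (snd p)"

definition flat :: "('a \<times> 'a list) list \<Rightarrow> 'a list" where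
  "flat ps = concat (map (\<lambda>p. fst p # snd p) ps)"

lemma flat_simps [simp]: "flat [] = []" "flat (p # ps) = fst p # snd p @ flat ps"
  "flat (ps @ qs) = flat ps @ flat qs"
  by (simp_all add: flat_def)

text \<open>In a product of anchored factors every letter of \<open>B\<close> is blocked within its own factor. Hence the
  initial letters in \<open>B\<close> of \<open>w\<close> followed by such a product are those of \<open>w\<close>
  (\<open>flat_cancel_prefix\<close>).\<close>

lemma not_initial_flat:
  assumes "b \<in> B" "\<forall>p\<in>set ps. anchored_pair p"
  shows "\<not> initial \<theta> b (flat ps)"
  using assms(2)
proof (induction ps)
  case (Cons p ps)
  have "b \<noteq> fst p" using Cons.prems assms(1) Z_notB by (auto simp: anchored_pair_def)
  then show ?case using Cons by (auto simp: anchored_pair_def anchored_def initial_append)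
qed simp

lemma flat_cancel_prefix:
  assumes "\<forall>p\<in>set ps. anchored_pair p" "\<forall>p\<in>set qs. anchored_pair p"
    and "w \<in> lists B" "w' \<in> lists B"
    and "(w @ flat ps, w' @ flat qs) \<in> pres_cong (comm_rels \<theta>)"
  shows "(w, w') \<in> pres_cong (comm_rels \<theta>) \<and> (flat ps, flat qs) \<in> pres_cong (comm_rels \<theta>)"
  using assms(3-)
proof (induction w arbitrary: w')
  case Nil
  have "w' = []"
  proof (cases w')
    case (Cons b v)
    then have "initial \<theta> b (flat ps)" "b \<in> B"
      using initial_cong[OF sym_\<theta> Nil(2), of b] Nil(1) by auto
    then show ?thesis using not_initial_flat assms(1) by blast
  qed
  then show ?case using Nil by (simp add: pres_cong.refl)
next
  case (Cons b w)
  have "initial \<theta> b (w' @ flat qs)" "b \<in> B"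
    using initial_cong[OF sym_\<theta> Cons.prems(2), of b] Cons.hyps(1) by auto
  then have i: "initial \<theta> b w'"
    using not_initial_flat[OF _ assms(2)] by (auto simp: initial_append)
  note f = initial_to_front[OF sym_\<theta> i]
  from pres_cong_context[OF f, of "[]" "flat qs"] Cons.prems(2)
  have "(b # (w @ flat ps), b # (remove1 b w' @ flat qs)) \<in> pres_cong (comm_rels \<theta>)"
    by (auto intro: pres_cong.trans)
  then have "(w @ flat ps, remove1 b w' @ flat qs) \<in> pres_cong (comm_rels \<theta>)"
    by (rule trace_cancel_Cons)
  moreover have "remove1 b w' \<in> lists B"
    using Cons.prems(1) set_remove1_subset[of b w'] by (auto simp: lists_eq_set)
  ultimately have "(w, remove1 b w') \<in> pres_cong (comm_rels \<theta>) \<and> (flat ps, flat qs) \<in> pres_cong (comm_rels \<theta>)"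
    by (rule Cons.IH[rotated])
  then show ?case using f by (auto intro: pres_cong.trans pres_cong.sym pres_cong_Cons)
qed

text \<open>A letter of \<open>Z\<close> can only occur as the head of a factor.\<close>

lemma initial_flat_Z:
  assumes "z \<in> Z" "\<forall>p\<in>set ps. anchored_pair p" "initial \<theta> z (flat ps)"
  shows "\<exists>ps1 w ps2. ps = ps1 @ (z, w) # ps2 \<and> (\<forall>p\<in>set ps1. (fst p, z) \<in> \<theta>)"
  using assms(2,3)
proof (induction ps)
  case (Cons p ps)
  show ?case
  proof (cases "z = fst p")
    case True
    then show ?thesis by (intro exI[of _ "[]"] exI[of _ "snd p"] exI[of _ ps]) (simp add: prod_eq_iff)
  next
    case False
    have "z \<notin> set (snd p)" using Cons.prems(1) Z_notB[OF assms(1)] by (auto simp: anchored_pair_def)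
    then have "\<not> initial \<theta> z (snd p)" using initial_in_set by fast
    then have pz: "(fst p, z) \<in> \<theta>" and "initial \<theta> z (flat ps)"
      using Cons.prems(2) False by (auto simp: initial_append)
    then obtain ps1 w ps2 where "ps = ps1 @ (z, w) # ps2" "\<forall>p\<in>set ps1. (fst p, z) \<in> \<theta>"
      using Cons by auto
    then show ?thesis using pz by (intro exI[of _ "p # ps1"] exI[of _ w] exI[of _ ps2]) simp
  qed
qed simp

abbreviation \<beta>_pos :: "'a list set set" where
  "\<beta>_pos \<equiv> beta A \<theta> Z B"

definition pair_trace :: "'a \<times> 'a list \<Rightarrow> 'a list set" where
  "pair_trace p = trace \<theta> (fst p # snd p)"

lemma beta_pos: "\<beta>_pos = pair_trace ` Collect anchored_pair"
  unfolding beta_trace[OF sym_\<theta> irrefl_\<theta> Z_sub B_sub]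
proof (intro equalityI subsetI)
  fix t assume "t \<in> {trace \<theta> (z # w) | z w. z \<in> Z \<and> w \<in> lists B \<and> anchored \<theta> z w}"
  then obtain z w where "t = trace \<theta> (z # w)" "z \<in> Z" "w \<in> lists B" "anchored \<theta> z w" by blast
  then have "t = pair_trace (z, w)" "anchored_pair (z, w)"
    by (simp_all add: pair_trace_def anchored_pair_def)
  then show "t \<in> pair_trace ` Collect anchored_pair" by blast
next
  fix t assume "t \<in> pair_trace ` Collect anchored_pair"
  then obtain p where "t = pair_trace p" "anchored_pair p" by blast
  then show "t \<in> {trace \<theta> (z # w) | z w. z \<in> Z \<and> w \<in> lists B \<and> anchored \<theta> z w}"
    unfolding pair_trace_def anchored_pair_def by blast
qed

text \<open>Let \<open>z\<close> be the head of the first factor on the left. It is initial, so on the right it heads a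
  factor \<open>z w'\<close>, and the heads of the factors before that commute with \<open>z\<close>. By separation these
  factors are independent of \<open>z w'\<close>, which can thus be moved to the front. After cancelling \<open>z\<close>,
  \<open>flat_cancel_prefix\<close> identifies \<open>w\<close> with \<open>w'\<close>, and induction applies to the remaining factors.\<close>

lemma separated_flat_inject:
  assumes sep: separated
    and "\<forall>p\<in>set ps. anchored_pair p" "\<forall>p\<in>set qs. anchored_pair p"
    and "(flat ps, flat qs) \<in> pres_cong (comm_rels \<theta>)"
  shows "(map pair_trace ps, map pair_trace qs) \<in> pres_cong (comm_rels (induced_indep \<theta> \<beta>_pos))"
  using assms(2-)
proof (induction ps arbitrary: qs)
  case Nil
  then have "flat qs = []" using comm_cong_same(2) by fastforce
  then show ?case by (cases qs) (simp_all add: pres_cong.refl)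
next
  case (Cons p ps)
  let ?I = "induced_indep \<theta> \<beta>_pos"
  obtain z w where p: "p = (z, w)" by (cases p)
  have z: "z \<in> Z" using Cons.prems(1) p by (simp add: anchored_pair_def)
  have "initial \<theta> z (flat qs)"
    using initial_cong[OF sym_\<theta> Cons.prems(3), of z] p by simp
  from initial_flat_Z[OF z Cons.prems(2) this]
  obtain qs1 w' qs2 where qs: "qs = qs1 @ (z, w') # qs2" "\<forall>q\<in>set qs1. (fst q, z) \<in> \<theta>" by blast
  let ?q = "(z, w')"
  have a: "anchored_pair ?q" "\<forall>q\<in>set (qs1 @ qs2). anchored_pair q" using Cons.prems(2) qs(1) by auto
  have ind: "set (z # w') \<times> set (fst q # snd q) \<subseteq> \<theta>" if q: "q \<in> set qs1" for q
    using a q qs(2) z \<theta>_sym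
    by (intro separated_alph[OF sep, of _ "\<lambda>x. x"]) (auto simp: anchored_pair_def)
  have "set (z # w') \<times> set (flat qs1) \<subseteq> \<theta>"
    using ind by (force simp: flat_def)
  from pres_cong_context[OF trace_commute[OF this], of "[]" "flat qs2"]
  have "(z # w' @ flat (qs1 @ qs2), flat qs) \<in> pres_cong (comm_rels \<theta>)"
    by (simp add: qs(1))
  then have "(z # (w @ flat ps), z # (w' @ flat (qs1 @ qs2))) \<in> pres_cong (comm_rels \<theta>)"
    using Cons.prems(3) p by (auto intro: pres_cong.trans pres_cong.sym)
  then have "(w @ flat ps, w' @ flat (qs1 @ qs2)) \<in> pres_cong (comm_rels \<theta>)"
    by (rule trace_cancel_Cons)
  then have ww: "(w, w') \<in> pres_cong (comm_rels \<theta>)"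
    and "(flat ps, flat (qs1 @ qs2)) \<in> pres_cong (comm_rels \<theta>)"
    using flat_cancel_prefix[of ps "qs1 @ qs2" w w'] Cons.prems(1) a p by (auto simp: anchored_pair_def)
  then have IH: "(map pair_trace ps, map pair_trace (qs1 @ qs2)) \<in> pres_cong (comm_rels ?I)"
    using Cons.prems(1) a by (intro Cons.IH) auto
  have pq: "pair_trace p = pair_trace ?q"
    using pres_cong_Cons[OF ww] by (simp add: p pair_trace_def pres_class_eq_iff)
  have "(pair_trace ?q, t) \<in> ?I" if "t \<in> set (map pair_trace qs1)" for t
  proof -
    obtain q where q: "q \<in> set qs1" "t = pair_trace q" using \<open>t \<in> _\<close> by auto
    then have "pair_trace ?q \<in> \<beta>_pos" "t \<in> \<beta>_pos" unfolding beta_pos using a by auto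
    moreover have "Alph (pair_trace ?q) \<times> Alph t \<subseteq> \<theta>"
      unfolding q(2) pair_trace_def Alph_trace using ind[OF q(1)] by simp
    ultimately show ?thesis by (simp add: induced_indep_def)
  qed
  then have "(pair_trace ?q # map pair_trace qs1, map pair_trace qs1 @ [pair_trace ?q]) \<in> pres_cong (comm_rels ?I)"
    by (rule trace_move)
  from pres_cong_context[OF this, of "[]" "map pair_trace qs2"]
  have "(pair_trace p # map pair_trace (qs1 @ qs2), map pair_trace qs) \<in> pres_cong (comm_rels ?I)"
    by (simp add: qs(1) pq)
  then show ?case using pres_cong_Cons[OF IH, of "pair_trace p"] by (auto intro: pres_cong.trans)
qed

lemma beta_pos_eval:
  assumes "u \<in> lists \<beta>_pos"
  shows "\<exists>ps. u = map pair_trace ps \<and> (\<forall>p\<in>set ps. anchored_pair p) \<and>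
    word_eval (pc_monoid A \<theta>) (\<lambda>x. x) u = trace \<theta> (flat ps)"
  using assms
proof induction
  case Nil
  show ?case by (intro exI[of _ "[]"]) (simp add: pc_monoid_def one_monoid_pres)
next
  case (Cons t u)
  then obtain ps p where "u = map pair_trace ps" "\<forall>p\<in>set ps. anchored_pair p"
    "word_eval (pc_monoid A \<theta>) (\<lambda>x. x) u = trace \<theta> (flat ps)" "anchored_pair p" "t = pair_trace p"
    by (auto simp: beta_pos)
  then show ?case by (intro exI[of _ "p # ps"]) (simp add: pair_trace_def mult_trace)
qed

text \<open>Without separation, \<open>z (z' c b) = (z' c) (z b)\<close> for a path as in \<open>not_separatedE\<close>, because \<open>z\<close> commutes
  with \<open>z'\<close> and \<open>c\<close>. The two factorizations do not even use the same elements of \<open>beta\<close>.\<close>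

lemma TFSA_iff_separated: "TFSA A \<theta> B \<longleftrightarrow> separated"
proof -
  let ?I = "induced_indep \<theta> \<beta>_pos" and ?M = "pc_monoid A \<theta>"
  have "\<beta>_pos \<subseteq> carrier ?M"
  proof
    fix t assume "t \<in> \<beta>_pos"
    then obtain p where p: "anchored_pair p" "t = pair_trace p" unfolding beta_pos by blast
    have "fst p # snd p \<in> lists A"
      using p(1) subsetD[OF Z_sub] subsetD[OF B_sub] by (auto simp: anchored_pair_def)
    then show "t \<in> carrier ?M" unfolding p(2) pair_trace_def by (rule trace_in_carrier)
  qed
  note code = pc_code_iff[OF this]
  have "pc_code A \<theta> \<beta>_pos \<longleftrightarrow> separated"
  proof
    assume sep: separated
    show "pc_code A \<theta> \<beta>_pos"
      unfolding code
    proof (intro ballI impI)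
      fix u v assume uv: "u \<in> lists \<beta>_pos" "v \<in> lists \<beta>_pos"
        "word_eval ?M (\<lambda>x. x) u = word_eval ?M (\<lambda>x. x) v"
      obtain ps where ps: "u = map pair_trace ps" "\<forall>p\<in>set ps. anchored_pair p"
        "word_eval ?M (\<lambda>x. x) u = trace \<theta> (flat ps)" using beta_pos_eval[OF uv(1)] by blast
      obtain qs where qs: "v = map pair_trace qs" "\<forall>p\<in>set qs. anchored_pair p"
        "word_eval ?M (\<lambda>x. x) v = trace \<theta> (flat qs)" using beta_pos_eval[OF uv(2)] by blast
      have "(flat ps, flat qs) \<in> pres_cong (comm_rels \<theta>)"
        using uv(3) ps(3) qs(3) by (metis pres_class_eq_iff)
      then show "(u, v) \<in> pres_cong (comm_rels ?I)"
        unfolding ps(1) qs(1) by (rule separated_flat_inject[OF sep ps(2) qs(2)])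
    qed
  next
    assume pc: "pc_code A \<theta> \<beta>_pos"
    show separated
    proof (rule ccontr)
      assume "\<not> separated"
      then obtain z z' c b where z: "z \<in> Z" "z' \<in> Z" "(z, z') \<in> \<theta>" and cb: "set c \<subseteq> B" "b \<in> B"
        "\<And>y. y \<in> set c \<Longrightarrow> (z, y) \<in> \<theta>" "(z, b) \<notin> \<theta>"
        and path: "successively (\<lambda>x y. (x, y) \<notin> \<theta>) (z' # c @ [b])"
        by (rule not_separatedE) blast
      let ?u = "[pair_trace (z, []), pair_trace (z', c @ [b])]"
      let ?v = "[pair_trace (z', c), pair_trace (z, [b])]"
      have "successively (\<lambda>x y. (x, y) \<notin> \<theta>) (z' # c)"
        using path successively_append_iff[of "\<lambda>x y. (x, y) \<notin> \<theta>" "z' # c" "[b]"] by simp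
      then have "anchored_pair (z, [])" "anchored_pair (z', c @ [b])"
        "anchored_pair (z', c)" "anchored_pair (z, [b])"
        using z cb path anchored_successively[of \<theta> z' "c @ [b]"] anchored_successively[of \<theta> z' c]
        by (auto simp: anchored_pair_def) (auto simp: anchored_def)
      then have uv: "?u \<in> lists \<beta>_pos" "?v \<in> lists \<beta>_pos" by (simp_all add: beta_pos)
      have "(z # z' # c, (z' # c) @ [z]) \<in> pres_cong (comm_rels \<theta>)"
        using z cb by (intro trace_move) auto
      from pres_cong_context[OF this, of "[]" "[b]"]
      have "trace \<theta> (z # z' # c @ [b]) = trace \<theta> (z' # c @ [z, b])" by (simp add: pres_class_eq_iff)
      then have "word_eval ?M (\<lambda>x. x) ?u = word_eval ?M (\<lambda>x. x) ?v"
        by (simp add: pair_trace_def mult_trace pc_monoid_def one_monoid_pres pres_mult_class)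
      then have "(?u, ?v) \<in> pres_cong (comm_rels ?I)" using pc uv unfolding code by blast
      then have "set ?u = set ?v" by (rule comm_cong_same(1))
      then have "pair_trace (z, []) \<in> set ?v" using list.set_intros(1) by metis
      then have "pair_trace (z, []) = pair_trace (z', c) \<or> pair_trace (z, []) = pair_trace (z, [b])" by simp
      then have "Alph (trace \<theta> [z]) = Alph (trace \<theta> (z' # c)) \<or> Alph (trace \<theta> [z]) = Alph (trace \<theta> [z, b])"
        by (auto simp: pair_trace_def)
      then have "z = z' \<or> z = b" unfolding Alph_trace by auto
      then show False using z cb \<theta>_irrefl Z_notB by auto
    qed
  qed
  then show ?thesis using B_sub by (simp add: TFSA_def Z_eq)
qed

end

theorem proposition28:
  fixes A B Z :: "'a set" and \<theta> :: "('a \<times> 'a) set"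
  assumes "independence_alphabet A \<theta>"
    and "B \<union> Z = A" and "B \<inter> Z = {}"
  shows
    "((\<exists>\<iota> \<in> iso (pc_group B (restr \<theta> B))
               ((pc_group A \<theta>)\<lparr>carrier := generate (pc_group A \<theta>) (gen A \<theta> ` B)\<rparr>).
         \<forall>b\<in>B. \<iota> (gen B (restr \<theta> B) b) = gen A \<theta> b) \<and>
      internal_semidirect (pc_group A \<theta>)
        (generate (pc_group A \<theta>) (gen A \<theta> ` B)) (H_Z A \<theta> Z) \<and>
      H_Z A \<theta> Z = generate (pc_group A \<theta>) (rho A \<theta> Z B)) \<and>
     (\<exists>\<phi> \<in> iso (pc_group (rho A \<theta> Z B) (rho_indep A \<theta> Z B)) (H_group A \<theta> Z).
        \<forall>t\<in>rho A \<theta> Z B. \<phi> (gen (rho A \<theta> Z B) (rho_indep A \<theta> Z B) t) = t) \<and>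
     (\<exists>\<alpha> \<in> hom (pc_group (betaR A \<theta> Z B) (induced_indep (tilde_indep A \<theta>) (betaR A \<theta> Z B)))
              (H_group A \<theta> Z).
        (\<forall>(z, w) \<in> zw_pairs A \<theta> Z B.
           \<alpha> (gen (betaR A \<theta> Z B) (induced_indep (tilde_indep A \<theta>) (betaR A \<theta> Z B))
                (zw_trace A \<theta> z w)) = zw_conj A \<theta> z w) \<and>
        (inj_on \<alpha> (carrier (pc_group (betaR A \<theta> Z B)
                              (induced_indep (tilde_indep A \<theta>) (betaR A \<theta> Z B)))) \<longleftrightarrow>
         TFSA A \<theta> B))"
proof -
  interpret indep_partition A \<theta> B Z
    using assms by unfold_locales
  show ?thesis
  proof (intro conjI)
    show "H_Z A \<theta> Z = generate F (rho A \<theta> Z B)" by (simp add: H_Z_eq rho_eq)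
    have "\<forall>(z, w)\<in>zw_pairs A \<theta> Z B. \<alpha> (gen \<beta> \<beta>_indep (zw_trace A \<theta> z w)) = zw_conj A \<theta> z w"
      using \<alpha>_zw by blast
    moreover have "inj_on \<alpha> (carrier (pc_group \<beta> \<beta>_indep)) \<longleftrightarrow> TFSA A \<theta> B"
      by (simp only: \<alpha>_inj_iff_separated TFSA_iff_separated)
    ultimately show "\<exists>\<alpha>\<in>hom (pc_group \<beta> \<beta>_indep) (H_group A \<theta> Z).
        (\<forall>(z, w)\<in>zw_pairs A \<theta> Z B. \<alpha> (gen \<beta> \<beta>_indep (zw_trace A \<theta> z w)) = zw_conj A \<theta> z w) \<and>
        (inj_on \<alpha> (carrier (pc_group \<beta> \<beta>_indep)) \<longleftrightarrow> TFSA A \<theta> B)"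
      using \<alpha>_hom by blast
  qed (rule iso_B semidirect iso_rho)+
qed

end
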